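(* Let $n\ge5$, $p\ge1$, let $\mathcal V_{a,T}=\Lambda^*v_{a,T}$ be an Emden--Fowler solution in cylindrical coordinates, and let $\mathcal L^a_j$, $j=0,1,2,\dots$, be the projection onto the $j$-th spherical eigenmode of the linearized operator around $\mathcal V_{a,T}$. Then: (i) For $j=0$, the homogeneous equation $\mathcal L^a_0(\Phi)=0$ has a solutions basis with $2p$ elements, which are either bounded or at most linearly growing as $t\to\infty$. (ii) For each $j\ge1$, the homogeneous equation $\mathcal L^a_j(\Phi)=0$ has a solutions basis with $4p$ elements, which are exponentially growing/decaying as $t\to\infty$.
   Context: Constants: $2^{**}=2n/(n-4)$, $c(n)=n(n-4)(n^2-4)/16$, $K_0=n^2(n-4)^2/16$, $K_2=(n^2-4n+8)/2$, $J_0=n(n-4)/2$, $a_0=[n(n-4)/(n^2-4)]^{(n-4)/8}$. Emden--Fowler solutions: for $a\in(0,a_0]$, $v_a$ denotes the positive bounded periodic solution on $\mathbb R$ of $v^{(4)}-K_2v^{(2)}+K_0v=c(n)v^{2^{**}-1}$ with $v(0)=a=\min v$, $v^{(1)}(0)=v^{(3)}(0)=0$, $v^{(2)}(0)=b(a)$, where $b(a)$ is the unique (shooting) value for which such a solution exists; $T_a$ is its fundamental period, and $v_{a,T}(t)=v_a(t+T)$ for $T\in(0,T_a]$ (for $a=a_0$, $v_{a_0}\equiv a_0$). In the vectorial case $\mathcal V_{a,T}=\Lambda^*v_{a,T}$ with $\Lambda^*\in\mathbb S^{p-1}$, $\Lambda^*_i>0$ for all $i$. Linearized operator: on the cylinder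 $\mathcal C_0=(0,\infty)\times\mathbb S^{n-1}$ let $\Delta^2_{\rm cyl}=\partial_t^{(4)}-K_2\partial_t^{(2)}+K_0+\Delta_\theta^2+2\partial_t^{(2)}\Delta_\theta-J_0\Delta_\theta$, where $\Delta_\theta$ is the Laplace--Beltrami operator of $\mathbb S^{n-1}$, and $\mathcal N(\mathcal V)_i=\Delta^2_{\rm cyl}v_i-c(n)|\mathcal V|^{2^{**}-2}v_i$. Then $\mathcal L^a$ is the Fréchet derivative of $\mathcal N$ at $\mathcal V_{a,T}$. Projection: let $0=\lambda_0<\lambda_1=\dots=\lambda_n=n-1<\lambda_{n+1}\le\cdots$ be the eigenvalues of $-\Delta_\theta$ counted with multiplicity. Then $\mathcal L^a_j$ acts on $\Phi=(\phi_1,\dots,\phi_p)$, $\phi_i=\phi_i(t)$, by $$(\mathcal L^a_j\Phi)_i=\phi_i^{(4)}-(K_2+2\lambda_j)\phi_i^{(2)}+[K_0+\lambda_j(\lambda_j+J_0)]\phi_i-c(n)v_{a,T}^{2^{**}-2}\big[(2^{**}-2)\Lambda^*_i\langle\Lambda^*,\Phi\rangle+\phi_i\big].$$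
   Formalization: In (i) all solutions of the homogeneous equation form a 4p-dimensional space, so no 2p-element set is a basis of it; the claim proved is that the solutions growing at most linearly as t→+∞ and as t→−∞ form a space with a basis of 2p elements. *)

theory Defs
  imports "HOL-Analysis.Analysis" "HOL-Library.Function_Algebras" "HOL-Library.Landau_Symbols"
begin

definition fun_scale :: "real \<Rightarrow> ('a \<Rightarrow> 'b::real_vector) \<Rightarrow> 'a \<Rightarrow> 'b" where
  "fun_scale c f = (\<lambda>x. c *\<^sub>R f x)"

interpretation fun_vs: vector_space "fun_scale :: real \<Rightarrow> ('a \<Rightarrow> 'b::real_vector) \<Rightarrow> 'a \<Rightarrow> 'b"
  by unfold_locales (auto simp: fun_scale_def fun_eq_iff scaleR_add_right scaleR_add_left)


definition crit_exp :: "nat \<Rightarrow> real" where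
  "crit_exp n = 2 * real n / (real n - 4)"

definition c_const :: "nat \<Rightarrow> real" where
  "c_const n = real n * (real n - 4) * ((real n)\<^sup>2 - 4) / 16"

definition K0 :: "nat \<Rightarrow> real" where
  "K0 n = (real n)\<^sup>2 * (real n - 4)\<^sup>2 / 16"

definition K2 :: "nat \<Rightarrow> real" where
  "K2 n = ((real n)\<^sup>2 - 4 * real n + 8) / 2"

definition J0 :: "nat \<Rightarrow> real" where
  "J0 n = real n * (real n - 4) / 2"

definition a0 :: "nat \<Rightarrow> real" where
  "a0 n = (real n * (real n - 4) / ((real n)\<^sup>2 - 4)) powr ((real n - 4) / 8)"


definition four_times_differentiable :: "(real \<Rightarrow> real) \<Rightarrow> bool" where
  "four_times_differentiable f \<longleftrightarrow> (\<forall>k<4. \<forall>t. (deriv ^^ k) f field_differentiable at t)"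

definition is_period :: "(real \<Rightarrow> real) \<Rightarrow> real \<Rightarrow> bool" where
  "is_period f P \<longleftrightarrow> 0 < P \<and> (\<forall>t. f (t + P) = f t)"

definition is_fundamental_period :: "(real \<Rightarrow> real) \<Rightarrow> real \<Rightarrow> bool" where
  "is_fundamental_period f P \<longleftrightarrow> is_period f P \<and> (\<forall>Q. is_period f Q \<longrightarrow> P \<le> Q)"

definition ef_profile :: "nat \<Rightarrow> real \<Rightarrow> real \<Rightarrow> (real \<Rightarrow> real) \<Rightarrow> bool" where
  "ef_profile n a b v \<longleftrightarrow>
     four_times_differentiable v \<and>
     (\<forall>t. (deriv ^^ 4) v t - K2 n * (deriv ^^ 2) v t + K0 n * v t
            = c_const n * v t powr (crit_exp n - 1)) \<and>
     (\<forall>t. 0 < v t) \<and> bounded (range v) \<and> (\<exists>P. is_period v P) \<and>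
     v 0 = a \<and> (\<forall>t. a \<le> v t) \<and>
     deriv v 0 = 0 \<and> (deriv ^^ 3) v 0 = 0 \<and> (deriv ^^ 2) v 0 = b"

definition shooting_value :: "nat \<Rightarrow> real \<Rightarrow> real" where
  "shooting_value n a = (THE b. \<exists>v. ef_profile n a b v)"

definition emden_fowler :: "nat \<Rightarrow> real \<Rightarrow> (real \<Rightarrow> real) \<Rightarrow> bool" where
  "emden_fowler n a v \<longleftrightarrow> ef_profile n a (shooting_value n a) v"


fun Ck_on :: "nat \<Rightarrow> ('a::euclidean_space \<Rightarrow> real) \<Rightarrow> 'a set \<Rightarrow> bool" where
  "Ck_on 0 g S \<longleftrightarrow> continuous_on S g"
| "Ck_on (Suc k) g S \<longleftrightarrow>
     (\<exists>G. (\<forall>x\<in>S. (g has_derivative (\<lambda>h. G x \<bullet> h)) (at x)) \<and>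
          (\<forall>e\<in>Basis. Ck_on k (\<lambda>x. G x \<bullet> e) S))"

definition laplacian :: "('a::euclidean_space \<Rightarrow> real) \<Rightarrow> 'a \<Rightarrow> real" where
  "laplacian g x = (\<Sum>e\<in>Basis. (deriv ^^ 2) (\<lambda>s. g (x + s *\<^sub>R e)) 0)"

text \<open>On the unit sphere the Laplace--Beltrami operator is the Euclidean Laplacian of the
  extension that is constant along rays, and smoothness is smoothness of that extension
  off the origin.\<close>

definition radial_ext :: "('a::euclidean_space \<Rightarrow> real) \<Rightarrow> 'a \<Rightarrow> real" where
  "radial_ext f = (\<lambda>y. f (y /\<^sub>R norm y))"

definition smooth_on_sphere :: "('a::euclidean_space \<Rightarrow> real) \<Rightarrow> bool" where
  "smooth_on_sphere f \<longleftrightarrow> (\<forall>k. Ck_on k (radial_ext f) (- {0}))"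

definition sphere_laplacian :: "('a::euclidean_space \<Rightarrow> real) \<Rightarrow> 'a \<Rightarrow> real" where
  "sphere_laplacian f x = laplacian (radial_ext f) x"

text \<open>Functions on the sphere are represented by functions vanishing off the sphere, so that
  the dimension below is that of a space of functions on the sphere.\<close>

definition sphere_eigenspace :: "real \<Rightarrow> ('a::euclidean_space \<Rightarrow> real) set" where
  "sphere_eigenspace \<mu> = {f. smooth_on_sphere f \<and> (\<forall>x. x \<notin> sphere 0 1 \<longrightarrow> f x = 0) \<and>
     (\<forall>x\<in>sphere 0 1. - sphere_laplacian f x = \<mu> * f x)}"

definition sphere_eigenvalues :: "('a::euclidean_space) itself \<Rightarrow> (nat \<Rightarrow> real) \<Rightarrow> bool" where
  "sphere_eigenvalues _ ev \<longleftrightarrow>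
     mono ev \<and> ev 0 = 0 \<and> (\<forall>j\<in>{1..DIM('a)}. ev j = real DIM('a) - 1) \<and>
     real DIM('a) - 1 < ev (DIM('a) + 1) \<and>
     (\<forall>\<mu>. finite {j. ev j = \<mu>} \<and>
          card {j. ev j = \<mu>} = fun_vs.dim (sphere_eigenspace \<mu> :: ('a \<Rightarrow> real) set))"


text \<open>The action of the linearized operator on the spherical mode with eigenvalue \<open>l\<close>,
  for the background solution \<open>\<lambda>t. w t *\<^sub>R \<Lambda>\<close>.\<close>

definition Lproj ::
  "nat \<Rightarrow> real ^ 'p \<Rightarrow> (real \<Rightarrow> real) \<Rightarrow> real \<Rightarrow> (real \<Rightarrow> real ^ 'p) \<Rightarrow> real \<Rightarrow> real ^ 'p" where
  "Lproj n \<Lambda> w l \<Phi> t = (\<chi> i.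
     (deriv ^^ 4) (\<lambda>s. \<Phi> s $ i) t
     - (K2 n + 2 * l) * (deriv ^^ 2) (\<lambda>s. \<Phi> s $ i) t
     + (K0 n + l * (l + J0 n)) * \<Phi> t $ i
     - c_const n * w t powr (crit_exp n - 2)
         * ((crit_exp n - 2) * (\<Lambda> $ i) * (\<Lambda> \<bullet> \<Phi> t) + \<Phi> t $ i))"

definition mode_solutions ::
  "nat \<Rightarrow> real ^ 'p \<Rightarrow> (real \<Rightarrow> real) \<Rightarrow> real \<Rightarrow> (real \<Rightarrow> real ^ 'p) set" where
  "mode_solutions n \<Lambda> w l =
     {\<Phi>. (\<forall>i. four_times_differentiable (\<lambda>t. \<Phi> t $ i)) \<and> (\<forall>t. Lproj n \<Lambda> w l \<Phi> t = 0)}"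

text \<open>The filter \<open>at_infinity\<close> on the reals covers both ends of the line.  A one-sided bound
  would also admit the solutions that decay at one end and grow exponentially at the other.\<close>

definition at_most_linear :: "(real \<Rightarrow> 'b::real_normed_vector) \<Rightarrow> bool" where
  "at_most_linear \<Phi> \<longleftrightarrow> (\<lambda>t. norm (\<Phi> t)) \<in> O[at_infinity](\<lambda>t. t)"

definition exp_growing :: "real filter \<Rightarrow> (real \<Rightarrow> 'b::real_normed_vector) \<Rightarrow> bool" where
  "exp_growing F \<Phi> \<longleftrightarrow> (\<exists>\<delta>>0. (\<lambda>t. exp (\<delta> * \<bar>t\<bar>)) \<in> O[F](\<lambda>t. norm (\<Phi> t)))"

definition exp_decaying :: "real filter \<Rightarrow> (real \<Rightarrow> 'b::real_normed_vector) \<Rightarrow> bool" where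
  "exp_decaying F \<Phi> \<longleftrightarrow> (\<exists>\<delta>>0. (\<lambda>t. norm (\<Phi> t)) \<in> O[F](\<lambda>t. exp (- \<delta> * \<bar>t\<bar>)))"

text \<open>\<open>solution_basis B S\<close>: the set \<open>B\<close> is a basis of the space \<open>S\<close> of functions.\<close>

definition solution_basis :: "('a \<Rightarrow> 'b::real_vector) set \<Rightarrow> ('a \<Rightarrow> 'b) set \<Rightarrow> bool" where
  "solution_basis B S \<longleftrightarrow> fun_vs.independent B \<and> fun_vs.span B = S"

end

theory Submission
  imports Defs
begin

text \<open>
  The system of a spherical mode decouples: the component of \<open>\<Phi>\<close> along \<open>\<Lambda>\<close> and the components
  orthogonal to \<open>\<Lambda>\<close> each satisfy a scalar equation
  \<open>f'''' - (A + B) f'' + A B f = Q f\<close> with \<open>Q = \<theta> c(n) v\<^sup>q\<^sup>-\<^sup>1\<close>, where \<open>q = (n + 4) / (n - 4)\<close>,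
  \<open>\<theta> = q\<close> along \<open>\<Lambda>\<close> and \<open>\<theta> = 1\<close> across it.  Both \<open>A\<close> and \<open>B\<close> are
  positive, so with the companion \<open>g = f'' - B f\<close> the equation becomes the cooperative system
  \<open>f'' = B f + g\<close>, \<open>g'' = A g + Q f\<close>: data with non-negative entries at \<open>0\<close> stay non-negative for
  \<open>t \<ge> 0\<close>, and the solution grows faster than linearly unless it is zero (\<open>nonneg_solution_superlinear\<close>).

  Floquet theory takes a short form here.  Since \<open>v\<close> is even and has a period \<open>P\<close>, the map
  \<open>X \<mapsto> X(t + P) + X(t - P)\<close> preserves the plane of even and the plane of odd solutions, and in the
  natural coordinates its matrix on each plane has positive entries.  It therefore has real
  eigenvalues \<open>2 \<kappa> > 2 \<mu>\<close> with \<open>\<kappa> > 1\<close> and \<open>\<kappa> > \<bar>\<mu>\<bar>\<close>, and the solution belonging to \<open>\<kappa>\<close> is positive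
  for \<open>t > 0\<close> (\<open>parity_modes\<close>).  Everything depends on the size of \<open>\<mu>\<close>: the solutions belonging to
  \<open>\<mu>\<close> grow at most linearly if \<open>\<bar>\<mu>\<bar> \<le> 1\<close>, while \<open>\<bar>\<mu>\<bar> > 1\<close> holds as soon as there is no non-zero bounded
  solution.

  For the eigenvalue \<open>0\<close> of the sphere there is a bounded solution: \<open>v\<close> across \<open>\<Lambda>\<close>, and along \<open>\<Lambda>\<close> the
  derivative \<open>v'\<close>, or a cosine if \<open>v\<close> is constant.  Hence \<open>\<bar>\<mu>\<bar> \<le> 1\<close>, and the even and the odd solution
  belonging to \<open>\<mu>\<close> span the solutions of at most linear growth
  (\<open>bounded_solution_gives_slow_basis\<close>): two for each direction.

  For a spherical eigenvalue \<open>l \<ge> n - 1\<close> there is none.  The invariance of the original equation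
  under translations of Euclidean space provides, for \<open>l = n - 1\<close> and \<open>\<theta> = q\<close>, the solutions
  \<open>e\<^sup>t (v' + \<gamma> v)\<close> and \<open>e\<^sup>-\<^sup>t (\<gamma> v - v')\<close>, \<open>\<gamma> = (n - 4) / 2\<close>.  They and their (negated) companions are
  positive, and their sum tends to infinity at both ends.  A maximum principle for cooperative
  systems compares any bounded solution with multiples of this sum and shows that it vanishes
  (\<open>supersolution_excludes_bounded\<close>); raising \<open>l\<close> and lowering \<open>\<theta>\<close> only helps.  Hence \<open>\<bar>\<mu>\<bar> > 1\<close>, all
  multipliers are real, and none has modulus \<open>1\<close>.  A Floquet solution may still have zeros that
  recur for ever; adding a multiple of the positive solution with the dominant multiplier removes
  them on the growing side without spoiling the decay on the other
  (\<open>no_bounded_solution_gives_hyperbolic_basis\<close>): four solutions for each direction.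
\<close>

section \<open>Linear ordinary differential equations\<close>

lemma continuous_antiderivative:
  fixes f :: "real \<Rightarrow> 'a::euclidean_space"
  assumes "continuous_on UNIV f"
  shows "\<exists>F. F 0 = 0 \<and> (\<forall>t. (F has_vector_derivative f t) (at t))"
proof -
  have "\<exists>F. \<forall>x::real. - \<infinity> < ereal x \<longrightarrow> ereal x < \<infinity> \<longrightarrow> (F has_vector_derivative f x) (at x)"
    by (rule einterval_antiderivative) (use assms in \<open>auto simp: continuous_on_eq_continuous_at\<close>)
  then obtain F where F: "\<And>x. (F has_vector_derivative f x) (at x)" by auto
  have "((\<lambda>t. F t - F 0) has_vector_derivative f t) (at t)" for t
    using has_vector_derivative_diff[OF F has_vector_derivative_const] by simp
  then show ?thesis by (intro exI[of _ "\<lambda>t. F t - F 0"]) auto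
qed

lemma has_vector_derivative_reflect:
  assumes "(f has_vector_derivative f') (at (- t))"
  shows "((\<lambda>s. f (- s)) has_vector_derivative - f') (at t)"
proof -
  have "(uminus has_vector_derivative -1) (at t)"
    by (simp add: has_real_derivative_iff_has_vector_derivative[symmetric] DERIV_minus)
  from vector_diff_chain_at[OF this assms] show ?thesis by (simp add: o_def)
qed

text \<open>The step from one Picard iterate to the next: it gains one power of \<open>\<bar>t\<bar>\<close> and one factor of
  the factorial.\<close>
lemma norm_le_power_antiderivative:
  fixes F :: "real \<Rightarrow> 'a::real_normed_vector"
  assumes F0: "F 0 = 0" and F: "\<And>t. (F has_vector_derivative f t) (at t)"
    and f: "\<And>t. norm (f t) \<le> M * \<bar>t\<bar> ^ k"
  shows "norm (F t) \<le> M * \<bar>t\<bar> ^ Suc k / real (Suc k)"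
proof -
  have pos: "norm (G t) \<le> M * t ^ Suc k / real (Suc k)"
    if "0 \<le> t" "G 0 = 0" "\<And>t. (G has_vector_derivative g t) (at t)" "\<And>t. norm (g t) \<le> M * \<bar>t\<bar> ^ k"
    for G :: "real \<Rightarrow> 'a" and g and t :: real
  proof (cases "t = 0")
    case False
    let ?p = "\<lambda>s. M * s ^ Suc k / real (Suc k)"
    have p: "(?p has_vector_derivative M * s ^ k) (at s)" for s :: real
    proof -
      have "(?p has_real_derivative M * (real (Suc k) * s ^ k) / real (Suc k)) (at s)"
        using DERIV_cdivide[OF DERIV_cmult[OF DERIV_pow[of "Suc k" s UNIV], of M], of "real (Suc k)"]
        by (simp del: power_Suc)
      then show ?thesis by (simp add: has_real_derivative_iff_has_vector_derivative)
    qed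
    have "norm (G t - G 0) \<le> ?p t - ?p 0"
    proof (rule differentiable_bound_general)
      show "continuous_on {0..t} G"
        by (meson continuous_at_imp_continuous_on has_vector_derivative_continuous that(3))
      show "continuous_on {0..t} ?p" by (intro continuous_intros) simp
      show "norm (g s) \<le> M * s ^ k" if "0 < s" "s < t" for s using that \<open>\<And>t. norm (g t) \<le> _\<close>[of s] by simp
    qed (use that p False in auto)
    then show ?thesis using that by simp
  qed (use that in simp)
  show ?thesis
  proof (cases "t \<ge> 0")
    case True then show ?thesis using pos[of t F f] assms by simp
  next
    case False
    have "((\<lambda>s. F (- s)) has_vector_derivative - f (- s)) (at s)" for s
      by (rule has_vector_derivative_reflect[OF F])
    from pos[of "- t" "\<lambda>s. F (- s)" "\<lambda>s. - f (- s)", OF _ _ this] show ?thesis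
      using False F0 f[of "- s" for s] by simp
  qed
qed

text \<open>Picard iteration.  The iterates decay like \<open>(K \<bar>t\<bar>)\<^sup>k / k!\<close>, so their sum converges locally
  uniformly together with its derivative.  If the field preserves the non-negative orthant for
  \<open>t \<ge> 0\<close>, then so does every iterate, and hence the solution.\<close>
theorem linear_ode_exists:
  fixes A :: "real \<Rightarrow> 'a::euclidean_space \<Rightarrow> 'a"
  assumes lin: "\<And>t. linear (A t)"
    and bnd: "\<And>t x. norm (A t x) \<le> K * norm x"
    and cont: "\<And>f. continuous_on UNIV f \<Longrightarrow> continuous_on UNIV (\<lambda>t. A t (f t))"
  obtains X where "X 0 = x0" and "\<And>t. (X has_vector_derivative A t (X t)) (at t)"
    and "(\<And>t x. 0 \<le> t \<Longrightarrow> \<forall>b\<in>Basis. 0 \<le> x \<bullet> b \<Longrightarrow> \<forall>b\<in>Basis. 0 \<le> A t x \<bullet> b) \<Longrightarrow>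
      \<forall>b\<in>Basis. 0 \<le> x0 \<bullet> b \<Longrightarrow> (\<And>t. 0 \<le> t \<Longrightarrow> \<forall>b\<in>Basis. 0 \<le> X t \<bullet> b)"
proof -
  define J where "J f = (SOME F. F 0 = 0 \<and> (\<forall>t. (F has_vector_derivative A t (f t)) (at t)))"
    for f :: "real \<Rightarrow> 'a"
  define it where "it k = (J ^^ k) (\<lambda>_. x0)" for k
  have J: "J f 0 = 0" "\<And>t. (J f has_vector_derivative A t (f t)) (at t)"
    if "continuous_on UNIV f" for f
    using someI_ex[OF continuous_antiderivative[OF cont[OF that]]] unfolding J_def by auto
  have it0: "it 0 = (\<lambda>_. x0)" and itS: "it (Suc k) = J (it k)" for k by (auto simp: it_def)
  have cit: "continuous_on UNIV (it k)" for k
  proof (induction k)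
    case (Suc k)
    show ?case unfolding itS
      by (meson J(2)[OF Suc] continuous_at_imp_continuous_on has_vector_derivative_continuous)
  qed (simp add: it0)
  have dit: "(it (Suc k) has_vector_derivative A t (it k t)) (at t)" for k t
    unfolding itS using J(2)[OF cit] .
  have it_zero: "it (Suc k) 0 = 0" for k unfolding itS using J(1)[OF cit] .
  have K: "0 \<le> K" if "x0 \<noteq> 0" 
    using order_trans[OF norm_ge_zero bnd[of 0 x0]] that by (simp add: zero_le_mult_iff)
  have bit: "norm (it k t) \<le> norm x0 * K ^ k / fact k * \<bar>t\<bar> ^ k" for k t
  proof (induction k arbitrary: t)
    case (Suc k)
    have "norm (it (Suc k) t) \<le> (K * (norm x0 * K ^ k / fact k)) * \<bar>t\<bar> ^ Suc k / real (Suc k)"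
    proof (rule norm_le_power_antiderivative[OF it_zero dit])
      fix s
      show "norm (A s (it k s)) \<le> K * (norm x0 * K ^ k / fact k) * \<bar>s\<bar> ^ k"
      proof (cases "x0 = 0")
        case True
        then show ?thesis using Suc[of s] bnd[of s "it k s"] by simp
      next
        case False
        then show ?thesis
          using order_trans[OF bnd mult_left_mono[OF Suc K]] by (simp add: mult.assoc)
      qed
    qed
    also have "\<dots> = norm x0 * K ^ Suc k / fact (Suc k) * \<bar>t\<bar> ^ Suc k"
      by (simp add: field_simps)
    finally show ?case .
  qed (simp add: it0)
  define X where "X t = (\<Sum>k. it k t)" for t
  have smb: "summable (\<lambda>k. norm x0 * K ^ k / fact k * R ^ k)" for R :: real
    using summable_mult[OF summable_exp[of "K * R"], of "norm x0"] by (simp add: field_simps power_mult_distrib)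
  have sm: "summable (\<lambda>k. it k t)" for t
    by (rule summable_comparison_test'[OF smb[of "\<bar>t\<bar>"], of 0]) (use bit in auto)
  have dX: "(X has_vector_derivative A t (X t)) (at t)" for t
  proof -
    define R where "R = \<bar>t\<bar> + 1"
    let ?S = "ball 0 R :: real set"
    let ?f' = "\<lambda>k t. case k of 0 \<Rightarrow> 0 | Suc k \<Rightarrow> A t (it k t)"
    have t: "t \<in> ?S" by (simp add: R_def)
    have d: "(it k has_derivative (\<lambda>h. h *\<^sub>R ?f' k s)) (at s within ?S)" for k s
    proof (cases k)
      case (Suc j)
      then show ?thesis using dit[of j s] has_derivative_at_withinI by (auto simp: has_vector_derivative_def)
    qed (simp add: it0)
    have ul: "uniform_limit ?S (\<lambda>n s. \<Sum>k<n. it k s) X sequentially"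
      unfolding X_def
    proof (rule Weierstrass_m_test[OF _ smb[of R]])
      fix n s assume s: "s \<in> ?S"
      show "norm (it n s) \<le> norm x0 * K ^ n / fact n * R ^ n"
      proof (cases "x0 = 0")
        case True then show ?thesis using bit[of n s] by simp
      next
        case False
        then have "norm x0 * K ^ n / fact n * \<bar>s\<bar> ^ n \<le> norm x0 * K ^ n / fact n * R ^ n"
          using s K[OF False] by (intro mult_left_mono power_mono) auto
        then show ?thesis using bit[of n s] by linarith
      qed
    qed
    \<comment> \<open>the derivative of a partial sum is the field at the preceding partial sum\<close>
    have sumA: "(\<Sum>k<Suc n. ?f' k s) = A s (\<Sum>k<n. it k s)" for n s
      by (simp add: linear_sum[OF lin] sum.lessThan_Suc_shift del: sum.lessThan_Suc)
    have ev: "\<forall>\<^sub>F n in sequentially. \<forall>s\<in>?S. \<forall>h. norm ((\<Sum>k<n. h *\<^sub>R ?f' k s) - h *\<^sub>R A s (X s)) \<le> e * norm h"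
      if e: "e > 0" for e
    proof -
      have "\<forall>\<^sub>F n in sequentially. \<forall>s\<in>?S. dist (\<Sum>k<n. it k s) (X s) < e / (\<bar>K\<bar> + 1)"
        by (rule uniform_limitD[OF ul]) (use e in simp)
      then have "\<forall>\<^sub>F n in sequentially. \<forall>s\<in>?S. \<forall>h. norm ((\<Sum>k<Suc n. h *\<^sub>R ?f' k s) - h *\<^sub>R A s (X s)) \<le> e * norm h"
      proof (rule eventually_mono, intro ballI allI)
        fix n s h assume *: "\<forall>s\<in>?S. dist (\<Sum>k<n. it k s) (X s) < e / (\<bar>K\<bar> + 1)" and s: "s \<in> ?S"
        have "(\<Sum>k<Suc n. h *\<^sub>R ?f' k s) - h *\<^sub>R A s (X s) = h *\<^sub>R A s ((\<Sum>k<n. it k s) - X s)"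
          by (simp only: scaleR_sum_right[symmetric] sumA linear_diff[OF lin] scaleR_diff_right)
        moreover have "norm (A s ((\<Sum>k<n. it k s) - X s)) \<le> e"
        proof -
          let ?d = "norm ((\<Sum>k<n. it k s) - X s)"
          have "norm (A s ((\<Sum>k<n. it k s) - X s)) \<le> K * ?d" by (rule bnd)
          also have "\<dots> \<le> (\<bar>K\<bar> + 1) * ?d" by (intro mult_right_mono) auto
          also have "\<dots> \<le> (\<bar>K\<bar> + 1) * (e / (\<bar>K\<bar> + 1))"
            using *[rule_format, OF s] by (intro mult_left_mono) (auto simp: dist_norm)
          finally show ?thesis by simp
        qed
        ultimately show "norm ((\<Sum>k<Suc n. h *\<^sub>R ?f' k s) - h *\<^sub>R A s (X s)) \<le> e * norm h"
          by (simp only: norm_scaleR real_norm_def mult.commute[of e] mult_left_mono abs_ge_zero)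
      qed
      then show ?thesis
        by (rule eventually_sequentially_Suc[THEN iffD1])
    qed
    have "\<exists>g. \<forall>s\<in>?S. (\<lambda>n. it n s) sums g s \<and> (g has_derivative (\<lambda>h. h *\<^sub>R A s (X s))) (at s within ?S)"
      by (rule has_derivative_series[OF convex_ball d ev t summable_sums[OF sm]])
    then obtain g where g: "\<And>s. s \<in> ?S \<Longrightarrow> (\<lambda>n. it n s) sums g s"
      "\<And>s. s \<in> ?S \<Longrightarrow> (g has_derivative (\<lambda>h. h *\<^sub>R A s (X s))) (at s within ?S)" by blast
    have "g s = X s" if "s \<in> ?S" for s using sums_unique[OF g(1)[OF that]] by (simp add: X_def)
    then have "(X has_derivative (\<lambda>h. h *\<^sub>R A t (X t))) (at t within ?S)"
      using has_derivative_transform[OF t _ g(2)[OF t]] by auto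
    then show ?thesis using t by (simp add: has_vector_derivative_def at_within_open[OF t])
  qed
  have X0: "X 0 = x0"
  proof -
    have "X 0 = (\<Sum>k\<in>{0}. it k 0)" unfolding X_def
      by (rule suminf_finite) (use it_zero in \<open>auto simp: gr0_conv_Suc\<close>)
    then show ?thesis by (simp add: it0)
  qed
  show ?thesis
  proof (rule that[OF X0 dX])
    assume pos: "\<And>t x. 0 \<le> t \<Longrightarrow> \<forall>b\<in>Basis. 0 \<le> x \<bullet> b \<Longrightarrow> \<forall>b\<in>Basis. 0 \<le> A t x \<bullet> b"
      and x0: "\<forall>b\<in>Basis. 0 \<le> x0 \<bullet> b"
    have itpos: "0 \<le> it k t \<bullet> b" if "0 \<le> t" "b \<in> Basis" for k t b
      using that
    proof (induction k arbitrary: t b)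
      case (Suc k)
      have "it (Suc k) 0 \<bullet> b \<le> it (Suc k) t \<bullet> b"
      proof (rule DERIV_nonneg_imp_nondecreasing[OF Suc.prems(1)])
        fix s assume "0 \<le> s" "s \<le> t"
        then show "\<exists>y. ((\<lambda>t. it (Suc k) t \<bullet> b) has_real_derivative y) (at s) \<and> 0 \<le> y"
          using pos[of s "it k s"] Suc.IH[of s] Suc.prems
            bounded_linear.has_vector_derivative[OF bounded_linear_inner_left dit[of k s], of b]
          by (auto simp: has_real_derivative_iff_has_vector_derivative)
      qed
      then show ?case by (simp add: it_zero)
    qed (use x0 in \<open>simp add: it0\<close>)
    fix t :: real assume t: "0 \<le> t"
    show "\<forall>b\<in>Basis. 0 \<le> X t \<bullet> b"
    proof
      fix b :: 'a assume b: "b \<in> Basis"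
      have "(\<lambda>k. it k t \<bullet> b) sums (X t \<bullet> b)"
        unfolding X_def using bounded_linear.sums[OF bounded_linear_inner_left summable_sums[OF sm]] .
      then show "0 \<le> X t \<bullet> b" by (rule sums_le[OF _ sums_zero, rotated]) (rule itpos[OF t b])
    qed
  qed
qed

text \<open>Gronwall's argument: \<open>e\<^sup>-\<^sup>2\<^sup>K\<^sup>t \<bar>X\<bar>\<^sup>2\<close> does not increase for \<open>t \<ge> 0\<close>, and reflection covers \<open>t \<le> 0\<close>.
  The field enters through a bound on \<open>X'\<close>, so that the lemma also compares two solutions of a nonlinear
  equation.\<close>
theorem linear_ode_unique:
  fixes X :: "real \<Rightarrow> 'a::real_inner"
  assumes X: "\<And>t. (X has_vector_derivative X' t) (at t)"
    and bnd: "\<And>t. norm (X' t) \<le> K * norm (X t)" and X0: "X 0 = 0"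
  shows "X t = 0"
proof -
  have pos: "Y t = 0" if Y: "\<And>t. (Y has_vector_derivative Y' t) (at t)"
    "\<And>t. norm (Y' t) \<le> K * norm (Y t)" "Y 0 = 0" "0 \<le> t" for Y Y' :: "real \<Rightarrow> 'a" and t :: real
  proof -
    define F where "F t = exp (- (2 * K) * t) * (Y t \<bullet> Y t)" for t :: real
    have dF: "(F has_real_derivative exp (- (2 * K) * t) * (2 * (Y t \<bullet> Y' t)) - 2 * K * F t) (at t)" for t
    proof -
      have "((\<lambda>t. Y t \<bullet> Y t) has_derivative (\<lambda>h. h * (2 * (Y t \<bullet> Y' t)))) (at t)"
        using has_derivative_inner[of Y "\<lambda>h. h *\<^sub>R Y' t" t UNIV Y "\<lambda>h. h *\<^sub>R Y' t"] Y(1)[of t]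
        by (simp add: has_vector_derivative_def inner_commute algebra_simps)
      then have "((\<lambda>t. Y t \<bullet> Y t) has_real_derivative 2 * (Y t \<bullet> Y' t)) (at t)"
        by (simp add: has_field_derivative_def mult_commute_abs)
      then show ?thesis unfolding F_def
        by (auto intro!: derivative_eq_intros)
    qed
    have "F t \<le> F 0"
    proof (rule DERIV_nonpos_imp_nonincreasing[OF that(4)])
      fix s
      have "Y s \<bullet> Y' s \<le> norm (Y s) * norm (Y' s)" by (rule norm_cauchy_schwarz)
      also have "\<dots> \<le> norm (Y s) * (K * norm (Y s))" using Y(2) by (intro mult_left_mono) auto
      finally have "Y s \<bullet> Y' s \<le> K * (Y s \<bullet> Y s)" by (simp add: dot_square_norm power2_eq_square mult_ac)
      then have "exp (- (2 * K) * s) * (Y s \<bullet> Y' s) \<le> exp (- (2 * K) * s) * (K * (Y s \<bullet> Y s))"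
        by (rule mult_left_mono) simp
      then show "\<exists>y. (F has_real_derivative y) (at s) \<and> y \<le> 0"
        using dF[of s] by (intro exI conjI) (auto simp: F_def)
    qed
    then have "Y t \<bullet> Y t \<le> 0" by (simp add: F_def Y(3) mult_le_0_iff)
    then show ?thesis by (metis inner_eq_zero_iff inner_ge_zero order_antisym)
  qed
  show ?thesis
  proof (cases "t \<ge> 0")
    case True then show ?thesis using pos[of X X'] assms by blast
  next
    case False
    have "((\<lambda>s. X (- s)) has_vector_derivative - X' (- s)) (at s)" for s
      by (rule has_vector_derivative_reflect[OF X])
    from pos[of "\<lambda>s. X (- s)" "\<lambda>s. - X' (- s)" "- t", OF this] show ?thesis
      using False assms by simp
  qed
qed

section \<open>The scalar mode equation as a first-order system\<close>

lemma periodic_int: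
  fixes f :: "real \<Rightarrow> 'b"
  assumes per: "\<And>t. f (t + P) = f t"
  shows "f (t + of_int k * P) = f t"
proof -
  have nat: "f (s + of_nat m * P) = f s" for m s
  proof (induction m)
    case (Suc m)
    show ?case using per[of "s + of_nat m * P"] Suc by (simp add: algebra_simps)
  qed simp
  show ?thesis
  proof (cases "k \<ge> 0")
    case True then show ?thesis using nat[of t "nat k"] by simp
  next
    case False then show ?thesis using nat[of "t + of_int k * P" "nat (- k)"] by simp
  qed
qed

lemma periodic_representative:
  fixes f :: "real \<Rightarrow> 'b" and P t :: real
  assumes per: "\<And>t. f (t + P) = f t" and P: "0 < P"
  obtains s where "s \<in> {0..P}" "f s = f t"
proof
  let ?s = "t + of_int (- \<lfloor>t / P\<rfloor>) * P"
  show "f ?s = f t" by (rule periodic_int[of f]) (rule per)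
  show "?s \<in> {0..P}"
    using floor_divide_lower[OF P, of t] floor_divide_upper[OF P, of t] by (simp add: algebra_simps)
qed

lemma periodic_attains_min:
  fixes f :: "real \<Rightarrow> real"
  assumes cont: "continuous_on UNIV f" and per: "\<And>t. f (t + P) = f t" and P: "0 < P"
  obtains s where "\<And>t. f s \<le> f t"
proof -
  obtain s where s: "\<forall>t\<in>{0..P}. f s \<le> f t"
    using continuous_attains_inf[of "{0..P}" f] continuous_on_subset[OF cont] P by auto
  have "f s \<le> f t" for t
    using periodic_representative[of f P t, OF per P] s by metis
  then show ?thesis by (rule that)
qed

lemma periodic_bounded:
  fixes f :: "real \<Rightarrow> 'b::real_normed_vector"
  assumes cont: "continuous_on UNIV f" and per: "\<And>t. f (t + P) = f t" and P: "0 < P"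
  shows "bounded (range f)"
proof -
  obtain s where s: "\<And>t. - norm (f s) \<le> - norm (f t)"
    by (rule periodic_attains_min[of "\<lambda>t. - norm (f t)" P])
      (use cont per P in \<open>auto intro!: continuous_intros\<close>)
  then show ?thesis unfolding bounded_iff by auto
qed

lemma periodic_positive_lower_bound:
  fixes f :: "real \<Rightarrow> real"
  assumes cont: "continuous_on UNIV f" and per: "\<And>t. f (t + P) = f t" and P: "0 < P"
    and pos: "\<And>t. 0 < f t"
  obtains m where "0 < m" "\<And>t. m \<le> f t"
  using periodic_attains_min[OF cont per P] pos by metis

type_synonym state = "real \<times> real \<times> real \<times> real"

abbreviation slope :: "state \<Rightarrow> real" where "slope z \<equiv> fst (snd z)"
abbreviation companion :: "state \<Rightarrow> real" where "companion z \<equiv> fst (snd (snd z))"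
abbreviation companion_slope :: "state \<Rightarrow> real" where "companion_slope z \<equiv> snd (snd (snd z))"

text \<open>The state of the equation \<open>f'''' - (A + B) f'' + A B f = Q f\<close> is \<open>(f, f', g, g')\<close> with the companion
  \<open>g = f'' - B f\<close>.  In these coordinates, unlike in \<open>(f, f', f'', f''')\<close>, all coefficients of the
  field are non-negative when \<open>A\<close>, \<open>B\<close> and \<open>Q\<close> are.\<close>
definition mode_field :: "real \<Rightarrow> real \<Rightarrow> (real \<Rightarrow> real) \<Rightarrow> real \<Rightarrow>
    state \<Rightarrow> state" where
  "mode_field A B Q t = (\<lambda>(f, f', g, g'). (f', B * f + g, g', A * g + Q t * f))"

definition mode_path :: "real \<Rightarrow> real \<Rightarrow> (real \<Rightarrow> real) \<Rightarrow>
    (real \<Rightarrow> state) \<Rightarrow> bool" where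
  "mode_path A B Q X \<longleftrightarrow> (\<forall>t. (X has_vector_derivative mode_field A B Q t (X t)) (at t))"

lemma mode_path_coords:
  "mode_path A B Q (\<lambda>t. (f t, f1 t, g t, g1 t)) \<longleftrightarrow>
    (\<forall>t. (f has_real_derivative f1 t) (at t) \<and> (f1 has_real_derivative B * f t + g t) (at t) \<and>
         (g has_real_derivative g1 t) (at t) \<and> (g1 has_real_derivative A * g t + Q t * f t) (at t))"
  (is "?L \<longleftrightarrow> ?R")
proof
  assume ?L
  then have *: "((\<lambda>t. (f t, f1 t, g t, g1 t)) has_vector_derivative
      (f1 t, B * f t + g t, g1 t, A * g t + Q t * f t)) (at t)" for t
    by (auto simp: mode_path_def mode_field_def)
  note fs = bounded_linear.has_vector_derivative[OF bounded_linear_fst]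
    and sn = bounded_linear.has_vector_derivative[OF bounded_linear_snd]
  show ?R
    using fs[OF *] fs[OF sn[OF *]] fs[OF sn[OF sn[OF *]]] sn[OF sn[OF sn[OF *]]]
    by (simp add: has_real_derivative_iff_has_vector_derivative)
next
  assume ?R
  then show ?L
    by (auto simp: mode_path_def mode_field_def has_real_derivative_iff_has_vector_derivative
        intro!: has_vector_derivative_Pair)
qed

lemma linear_mode_field: "linear (mode_field A B Q t)"
  by (rule linearI) (auto simp: mode_field_def algebra_simps split: prod.splits)

lemma mode_path_lincomb:
  assumes "mode_path A B Q X" "mode_path A B Q Y"
  shows "mode_path A B Q (\<lambda>t. a *\<^sub>R X t + b *\<^sub>R Y t)"
  using assms unfolding mode_path_def
  by (auto simp: linear_add[OF linear_mode_field] linear_scale[OF linear_mode_field]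
      intro!: derivative_eq_intros)

lemma mode_path_add: "mode_path A B Q X \<Longrightarrow> mode_path A B Q Y \<Longrightarrow> mode_path A B Q (\<lambda>t. X t + Y t)"
  using mode_path_lincomb[of A B Q X Y 1 1] by simp

lemma mode_path_scale: "mode_path A B Q X \<Longrightarrow> mode_path A B Q (\<lambda>t. a *\<^sub>R X t)"
  using mode_path_lincomb[of A B Q X X a 0] by simp

lemma mode_path_diff: "mode_path A B Q X \<Longrightarrow> mode_path A B Q Y \<Longrightarrow> mode_path A B Q (\<lambda>t. X t - Y t)"
  using mode_path_lincomb[of A B Q X Y 1 "-1"] by simp

lemma mode_path_translate:
  assumes X: "mode_path A B Q X"
  shows "mode_path A B (\<lambda>t. Q (t + c)) (\<lambda>t. X (t + c))"
  unfolding mode_path_def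
proof
  fix t
  have "((\<lambda>t. t + c) has_vector_derivative 1) (at t)" by (auto intro!: derivative_eq_intros)
  from vector_diff_chain_at[OF this, of X "mode_field A B Q (t + c) (X (t + c))"]
  show "((\<lambda>t. X (t + c)) has_vector_derivative mode_field A B (\<lambda>t. Q (t + c)) t (X (t + c))) (at t)"
    using X by (simp add: mode_path_def o_def mode_field_def)
qed

lemma mode_path_shift:
  assumes "mode_path A B Q X" and Q: "\<And>t. Q (t + c) = Q t"
  shows "mode_path A B Q (\<lambda>t. X (t + c))"
  using mode_path_translate[OF assms(1), of c] by (simp add: Q)

text \<open>The effect of time reversal on states.\<close>
definition flip :: "state \<Rightarrow> state" where
  "flip = (\<lambda>(f, f', g, g'). (f, - f', g, - g'))"

lemma linear_flip: "linear flip"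
  by (rule linearI) (auto simp: flip_def split: prod.splits)

lemma flip_flip [simp]: "flip (flip z) = z"
  by (simp add: flip_def split: prod.splits)

lemma norm_flip [simp]: "norm (flip z) = norm z"
  by (simp add: flip_def norm_Pair split: prod.splits)

lemma fst_flip [simp]: "fst (flip z) = fst z"
  by (simp add: flip_def split: prod.splits)

lemma mode_path_reflect:
  assumes X: "mode_path A B Q X" and Q: "\<And>t. Q (- t) = Q t"
  shows "mode_path A B Q (\<lambda>t. flip (X (- t)))"
  unfolding mode_path_def
proof
  fix t
  have "((\<lambda>t. X (- t)) has_vector_derivative - mode_field A B Q (- t) (X (- t))) (at t)"
    by (rule has_vector_derivative_reflect) (use X in \<open>auto simp: mode_path_def\<close>)
  then have "((\<lambda>t. flip (X (- t))) has_vector_derivative flip (- mode_field A B Q (- t) (X (- t)))) (at t)"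
    by (rule bounded_linear.has_vector_derivative[OF linear_conv_bounded_linear[THEN iffD1, OF linear_flip]])
  moreover have "flip (- mode_field A B Q (- t) (X (- t))) = mode_field A B Q t (flip (X (- t)))"
    by (simp add: mode_field_def flip_def Q split: prod.splits)
  ultimately show "((\<lambda>t. flip (X (- t))) has_vector_derivative mode_field A B Q t (flip (X (- t)))) (at t)"
    by simp
qed

lemma norm_quad_le:
  fixes p q r s :: real
  shows "norm (p, q, r, s) \<le> \<bar>p\<bar> + \<bar>q\<bar> + \<bar>r\<bar> + \<bar>s\<bar>"
  using norm_Pair_le[of p "(q, r, s)"] norm_Pair_le[of q "(r, s)"] norm_Pair_le[of r s] by simp

lemma coord_le_norm:
  fixes p q r s :: real
  shows "\<bar>p\<bar> \<le> norm (p, q, r, s)" "\<bar>q\<bar> \<le> norm (p, q, r, s)"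
    "\<bar>r\<bar> \<le> norm (p, q, r, s)" "\<bar>s\<bar> \<le> norm (p, q, r, s)"
  using norm_fst_le[of p "(q, r, s)"] norm_snd_le[of "(q, r, s)" p] norm_fst_le[of q "(r, s)"]
    norm_snd_le[of "(r, s)" q] norm_fst_le[of r s] norm_snd_le[of s r] by simp_all

lemma mode_field_bound:
  assumes "\<bar>Q t\<bar> \<le> M"
  shows "norm (mode_field A B Q t z) \<le> (2 + \<bar>A\<bar> + \<bar>B\<bar> + 1 + M) * norm z"
proof -
  obtain p q r s where z: "z = (p, q, r, s)" by (cases z)
  let ?N = "norm z"
  have c: "\<bar>p\<bar> \<le> ?N" "\<bar>q\<bar> \<le> ?N" "\<bar>r\<bar> \<le> ?N" "\<bar>s\<bar> \<le> ?N" unfolding z by (rule coord_le_norm)+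
  have "norm (mode_field A B Q t z) \<le> \<bar>q\<bar> + \<bar>B * p + r\<bar> + \<bar>s\<bar> + \<bar>A * r + Q t * p\<bar>"
    unfolding z mode_field_def using norm_quad_le by simp
  also have "\<bar>B * p + r\<bar> \<le> \<bar>B\<bar> * ?N + ?N"
    by (rule order_trans[OF abs_triangle_ineq add_mono]) (use c in \<open>auto simp: abs_mult mult_left_mono\<close>)
  also have "\<bar>A * r + Q t * p\<bar> \<le> \<bar>A\<bar> * ?N + M * ?N"
    by (rule order_trans[OF abs_triangle_ineq add_mono])
      (use c assms in \<open>auto simp: abs_mult intro!: mult_mono\<close>)
  finally show ?thesis using c by (simp add: algebra_simps)
qed

definition nonneg_state :: "state \<Rightarrow> bool" where
  "nonneg_state z \<longleftrightarrow> 0 \<le> fst z \<and> 0 \<le> slope z \<and> 0 \<le> companion z \<and> 0 \<le> companion_slope z"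

locale mode_equation =
  fixes A B P :: real and Q :: "real \<Rightarrow> real"
  assumes A_pos: "0 < A" and B_pos: "0 < B" and P_pos: "0 < P"
    and Q_cont: "continuous_on UNIV Q" and Q_pos: "\<And>t. 0 < Q t"
    and Q_per: "\<And>t. Q (t + P) = Q t" and Q_even: "\<And>t. Q (- t) = Q t"
begin

abbreviation solution :: "(real \<Rightarrow> state) \<Rightarrow> bool" where
  "solution \<equiv> mode_path A B Q"

lemma Q_per': "Q (t - P) = Q t"
  using Q_per[of "t - P"] by simp

lemma Q_bound: obtains M where "0 \<le> M" "\<And>t. \<bar>Q t\<bar> \<le> M"
  using periodic_bounded[OF Q_cont Q_per P_pos] unfolding bounded_iff
  by (metis abs_ge_zero order_trans rangeI real_norm_def)

lemma solution_unique:
  assumes X: "solution X" and Y: "solution Y" and eq: "X 0 = Y 0"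
  shows "X = Y"
proof
  fix t
  obtain M where M: "\<And>t. \<bar>Q t\<bar> \<le> M" using Q_bound by metis
  have "X t - Y t = 0"
  proof (rule linear_ode_unique[of "\<lambda>t. X t - Y t" "\<lambda>t. mode_field A B Q t (X t - Y t)"
        "2 + \<bar>A\<bar> + \<bar>B\<bar> + 1 + M"])
    show "((\<lambda>t. X t - Y t) has_vector_derivative mode_field A B Q t (X t - Y t)) (at t)" for t
      using mode_path_diff[OF X Y] by (simp add: mode_path_def)
  qed (use eq mode_field_bound M in auto)
  then show "X t = Y t" by simp
qed

lemma solution_zero: "solution (\<lambda>_. 0)"
  using linear_0[OF linear_mode_field] by (simp add: mode_path_def)

lemma solution_exists:
  obtains X where "solution X" "X 0 = (x, x', y, y')"
    and "0 \<le> x \<Longrightarrow> 0 \<le> x' \<Longrightarrow> 0 \<le> y \<Longrightarrow> 0 \<le> y' \<Longrightarrow> (\<And>t. 0 \<le> t \<Longrightarrow> nonneg_state (X t))"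
proof -
  obtain M where M: "0 \<le> M" "\<And>t. \<bar>Q t\<bar> \<le> M" using Q_bound by metis
  have b: "norm (mode_field A B Q t z) \<le> (2 + \<bar>A\<bar> + \<bar>B\<bar> + 1 + M) * norm z" for t z
    by (rule mode_field_bound) (rule M(2))
  have c: "continuous_on UNIV (\<lambda>t. mode_field A B Q t (X t))" if "continuous_on UNIV X" for X
    unfolding mode_field_def case_prod_beta
    by (intro continuous_intros continuous_on_compose2[OF continuous_on_fst] that Q_cont) auto
  show ?thesis
  proof (rule linear_ode_exists[OF linear_mode_field b c, of "(x, x', y, y')"])
    fix X :: "real \<Rightarrow> state"
    assume X: "X 0 = (x, x', y, y')" "\<And>t. (X has_vector_derivative mode_field A B Q t (X t)) (at t)"
      and pos: "(\<And>t x. 0 \<le> t \<Longrightarrow> \<forall>b\<in>Basis. 0 \<le> x \<bullet> b \<Longrightarrow> \<forall>b\<in>Basis. 0 \<le> mode_field A B Q t x \<bullet> b) \<Longrightarrow>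
      \<forall>b\<in>Basis. 0 \<le> (x, x', y, y') \<bullet> b \<Longrightarrow> (\<And>t. 0 \<le> t \<Longrightarrow> \<forall>b\<in>Basis. 0 \<le> X t \<bullet> b)"
    have nn: "(\<forall>b\<in>Basis. 0 \<le> z \<bullet> b) \<longleftrightarrow> 0 \<le> fst z \<and> 0 \<le> slope z \<and> 0 \<le> companion z \<and> 0 \<le> companion_slope z"
      for z :: "state"
      by (cases z) (auto simp: Basis_prod_def)
    have "(\<forall>b\<in>Basis. 0 \<le> mode_field A B Q t z \<bullet> b)" if "\<forall>b\<in>Basis. 0 \<le> z \<bullet> b" for t z
      using that A_pos B_pos Q_pos[of t] unfolding nn
      by (auto simp: mode_field_def case_prod_beta intro!: add_nonneg_nonneg)
    then have "0 \<le> fst (X t) \<and> 0 \<le> slope (X t) \<and> 0 \<le> companion (X t) \<and> 0 \<le> companion_slope (X t)"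
      if "0 \<le> x" "0 \<le> x'" "0 \<le> y" "0 \<le> y'" "0 \<le> t" for t
      using pos that unfolding nn by auto
    then show thesis
      using X by (intro that[of X]) (auto simp: mode_path_def nonneg_state_def)
  qed
qed

end

section \<open>Even and odd solutions and the positive matrix of a period\<close>

lemma increasing_from_0:
  fixes h h' :: "real \<Rightarrow> real"
  assumes "\<And>s. (h has_real_derivative h' s) (at s)" "\<And>s. 0 < s \<Longrightarrow> 0 < h' s" "0 < t"
  shows "h 0 < h t"
  by (rule DERIV_pos_imp_increasing_open[OF assms(3)])
    (use assms in \<open>blast intro: DERIV_isCont continuous_at_imp_continuous_on\<close>)+

lemma nondecreasing_from_0:
  fixes h h' :: "real \<Rightarrow> real"
  assumes "\<And>s. (h has_real_derivative h' s) (at s)" "\<And>s. 0 \<le> s \<Longrightarrow> 0 \<le> h' s" "0 \<le> s" "s \<le> t"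
  shows "h s \<le> h t"
  by (rule DERIV_nonneg_imp_nondecreasing[OF assms(4)]) (use assms in \<open>meson order_trans\<close>)

text \<open>The initial state of an even (\<open>e = 1\<close>) or odd (\<open>e = -1\<close>) solution in its two free coordinates:
  the values of \<open>f\<close> and \<open>g\<close>, or those of \<open>f'\<close> and \<open>g'\<close>.\<close>
definition parity_data :: "real \<Rightarrow> real \<Rightarrow> real \<Rightarrow> state" where
  "parity_data e x y = (if e = 1 then (x, 0, y, 0) else (0, x, 0, y))"

definition has_parity :: "real \<Rightarrow> (real \<Rightarrow> state) \<Rightarrow> bool" where
  "has_parity e X \<longleftrightarrow> (\<forall>t. X (- t) = e *\<^sub>R flip (X t))"

lemma parity_dataE:
  assumes "e = 1 \<or> e = -1"
  obtains x y where "z + e *\<^sub>R flip z = 2 *\<^sub>R parity_data e x y"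
    "e = 1 \<Longrightarrow> x = fst z \<and> y = companion z" "e = -1 \<Longrightarrow> x = slope z \<and> y = companion_slope z"
proof
  let ?x = "if e = 1 then fst z else slope z"
  let ?y = "if e = 1 then companion z else companion_slope z"
  show "z + e *\<^sub>R flip z = 2 *\<^sub>R parity_data e ?x ?y"
    using assms by (cases z) (auto simp: parity_data_def flip_def)
qed auto

lemma parity_data_flip: "e = 1 \<or> e = -1 \<Longrightarrow> e *\<^sub>R flip (parity_data e x y) = parity_data e x y"
  by (auto simp: parity_data_def flip_def)

lemma parity_data_lincomb:
  "a *\<^sub>R parity_data e x y + b *\<^sub>R parity_data e x' y' = parity_data e (a * x + b * x') (a * y + b * y')"
  by (simp add: parity_data_def)

lemma parity_data_0 [simp]: "parity_data e 0 0 = 0"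
  by (simp add: parity_data_def zero_prod_def)

lemma parity_value_0:
  assumes "e = 1 \<or> e = -1" "has_parity e X"
  obtains x y where "X 0 = parity_data e x y"
proof -
  have *: "X 0 = e *\<^sub>R flip (X 0)" using assms(2)[unfolded has_parity_def, rule_format, of 0] by simp
  obtain x y where "X 0 + e *\<^sub>R flip (X 0) = 2 *\<^sub>R parity_data e x y"
    using parity_dataE[OF assms(1)] by metis
  then have "2 *\<^sub>R X 0 = 2 *\<^sub>R parity_data e x y" using * by (metis scaleR_2)
  then show ?thesis using that by simp
qed

context mode_equation
begin

text \<open>Eigenvectors of \<open>M + M\<^sup>-\<^sup>1\<close>, where \<open>M\<close> is the translation by a period.  A Floquet multiplier
  \<open>\<lambda>\<close> corresponds to the eigenvalue \<open>2 \<kappa> = \<lambda> + 1 / \<lambda>\<close>, so \<open>\<bar>\<lambda>\<bar> = 1\<close> corresponds to real \<open>\<kappa>\<close> with \<open>\<bar>\<kappa>\<bar> \<le> 1\<close>.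
  In contrast to \<open>M\<close>, this operator commutes with time reversal.\<close>
definition eigen :: "real \<Rightarrow> (real \<Rightarrow> state) \<Rightarrow> bool" where
  "eigen \<kappa> X \<longleftrightarrow> (\<forall>t. X (t + P) + X (t - P) = (2 * \<kappa>) *\<^sub>R X t)"

lemma solution_parity:
  assumes X: "solution X" and e: "e = 1 \<or> e = -1" and X0: "X 0 = parity_data e x y"
  shows "has_parity e X"
proof -
  have "(\<lambda>t. e *\<^sub>R flip (X (- t))) = X"
    by (rule solution_unique[OF mode_path_scale[OF mode_path_reflect[OF X Q_even]] X])
      (use X0 parity_data_flip[OF e] in auto)
  then have "X (- t) = e *\<^sub>R flip (X t)" for t by (metis minus_minus)
  then show ?thesis by (simp add: has_parity_def)
qed

lemma eigenI:
  assumes X: "solution X" and 0: "X P + X (- P) = (2 * \<kappa>) *\<^sub>R X 0"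
  shows "eigen \<kappa> X"
proof -
  have "(\<lambda>t. X (t + P) + X (t + (- P))) = (\<lambda>t. (2 * \<kappa>) *\<^sub>R X t)"
  proof (rule solution_unique)
    show "solution (\<lambda>t. X (t + P) + X (t + (- P)))"
      by (rule mode_path_add[OF mode_path_shift[OF X Q_per] mode_path_shift[OF X]]) (simp add: Q_per')
  qed (use 0 mode_path_scale[OF X] in auto)
  then show ?thesis by (simp add: eigen_def fun_eq_iff)
qed

lemma eigen_separate:
  assumes "eigen \<kappa> X" "eigen \<mu> Y" "\<kappa> \<noteq> \<mu>" and 0: "\<And>t. a *\<^sub>R X t + b *\<^sub>R Y t = 0"
  shows "a *\<^sub>R X t = 0" "b *\<^sub>R Y t = 0"
proof -
  have "0 = (a *\<^sub>R X (t + P) + b *\<^sub>R Y (t + P)) + (a *\<^sub>R X (t - P) + b *\<^sub>R Y (t - P)) - (2 * \<mu>) *\<^sub>R (a *\<^sub>R X t + b *\<^sub>R Y t)"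
    using 0 by simp
  also have "\<dots> = a *\<^sub>R (X (t + P) + X (t - P)) + b *\<^sub>R (Y (t + P) + Y (t - P)) - (2 * \<mu>) *\<^sub>R (a *\<^sub>R X t + b *\<^sub>R Y t)"
    by (simp add: algebra_simps)
  also have "\<dots> = (2 * (\<kappa> - \<mu>)) *\<^sub>R (a *\<^sub>R X t)"
    using assms(1,2) by (simp only: eigen_def) (simp add: algebra_simps)
  finally have "(2 * (\<kappa> - \<mu>)) *\<^sub>R (a *\<^sub>R X t) = 0" by (rule sym)
  then show "a *\<^sub>R X t = 0" using assms(3) by simp
  then show "b *\<^sub>R Y t = 0" using 0[of t] by (simp only: add_0)
qed

text \<open>Solutions of given parity form a plane, by their initial data.  Eigensolutions for distinct
  eigenvalues have independent initial data, and Cramer's rule gives the coefficients.\<close>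
lemma parity_span:
  assumes e: "e = 1 \<or> e = -1"
    and F: "solution F" "has_parity e F" "eigen \<kappa> F" "F 0 \<noteq> 0"
    and G: "solution G" "has_parity e G" "eigen \<mu> G" "G 0 \<noteq> 0" and ne: "\<kappa> \<noteq> \<mu>"
    and X: "solution X" "has_parity e X"
  obtains a b where "X = (\<lambda>t. a *\<^sub>R F t + b *\<^sub>R G t)"
proof -
  obtain x1 y1 where F0: "F 0 = parity_data e x1 y1" using parity_value_0[OF e F(2)] .
  obtain x2 y2 where G0: "G 0 = parity_data e x2 y2" using parity_value_0[OF e G(2)] .
  obtain x y where X0: "X 0 = parity_data e x y" using parity_value_0[OF e X(2)] .
  have dep: "s = 0 \<and> r = 0" if "s * x1 + r * x2 = 0" "s * y1 + r * y2 = 0" for s r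
  proof -
    have "(\<lambda>t. s *\<^sub>R F t + r *\<^sub>R G t) = (\<lambda>_. 0)"
      by (rule solution_unique[OF mode_path_lincomb[OF F(1) G(1)] solution_zero])
        (simp add: F0 G0 parity_data_lincomb that)
    then have "s *\<^sub>R F t + r *\<^sub>R G t = 0" for t by (simp add: fun_eq_iff)
    from eigen_separate[OF F(3) G(3) ne this, of 0] show ?thesis using F(4) G(4) by simp
  qed
  \<comment> \<open>the determinant of the initial data of \<open>F\<close> and \<open>G\<close>\<close>
  define \<Delta> where "\<Delta> = x1 * y2 - x2 * y1"
  have \<Delta>: "\<Delta> \<noteq> 0"
  proof
    assume "\<Delta> = 0"
    then have "y2 = 0 \<and> - y1 = 0" "x2 = 0 \<and> - x1 = 0"
      by (intro dep; simp add: \<Delta>_def algebra_simps)+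
    then show False using F(4) F0 by simp
  qed
  let ?a = "(x * y2 - x2 * y) / \<Delta>" and ?b = "(x1 * y - x * y1) / \<Delta>"
  have "X = (\<lambda>t. ?a *\<^sub>R F t + ?b *\<^sub>R G t)"
  proof (rule solution_unique[OF X(1) mode_path_lincomb[OF F(1) G(1)]])
    have "?a * x1 + ?b * x2 = x" "?a * y1 + ?b * y2 = y"
      using \<Delta> by (simp_all add: divide_simps) (simp_all add: \<Delta>_def algebra_simps)
    then show "X 0 = ?a *\<^sub>R F 0 + ?b *\<^sub>R G 0" by (simp add: X0 F0 G0 parity_data_lincomb)
  qed
  then show ?thesis by (rule that)
qed

lemma solution_coords:
  assumes "solution X"
  shows "((\<lambda>t. fst (X t)) has_real_derivative slope (X t)) (at t)"
    "((\<lambda>t. slope (X t)) has_real_derivative B * fst (X t) + companion (X t)) (at t)"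
    "((\<lambda>t. companion (X t)) has_real_derivative companion_slope (X t)) (at t)"
    "((\<lambda>t. companion_slope (X t)) has_real_derivative A * companion (X t) + Q t * fst (X t)) (at t)"
  using assms mode_path_coords[of A B Q "\<lambda>t. fst (X t)" "\<lambda>t. slope (X t)" "\<lambda>t. companion (X t)"
      "\<lambda>t. companion_slope (X t)"] by simp_all

lemma nonneg_solution_nondecreasing:
  assumes X: "solution X" and nn: "\<And>t. 0 \<le> t \<Longrightarrow> nonneg_state (X t)" and st: "0 \<le> s" "s \<le> t"
  shows "fst (X s) \<le> fst (X t)" "slope (X s) \<le> slope (X t)"
    "companion (X s) \<le> companion (X t)" "companion_slope (X s) \<le> companion_slope (X t)"
  using nn A_pos B_pos Q_pos
  by (auto simp: nonneg_state_def less_imp_le intro!: nondecreasing_from_0[OF solution_coords(1)[OF X] _ st]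
      nondecreasing_from_0[OF solution_coords(2)[OF X] _ st]
      nondecreasing_from_0[OF solution_coords(3)[OF X] _ st]
      nondecreasing_from_0[OF solution_coords(4)[OF X] _ st])

text \<open>Since \<open>f'' = B f + g \<ge> B f(1)\<close> for \<open>t \<ge> 1\<close>, the growth is at least quadratic.\<close>
lemma nonneg_solution_superlinear:
  assumes X: "solution X" and nn: "\<And>t. 0 \<le> t \<Longrightarrow> nonneg_state (X t)" and pos: "0 < fst (X 1)"
  obtains m where "0 < m" "\<And>t. 0 \<le> t \<Longrightarrow> m * t\<^sup>2 \<le> fst (X (1 + t))"
proof
  define m where "m = B * fst (X 1)"
  show "0 < m / 2" using pos B_pos by (simp add: m_def)
  fix t :: real assume t: "0 \<le> t"
  have d1: "((\<lambda>s. slope (X (1 + s)) - m * s) has_real_derivative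
      B * fst (X (1 + s)) + companion (X (1 + s)) - m) (at s)" for s
    by (rule derivative_eq_intros DERIV_chain2[OF solution_coords(2)[OF X]] refl | simp)+
  have d0: "((\<lambda>s. fst (X (1 + s)) - m / 2 * s\<^sup>2) has_real_derivative
      slope (X (1 + s)) - m * s) (at s)" for s
    by (rule derivative_eq_intros DERIV_chain2[OF solution_coords(1)[OF X]] refl | simp)+
  have "0 \<le> slope (X (1 + s)) - m * s" if s: "0 \<le> s" for s
  proof -
    have "slope (X (1 + 0)) - m * 0 \<le> slope (X (1 + s)) - m * s"
    proof (rule nondecreasing_from_0[OF d1 _ order_refl s])
      fix r :: real assume r: "0 \<le> r"
      have "fst (X 1) \<le> fst (X (1 + r))" by (rule nonneg_solution_nondecreasing(1)[OF X nn]) (use r in auto)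
      moreover have "0 \<le> companion (X (1 + r))" using nn[of "1 + r"] r by (simp add: nonneg_state_def)
      ultimately show "0 \<le> B * fst (X (1 + r)) + companion (X (1 + r)) - m"
        using B_pos by (simp add: m_def add_increasing2)
    qed
    moreover have "0 \<le> slope (X 1)" using nn[of 1] by (simp add: nonneg_state_def)
    ultimately show ?thesis by simp
  qed
  from nondecreasing_from_0[OF d0 this order_refl t] show "m / 2 * t\<^sup>2 \<le> fst (X (1 + t))"
    using pos by simp
qed

text \<open>What Perron's theorem provides for the larger eigenvalue of the positive matrix in \<open>parity_matrix\<close>:
  an eigensolution in the non-negative cone.\<close>
definition principal :: "real \<Rightarrow> (real \<Rightarrow> state) \<Rightarrow> bool" where
  "principal \<kappa> X \<longleftrightarrow> solution X \<and> eigen \<kappa> X \<and> (\<forall>t\<ge>0. nonneg_state (X t)) \<and> (\<forall>t>0. 0 < fst (X t)) \<and> X 0 \<noteq> 0"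

text \<open>In the coordinates of \<open>parity_data\<close>, the map \<open>X \<mapsto> X(t + P) + X(t - P)\<close> is twice the matrix with
  rows \<open>(a, b)\<close> and \<open>(c, d)\<close>, since \<open>X(-P)\<close> is the reflection of \<open>X(P)\<close>.  The entries are positive
  because the cooperative system passes positivity from each of \<open>f, g\<close> to the other, and \<open>a > 1\<close>
  because the first coordinate starts at \<open>1\<close> and increases.\<close>
lemma parity_matrix:
  assumes e: "e = 1 \<or> e = -1"
  obtains Y Z a b c d where "solution Y" "solution Z" "\<And>t. 0 \<le> t \<Longrightarrow> nonneg_state (Y t)" "\<And>t. 0 \<le> t \<Longrightarrow> nonneg_state (Z t)"
    "Y 0 = parity_data e 1 0" "Z 0 = parity_data e 0 1"
    "Y P + e *\<^sub>R flip (Y P) = 2 *\<^sub>R parity_data e a c" "Z P + e *\<^sub>R flip (Z P) = 2 *\<^sub>R parity_data e b d"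
    "1 < a" "0 < b" "0 < c" "0 < d" "\<And>t. 0 < t \<Longrightarrow> 0 < fst (Y t)"
proof -
  let ?u = "if e = 1 then 1 else 0 :: real"
  obtain Y where Y: "solution Y" "Y 0 = (?u, 1 - ?u, 0, 0)" and cY: "\<And>t. 0 \<le> t \<Longrightarrow> nonneg_state (Y t)"
    by (rule solution_exists[of ?u "1 - ?u" 0 0]) auto
  obtain Z where Z: "solution Z" "Z 0 = (0, 0, ?u, 1 - ?u)" and cZ: "\<And>t. 0 \<le> t \<Longrightarrow> nonneg_state (Z t)"
    by (rule solution_exists[of 0 0 ?u "1 - ?u"]) auto
  obtain a c where ac: "Y P + e *\<^sub>R flip (Y P) = 2 *\<^sub>R parity_data e a c"
    "e = 1 \<Longrightarrow> a = fst (Y P) \<and> c = companion (Y P)" "e = -1 \<Longrightarrow> a = slope (Y P) \<and> c = companion_slope (Y P)"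
    using parity_dataE[OF e, of "Y P"] by metis
  obtain b d where bd: "Z P + e *\<^sub>R flip (Z P) = 2 *\<^sub>R parity_data e b d"
    "e = 1 \<Longrightarrow> b = fst (Z P) \<and> d = companion (Z P)" "e = -1 \<Longrightarrow> b = slope (Z P) \<and> d = companion_slope (Z P)"
    using parity_dataE[OF e, of "Z P"] by metis
  note inc = increasing_from_0[OF solution_coords(1)] increasing_from_0[OF solution_coords(2)]
    increasing_from_0[OF solution_coords(3)] increasing_from_0[OF solution_coords(4)]
  have nn: "0 \<le> fst (X t) \<and> 0 \<le> slope (X t) \<and> 0 \<le> companion (X t) \<and> 0 \<le> companion_slope (X t)"
    if "X = Y \<or> X = Z" "0 < t" for X t
    using that cY[of t] cZ[of t] by (auto simp: nonneg_state_def)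
  have f_pos: "0 < fst (Y t)" if t: "0 < t" for t
  proof (cases "e = 1")
    case True
    then show ?thesis using nonneg_solution_nondecreasing(1)[OF Y(1) cY, of 0 t] Y(2) t by simp
  next
    case False
    have "0 < slope (Y s)" if "0 < s" for s
      using nonneg_solution_nondecreasing(2)[OF Y(1) cY, of 0 s] Y(2) that False by simp
    from inc(1)[OF Y(1) this t] show ?thesis using Y(2) False by simp
  qed
  have dY1: "0 < B * fst (Y t) + companion (Y t)" and dY3: "0 < A * companion (Y t) + Q t * fst (Y t)"
    if "0 < t" for t
    using f_pos[OF that] nn[of Y t] that A_pos B_pos Q_pos[of t]
    by (auto intro: add_pos_nonneg add_nonneg_pos)
  have f1_inc: "slope (Y 0) < slope (Y t)" and g1_inc: "companion_slope (Y 0) < companion_slope (Y t)" if "0 < t" for t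
    using inc(2)[OF Y(1) dY1 that] inc(4)[OF Y(1) dY3 that] by auto
  have f1_pos: "0 < slope (Y t)" and g1_pos: "0 < companion_slope (Y t)" if "0 < t" for t
    using f1_inc[OF that] g1_inc[OF that] Y(2) by (auto split: if_splits)
  have a1: "1 < a" and c0: "0 < c"
    using e ac(2,3) inc(1)[OF Y(1) f1_pos P_pos] inc(3)[OF Y(1) g1_pos P_pos] f1_inc[OF P_pos] g1_inc[OF P_pos] Y(2)
    by auto
  have g_pos: "0 < companion (Z t)" if t: "0 < t" for t
  proof (cases "e = 1")
    case True
    then show ?thesis using nonneg_solution_nondecreasing(3)[OF Z(1) cZ, of 0 t] Z(2) t by simp
  next
    case False
    have "0 < companion_slope (Z s)" if "0 < s" for s
      using nonneg_solution_nondecreasing(4)[OF Z(1) cZ, of 0 s] Z(2) that False by simp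
    from inc(3)[OF Z(1) this t] show ?thesis using Z(2) False by simp
  qed
  have dZ1: "0 < B * fst (Z t) + companion (Z t)" if "0 < t" for t
    using g_pos[OF that] nn[of Z t] that B_pos by (auto intro: add_nonneg_pos)
  have f1Z: "0 < slope (Z t)" if "0 < t" for t
    using inc(2)[OF Z(1) dZ1 that] Z(2) by simp
  have b0: "0 < b"
    using e bd(2,3) inc(1)[OF Z(1) f1Z P_pos] f1Z[OF P_pos] Z(2) by auto
  have d0: "0 < d"
    using e bd(2,3) nonneg_solution_nondecreasing(3,4)[OF Z(1) cZ, of 0 P] P_pos Z(2) by auto
  show ?thesis
    by (rule that[OF Y(1) Z(1) cY cZ _ _ ac(1) bd(1) a1 b0 c0 d0 f_pos])
      (use Y(2) Z(2) in \<open>auto simp: parity_data_def\<close>)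
qed

text \<open>Perron's theorem for a positive matrix of order two, by the quadratic formula: the discriminant
  \<open>((a - d) / 2)\<^sup>2 + b c\<close> is positive, the larger root exceeds \<open>a > 1\<close>, and the sum \<open>a + d\<close> of the roots is
  positive.\<close>
lemma parity_modes:
  assumes e: "e = 1 \<or> e = -1"
  obtains X Y \<kappa> \<mu> where "has_parity e X" "principal \<kappa> X" "1 < \<kappa>"
    "solution Y" "has_parity e Y" "eigen \<mu> Y" "Y 0 \<noteq> 0" "\<mu> < \<kappa>" "- \<kappa> < \<mu>"
proof -
  obtain Y Z a b c d where Y: "solution Y" and Z: "solution Z"
    and cY: "\<And>t. 0 \<le> t \<Longrightarrow> nonneg_state (Y t)" and cZ: "\<And>t. 0 \<le> t \<Longrightarrow> nonneg_state (Z t)"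
    and Y0: "Y 0 = parity_data e 1 0" and Z0: "Z 0 = parity_data e 0 1"
    and YP: "Y P + e *\<^sub>R flip (Y P) = 2 *\<^sub>R parity_data e a c"
    and ZP: "Z P + e *\<^sub>R flip (Z P) = 2 *\<^sub>R parity_data e b d"
    and abcd: "1 < a" "0 < b" "0 < c" "0 < d" and Y_pos: "\<And>t. 0 < t \<Longrightarrow> 0 < fst (Y t)"
    by (rule parity_matrix[OF e]) (rule that)
  define s where "s = sqrt (((a - d) / 2)\<^sup>2 + b * c)"
  have s2: "s\<^sup>2 = ((a - d) / 2)\<^sup>2 + b * c" using abcd by (simp add: s_def)
  have s: "\<bar>(a - d) / 2\<bar> < s"
    unfolding s_def by (rule real_less_rsqrt) (use abcd in \<open>simp add: power_divide\<close>)
  let ?X = "\<lambda>\<kappa> t. b *\<^sub>R Y t + (\<kappa> - a) *\<^sub>R Z t"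
  have X: "solution (?X \<kappa>)" for \<kappa> by (rule mode_path_lincomb[OF Y Z])
  have X0: "?X \<kappa> 0 = parity_data e b (\<kappa> - a)" for \<kappa> by (simp add: Y0 Z0 parity_data_lincomb)
  have ne: "?X \<kappa> 0 \<noteq> 0" for \<kappa> unfolding X0 using abcd by (auto simp: parity_data_def zero_prod_def)
  have par: "has_parity e (?X \<kappa>)" for \<kappa> using solution_parity[OF X e X0] .
  have eig: "eigen \<kappa> (?X \<kappa>)" if "(\<kappa> - a) * (\<kappa> - d) = b * c" for \<kappa>
  proof (rule eigenI[OF X])
    have "?X \<kappa> P + ?X \<kappa> (- P) = ?X \<kappa> P + e *\<^sub>R flip (?X \<kappa> P)"
      using par[of \<kappa>] by (simp only: has_parity_def)
    also have "\<dots> = b *\<^sub>R (Y P + e *\<^sub>R flip (Y P)) + (\<kappa> - a) *\<^sub>R (Z P + e *\<^sub>R flip (Z P))"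
      by (simp add: linear_add[OF linear_flip] linear_scale[OF linear_flip] scaleR_add_right mult.commute)
    also have "\<dots> = 2 *\<^sub>R (b *\<^sub>R parity_data e a c + (\<kappa> - a) *\<^sub>R parity_data e b d)"
      unfolding YP ZP by (simp add: scaleR_add_right mult.commute)
    also have "\<dots> = 2 *\<^sub>R parity_data e (b * \<kappa>) (\<kappa> * (\<kappa> - a))"
    proof -
      have "b * a + (\<kappa> - a) * b = b * \<kappa>" "b * c + (\<kappa> - a) * d = \<kappa> * (\<kappa> - a)"
        using that by (simp_all add: algebra_simps)
      then show ?thesis unfolding parity_data_lincomb by simp
    qed
    also have "\<dots> = (2 * \<kappa>) *\<^sub>R ?X \<kappa> 0"
      unfolding X0 by (simp add: parity_data_def mult.commute)
    finally show "?X \<kappa> P + ?X \<kappa> (- P) = (2 * \<kappa>) *\<^sub>R ?X \<kappa> 0" .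
  qed
  define \<kappa> \<mu> where "\<kappa> = (a + d) / 2 + s" and "\<mu> = (a + d) / 2 - s"
  have root: "(\<kappa> - a) * (\<kappa> - d) = b * c" "(\<mu> - a) * (\<mu> - d) = b * c"
    using s2 by (auto simp: \<kappa>_def \<mu>_def power2_eq_square field_simps)
  have \<kappa>: "a < \<kappa>" using s unfolding \<kappa>_def abs_less_iff by (simp add: field_simps)
  have "principal \<kappa> (?X \<kappa>)"
    unfolding principal_def
  proof (intro conjI allI impI X eig root ne)
    fix t :: real assume t: "0 \<le> t"
    show "nonneg_state (?X \<kappa> t)" using cY[OF t] cZ[OF t] \<kappa> abcd by (auto simp: nonneg_state_def intro!: add_nonneg_nonneg)
  next
    fix t :: real assume t: "0 < t"
    have "0 \<le> fst (Z t)" using cZ[of t] t by (simp add: nonneg_state_def)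
    then show "0 < fst (?X \<kappa> t)" using Y_pos[OF t] \<kappa> abcd by (auto intro!: add_pos_nonneg)
  qed
  then show ?thesis
    by (rule that[OF par _ _ X par eig[OF root(2)] ne]) (use \<kappa> abcd s in \<open>auto simp: \<kappa>_def \<mu>_def\<close>)
qed

end

section \<open>Growth of the eigensolutions\<close>

definition lin_growth :: "(real \<Rightarrow> real) \<Rightarrow> bool" where
  "lin_growth f \<longleftrightarrow> (\<exists>C. \<forall>t. \<bar>f t\<bar> \<le> C * (1 + \<bar>t\<bar>))"

lemma lin_growth_lincomb:
  assumes "lin_growth f" "lin_growth g"
  shows "lin_growth (\<lambda>t. a * f t + b * g t)"
proof -
  obtain C D where C: "\<And>t. \<bar>f t\<bar> \<le> C * (1 + \<bar>t\<bar>)" and D: "\<And>t. \<bar>g t\<bar> \<le> D * (1 + \<bar>t\<bar>)"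
    using assms by (auto simp: lin_growth_def)
  have "\<bar>a * f t + b * g t\<bar> \<le> (\<bar>a\<bar> * C + \<bar>b\<bar> * D) * (1 + \<bar>t\<bar>)" for t
  proof -
    have "\<bar>a * f t + b * g t\<bar> \<le> \<bar>a\<bar> * \<bar>f t\<bar> + \<bar>b\<bar> * \<bar>g t\<bar>"
      by (metis abs_mult abs_triangle_ineq)
    also have "\<dots> \<le> \<bar>a\<bar> * (C * (1 + \<bar>t\<bar>)) + \<bar>b\<bar> * (D * (1 + \<bar>t\<bar>))"
      by (intro add_mono mult_left_mono C D) auto
    finally show ?thesis by (simp add: algebra_simps)
  qed
  then show ?thesis by (auto simp: lin_growth_def)
qed

lemma lin_growth_shift:
  assumes "lin_growth f"
  shows "lin_growth (\<lambda>t. f (t + c))"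
proof -
  obtain C where C: "\<And>t. \<bar>f t\<bar> \<le> C * (1 + \<bar>t\<bar>)" using assms by (auto simp: lin_growth_def)
  have C0: "0 \<le> C" using order_trans[OF abs_ge_zero C[of 0]] by simp
  have "\<bar>f (t + c)\<bar> \<le> (C * (1 + \<bar>c\<bar>)) * (1 + \<bar>t\<bar>)" for t
  proof -
    have "1 + \<bar>t + c\<bar> \<le> (1 + \<bar>c\<bar>) * (1 + \<bar>t\<bar>)"
      using abs_triangle_ineq[of t c] mult_nonneg_nonneg[of "\<bar>c\<bar>" "\<bar>t\<bar>"] by (simp add: algebra_simps del: mult_nonneg_nonneg)
    from order_trans[OF C mult_left_mono[OF this C0]] show ?thesis by (simp add: mult.assoc)
  qed
  then show ?thesis by (auto simp: lin_growth_def)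
qed

lemma lin_growth_reflect: "lin_growth f \<Longrightarrow> lin_growth (\<lambda>t. f (- t))"
  unfolding lin_growth_def by (metis abs_minus_cancel)

lemma bounded_lin_growth:
  fixes f :: "real \<Rightarrow> real"
  assumes "bounded (range f)"
  shows "lin_growth f"
proof -
  obtain C where C: "\<And>t. \<bar>f t\<bar> \<le> C" using assms by (auto simp: bounded_iff)
  then have "0 \<le> C" using order_trans[OF abs_ge_zero] by blast
  then have "\<bar>f t\<bar> \<le> C * (1 + \<bar>t\<bar>)" for t
    using C[of t] mult_left_mono[of 1 "1 + \<bar>t\<bar>" C] by simp
  then show ?thesis by (auto simp: lin_growth_def)
qed

text \<open>Exponential growth at \<open>\<infinity>\<close> together with exponential decay at \<open>-\<infinity>\<close>; the two rates may differ.\<close>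
definition forward_growing :: "(real \<Rightarrow> real) \<Rightarrow> bool" where
  "forward_growing f \<longleftrightarrow> (\<exists>\<delta>>0. \<exists>\<delta>'>0. \<exists>m>0. \<exists>M.
     (\<forall>t\<ge>0. m * exp (\<delta> * t) \<le> \<bar>f t\<bar>) \<and> (\<forall>t\<le>0. \<bar>f t\<bar> \<le> M * exp (\<delta>' * t)))"

text \<open>Bases as indexed families rather than as sets: their elements are counted by the index set, and
  translations and products of bases need no injectivity argument.\<close>
definition indexed_basis :: "'i set \<Rightarrow> ('i \<Rightarrow> 'a \<Rightarrow> 'b::real_vector) \<Rightarrow> ('a \<Rightarrow> 'b) set \<Rightarrow> bool" where
  "indexed_basis I u S \<longleftrightarrow> finite I \<and> S = range (\<lambda>c t. \<Sum>i\<in>I. c i *\<^sub>R u i t) \<and>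
     (\<forall>c. (\<forall>t. (\<Sum>i\<in>I. c i *\<^sub>R u i t) = 0) \<longrightarrow> (\<forall>i\<in>I. c i = 0))"

definition mode_functions :: "real \<Rightarrow> real \<Rightarrow> (real \<Rightarrow> real) \<Rightarrow> (real \<Rightarrow> real) set" where
  "mode_functions A B Q = {f. \<exists>X. mode_path A B Q X \<and> f = (\<lambda>t. fst (X t))}"

lemma mode_path_continuous:
  assumes "mode_path A B Q X"
  shows "continuous_on UNIV X"
proof (rule continuous_at_imp_continuous_on, rule ballI)
  show "isCont X t" for t
    using assms has_vector_derivative_continuous unfolding mode_path_def by blast
qed

text \<open>Dividing a Floquet solution by \<open>\<bar>\<nu>\<bar>\<^sup>t\<^sup>/\<^sup>P\<close> leaves a function of period \<open>P\<close> up to sign.\<close>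
lemma multiplier_growth:
  fixes f :: "real \<Rightarrow> real"
  assumes cont: "continuous_on UNIV f" and P: "0 < P" and mult: "\<And>t. f (t + P) = \<nu> * f t" and \<nu>: "1 < \<bar>\<nu>\<bar>"
  defines "\<delta> \<equiv> ln \<bar>\<nu>\<bar> / P"
  shows "\<exists>M. \<forall>t. \<bar>f t\<bar> \<le> M * exp (\<delta> * t)"
    and "(\<And>t. f t \<noteq> 0) \<Longrightarrow> \<exists>m>0. \<forall>t. m * exp (\<delta> * t) \<le> \<bar>f t\<bar>"
proof -
  let ?w = "\<lambda>t. \<bar>f t\<bar> * exp (- \<delta> * t)"
  have c: "continuous_on UNIV ?w" by (intro continuous_intros cont)
  have per: "?w (t + P) = ?w t" for t
  proof -
    have "exp (- \<delta> * (t + P)) = exp (- \<delta> * t) * exp (- (\<delta> * P))"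
      by (simp add: exp_add[symmetric] algebra_simps)
    moreover have "exp (\<delta> * P) = \<bar>\<nu>\<bar>" using P \<nu> by (simp add: \<delta>_def)
    ultimately show ?thesis using \<nu> by (simp add: mult abs_mult exp_minus)
  qed
  have eq: "\<bar>f t\<bar> = ?w t * exp (\<delta> * t)" for t by (simp add: exp_minus)
  obtain M where "\<And>t. \<bar>?w t\<bar> \<le> M"
    using periodic_bounded[OF c per P] by (auto simp: bounded_iff)
  then have "?w t * exp (\<delta> * t) \<le> M * exp (\<delta> * t)" for t
    by (intro mult_right_mono) (use abs_le_D1 in auto)
  then show "\<exists>M. \<forall>t. \<bar>f t\<bar> \<le> M * exp (\<delta> * t)" unfolding eq[symmetric] by blast
  assume "\<And>t. f t \<noteq> 0"
  then obtain m where "0 < m" "\<And>t. m \<le> ?w t"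
    using periodic_positive_lower_bound[OF c per P] by auto
  then have "m * exp (\<delta> * t) \<le> ?w t * exp (\<delta> * t)" for t by (intro mult_right_mono) auto
  then show "\<exists>m>0. \<forall>t. m * exp (\<delta> * t) \<le> \<bar>f t\<bar>" unfolding eq[symmetric] using \<open>0 < m\<close> by blast
qed

context mode_equation
begin

lemma solution_fst_zero:
  assumes X: "solution X" and f: "\<And>t. fst (X t) = 0"
  shows "X t = 0"
proof -
  have f1: "slope (X t) = 0" for t
    using DERIV_unique[OF solution_coords(1)[OF X, of t], of 0] by (simp add: f)
  have g: "companion (X t) = 0" for t
    using DERIV_unique[OF solution_coords(2)[OF X, of t], of 0] by (simp add: f f1)
  have "companion_slope (X t) = 0"
    using DERIV_unique[OF solution_coords(3)[OF X, of t], of 0] by (simp add: g)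
  then show ?thesis using f f1 g by (simp add: prod_eq_iff)
qed

lemma principal_not_lin_growth:
  assumes "principal \<kappa> X"
  shows "\<not> lin_growth (\<lambda>t. fst (X t))"
proof
  assume "lin_growth (\<lambda>t. fst (X t))"
  then obtain C where C: "\<And>t. \<bar>fst (X t)\<bar> \<le> C * (1 + \<bar>t\<bar>)" by (auto simp: lin_growth_def)
  obtain m where m: "0 < m" "\<And>t. 0 \<le> t \<Longrightarrow> m * t\<^sup>2 \<le> fst (X (1 + t))"
    using assms nonneg_solution_superlinear[of X] by (auto simp: principal_def)
  have C0: "0 \<le> C" using order_trans[OF abs_ge_zero C[of 0]] by simp
  define t where "t = 3 * C / m + 1"
  have t: "1 \<le> t" using C0 m by (simp add: t_def)
  have "m * t\<^sup>2 \<le> C * (1 + \<bar>1 + t\<bar>)" using m(2)[of t] C[of "1 + t"] t by linarith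
  also have "\<dots> \<le> C * (3 * t)" using t C0 by (intro mult_left_mono) auto
  finally have "(m * t) * t \<le> (3 * C) * t" by (simp add: power2_eq_square mult_ac)
  then have "m * t \<le> 3 * C" using t by simp
  then show False using m(1) by (simp add: t_def distrib_left)
qed

text \<open>The operator \<open>X(t + P) + X(t - P) - 2 \<mu> X(t)\<close> annihilates \<open>Y\<close>, multiplies \<open>X\<close> by
  \<open>2 (\<kappa> - \<mu>)\<close>, and keeps linear growth.\<close>
lemma lin_growth_excludes_principal:
  assumes X: "principal \<kappa> X" and Y: "eigen \<mu> Y" and ne: "\<mu> \<noteq> \<kappa>"
    and Z: "lin_growth (\<lambda>t. fst (a *\<^sub>R X t + b *\<^sub>R Y t))" (is "lin_growth ?z")
  shows "a = 0"
proof (rule ccontr)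
  assume a: "a \<noteq> 0"
  have eX: "fst (X (t + P)) + fst (X (t - P)) = 2 * \<kappa> * fst (X t)" for t
    using X[unfolded principal_def eigen_def] by (metis fst_add fst_scaleR real_scaleR_def)
  have eY: "fst (Y (t + P)) + fst (Y (t - P)) = 2 * \<mu> * fst (Y t)" for t
    using Y[unfolded eigen_def] by (metis fst_add fst_scaleR real_scaleR_def)
  have "lin_growth (\<lambda>t. (1 / (2 * a * (\<kappa> - \<mu>))) * (1 * ?z (t + P) + 1 * ?z (t + - P)) + (- 2 * \<mu> / (2 * a * (\<kappa> - \<mu>))) * ?z t)"
    by (intro lin_growth_lincomb lin_growth_shift Z lin_growth_shift[OF Z, of "P"] lin_growth_shift[OF Z, of "- P"])
  moreover have "(1 / (2 * a * (\<kappa> - \<mu>))) * (1 * ?z (t + P) + 1 * ?z (t + - P)) + (- 2 * \<mu> / (2 * a * (\<kappa> - \<mu>))) * ?z t = fst (X t)" for t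
  proof -
    have "?z (t + P) + ?z (t - P) - 2 * \<mu> * ?z t
        = a * (fst (X (t + P)) + fst (X (t - P))) + b * (fst (Y (t + P)) + fst (Y (t - P))) - 2 * \<mu> * ?z t"
      by (simp add: algebra_simps)
    also have "\<dots> = 2 * a * (\<kappa> - \<mu>) * fst (X t)" unfolding eX eY by (simp add: algebra_simps)
    finally have "?z (t + P) + ?z (t - P) - 2 * \<mu> * ?z t = 2 * a * (\<kappa> - \<mu>) * fst (X t)" .
    then have "fst (X t) = (?z (t + P) + ?z (t - P) - 2 * \<mu> * ?z t) / (2 * a * (\<kappa> - \<mu>))"
      using a ne by simp
    then show ?thesis by (simp add: diff_divide_distrib)
  qed
  ultimately have "lin_growth (\<lambda>t. fst (X t))" by simp
  then show False using principal_not_lin_growth[OF X] by simp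
qed

text \<open>The recurrence \<open>x\<^sub>k\<^sub>+\<^sub>1 = 2 \<kappa> x\<^sub>k - x\<^sub>k\<^sub>-\<^sub>1\<close> conserves the quadratic form
  \<open>\<bar>x\<^sub>k\<^sub>+\<^sub>1\<bar>\<^sup>2 - 2 \<kappa> x\<^sub>k\<^sub>+\<^sub>1 \<bullet> x\<^sub>k + \<bar>x\<^sub>k\<bar>\<^sup>2\<close>, so this form is a periodic function of \<open>t\<close>.  Completing the square shows
  that it is non-negative for \<open>\<bar>\<kappa>\<bar> \<le> 1\<close>, and definite for \<open>\<bar>\<kappa>\<bar> < 1\<close>.\<close>
lemma eigen_invariant:
  assumes X: "solution X" "eigen \<kappa> X"
  obtains c where "0 \<le> c" "\<And>t. (norm (X (t + P) - \<kappa> *\<^sub>R X t))\<^sup>2 + (1 - \<kappa>\<^sup>2) * (norm (X t))\<^sup>2 \<le> c\<^sup>2"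
proof -
  let ?E = "\<lambda>t. (norm (X (t + P) - \<kappa> *\<^sub>R X t))\<^sup>2 + (1 - \<kappa>\<^sup>2) * (norm (X t))\<^sup>2"
  have per: "?E (t + P) = ?E t" for t
  proof -
    have "X (t + P + P) = (2 * \<kappa>) *\<^sub>R X (t + P) - X t"
      using X(2)[unfolded eigen_def, rule_format, of "t + P"] by (simp add: algebra_simps)
    then have "X (t + P + P) - \<kappa> *\<^sub>R X (t + P) = \<kappa> *\<^sub>R X (t + P) - X t" by (simp add: algebra_simps flip: scaleR_2)
    then show ?thesis
      by (simp only: power2_norm_eq_inner)
        (simp add: inner_diff_left inner_diff_right inner_commute algebra_simps power2_eq_square)
  qed
  have c: "continuous_on UNIV ?E"
    by (intro continuous_intros continuous_on_compose2[OF mode_path_continuous[OF X(1)]]) auto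
  obtain b where b: "\<And>t. \<bar>?E t\<bar> \<le> b" using periodic_bounded[OF c per P_pos] by (auto simp: bounded_iff)
  have "0 \<le> b" using order_trans[OF abs_ge_zero b] .
  then show ?thesis using that[of "sqrt b"] b abs_le_D1 by auto
qed

text \<open>By the invariant, one period increases the norm by at most a constant.\<close>
lemma eigen_lin_growth:
  assumes X: "solution X" "eigen \<kappa> X" "has_parity e X" "e = 1 \<or> e = -1" and \<kappa>: "\<bar>\<kappa>\<bar> \<le> 1"
  shows "lin_growth (\<lambda>t. fst (X t))"
proof -
  obtain c where c: "0 \<le> c" "\<And>t. (norm (X (t + P) - \<kappa> *\<^sub>R X t))\<^sup>2 + (1 - \<kappa>\<^sup>2) * (norm (X t))\<^sup>2 \<le> c\<^sup>2"
    by (rule eigen_invariant[OF X(1,2)]) (rule that)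
  have \<kappa>2: "\<kappa>\<^sup>2 \<le> 1" using \<kappa> by (simp add: abs_square_le_1)
  have step: "norm (X (t + P)) \<le> norm (X t) + c" for t
  proof -
    have "0 \<le> (1 - \<kappa>\<^sup>2) * (norm (X t))\<^sup>2" using \<kappa>2 by simp
    then have "(norm (X (t + P) - \<kappa> *\<^sub>R X t))\<^sup>2 \<le> c\<^sup>2" using c(2)[of t] by linarith
    then have "norm (X (t + P) - \<kappa> *\<^sub>R X t) \<le> c" using c(1) power2_le_imp_le by blast
    moreover have "norm (\<kappa> *\<^sub>R X t) \<le> norm (X t)" using mult_right_mono[OF \<kappa>, of "norm (X t)"] by simp
    ultimately show ?thesis using norm_triangle_sub[of "X (t + P)" "\<kappa> *\<^sub>R X t"] by linarith
  qed
  have steps: "norm (X (t + real k * P)) \<le> norm (X t) + real k * c" for t k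
  proof (induction k)
    case (Suc k)
    show ?case using step[of "t + real k * P"] Suc by (simp add: algebra_simps)
  qed simp
  obtain M where M: "0 \<le> M" "\<And>t. t \<in> {0..P} \<Longrightarrow> norm (X t) \<le> M"
  proof -
    have "compact (X ` {0..P})"
      by (intro compact_continuous_image continuous_on_subset[OF mode_path_continuous[OF X(1)]]) auto
    then obtain b where "\<And>z. z \<in> X ` {0..P} \<Longrightarrow> norm z \<le> b"
      using compact_imp_bounded bounded_iff by metis
    then show ?thesis using that[of "max b 0"] by fastforce
  qed
  have pos: "norm (X t) \<le> (M + c / P) * (1 + \<bar>t\<bar>)" if t: "0 \<le> t" for t
  proof -
    define k where "k = nat \<lfloor>t / P\<rfloor>"
    have k: "real k = of_int \<lfloor>t / P\<rfloor>" using t P_pos by (simp add: k_def)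
    have "t - real k * P \<in> {0..P}"
      using floor_divide_lower[OF P_pos, of t] floor_divide_upper[OF P_pos, of t] by (simp add: k algebra_simps)
    then have "norm (X (t - real k * P + real k * P)) \<le> M + real k * c"
      using M(2) steps[of "t - real k * P" k] by fastforce
    also have "real k * c \<le> t / P * c" using c(1) by (intro mult_right_mono) (auto simp: k)
    also have "M + t / P * c \<le> (M + c / P) * (1 + t)"
    proof -
      have "(M + c / P) * (1 + t) = M + t / P * c + (c / P + M * t)"
        by (simp add: algebra_simps add_divide_distrib)
      moreover have "0 \<le> c / P + M * t" using M(1) c(1) P_pos t by simp
      ultimately show ?thesis by linarith
    qed
    finally show ?thesis using t by simp
  qed
  have "norm (X t) \<le> (M + c / P) * (1 + \<bar>t\<bar>)" for t
  proof (cases "0 \<le> t")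
    case False
    have "norm (X (- t)) = norm (X t)" using X(3,4) by (auto simp: has_parity_def)
    then show ?thesis using pos[of "- t"] False by simp
  qed (rule pos)
  then have "\<bar>fst (X t)\<bar> \<le> (M + c / P) * (1 + \<bar>t\<bar>)" for t
    using norm_fst_le[of "fst (X t)" "snd (X t)"] order_trans by fastforce
  then show ?thesis by (auto simp: lin_growth_def)
qed

text \<open>For \<open>\<bar>\<kappa>\<bar> < 1\<close> the invariant is definite and bounds \<open>X\<close> itself.  For \<open>\<kappa> = \<plusminus>1\<close> a Jordan block may
  make \<open>X\<close> grow linearly; then \<open>X(t + P) - \<kappa> X(t)\<close> is a non-zero solution with multiplier \<open>\<kappa>\<close>.\<close>
lemma eigen_gives_bounded:
  assumes X: "solution X" "eigen \<kappa> X" "X 0 \<noteq> 0" and \<kappa>: "\<bar>\<kappa>\<bar> \<le> 1"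
  shows "\<exists>Y t. solution Y \<and> bounded (range Y) \<and> Y t \<noteq> 0"
proof (cases "\<kappa>\<^sup>2 = 1")
  case False
  then have \<kappa>2: "\<kappa>\<^sup>2 < 1" using \<kappa> by (simp add: abs_square_le_1 order_less_le)
  obtain c where c: "0 \<le> c" "\<And>t. (norm (X (t + P) - \<kappa> *\<^sub>R X t))\<^sup>2 + (1 - \<kappa>\<^sup>2) * (norm (X t))\<^sup>2 \<le> c\<^sup>2"
    by (rule eigen_invariant[OF X(1,2)]) (rule that)
  have "(1 - \<kappa>\<^sup>2) * (norm (X t))\<^sup>2 \<le> c\<^sup>2" for t using c(2)[of t] zero_le_power2[of "norm (X (t + P) - \<kappa> *\<^sub>R X t)"] by linarith
  then have "(norm (X t))\<^sup>2 \<le> c\<^sup>2 / (1 - \<kappa>\<^sup>2)" for t using \<kappa>2 by (simp add: pos_le_divide_eq mult.commute)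
  then have "norm (X t) \<le> sqrt (c\<^sup>2 / (1 - \<kappa>\<^sup>2))" for t by (rule real_le_rsqrt)
  then have "bounded (range X)" by (auto simp: bounded_iff)
  then show ?thesis using X by blast
next
  case True
  then have abs1: "\<bar>\<kappa>\<bar> = 1" by (metis abs_1 power2_eq_1_iff abs_minus_cancel)
  have bdd: "bounded (range Z)" if Z: "solution Z" "\<And>t. Z (t + P) = \<kappa> *\<^sub>R Z t" for Z
  proof -
    have "bounded (range (\<lambda>t. norm (Z t)))"
      by (rule periodic_bounded[OF _ _ P_pos]) (use Z abs1 mode_path_continuous[OF Z(1)] in \<open>auto intro!: continuous_intros\<close>)
    then show ?thesis by (auto simp: bounded_iff)
  qed
  let ?Y = "\<lambda>t. X (t + P) - \<kappa> *\<^sub>R X t"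
  have Y: "solution ?Y" by (intro mode_path_diff mode_path_scale mode_path_shift X Q_per)
  have multY: "?Y (t + P) = \<kappa> *\<^sub>R ?Y t" for t
  proof -
    have "X (t + P + P) = (2 * \<kappa>) *\<^sub>R X (t + P) - X t"
      using X(2)[unfolded eigen_def, rule_format, of "t + P"] by (simp add: algebra_simps)
    moreover have "\<kappa> * \<kappa> = 1" using True by (simp add: power2_eq_square)
    ultimately show ?thesis by (simp add: scaleR_diff_right scaleR_left.add algebra_simps flip: scaleR_2)
  qed
  show ?thesis
  proof (cases "\<forall>t. ?Y t = 0")
    case True
    then have "X (t + P) = \<kappa> *\<^sub>R X t" for t by simp
    then show ?thesis using bdd X by blast
  next
    case False
    then show ?thesis using bdd[OF Y multY] Y by blast
  qed
qed

text \<open>If \<open>s\<close> is the supremum of the norm, the recurrence gives \<open>2 \<bar>\<kappa>\<bar> s \<le> 2 s\<close>.\<close>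
lemma bounded_eigen:
  assumes X: "eigen \<kappa> X" "X 0 \<noteq> 0" and bdd: "bounded (range X)"
  shows "\<bar>\<kappa>\<bar> \<le> 1"
proof (rule ccontr)
  assume \<kappa>: "\<not> \<bar>\<kappa>\<bar> \<le> 1"
  define s where "s = (SUP t. norm (X t))"
  have bd: "bdd_above (range (\<lambda>t. norm (X t)))"
    using bdd by (auto simp: bounded_iff bdd_above_def)
  have le: "norm (X t) \<le> s" for t unfolding s_def by (rule cSUP_upper[OF _ bd]) simp
  have "norm (X t) \<le> s / \<bar>\<kappa>\<bar>" for t
  proof -
    have "2 * \<bar>\<kappa>\<bar> * norm (X t) = norm (X (t + P) + X (t - P))"
      using X(1) by (simp add: eigen_def abs_mult)
    also have "\<dots> \<le> s + s" by (rule norm_triangle_le[OF add_mono[OF le le]])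
    finally show ?thesis using \<kappa> by (simp add: field_simps)
  qed
  then have "(SUP t. norm (X t)) \<le> s / \<bar>\<kappa>\<bar>" by (intro cSUP_least) auto
  then have "s \<le> s / \<bar>\<kappa>\<bar>" by (simp only: s_def)
  then have "s * \<bar>\<kappa>\<bar> \<le> s * 1" using \<kappa> by (simp add: field_simps)
  moreover have "0 < s" using le[of 0] X(2) by (meson less_le_trans zero_less_norm_iff)
  ultimately show False using \<kappa> by (simp add: mult_le_cancel_left)
qed

text \<open>Away from the multipliers \<open>\<plusminus>1\<close>, the operator \<open>M - M\<^sup>-\<^sup>1\<close> exchanges the parities without
  changing the eigenvalue.\<close>
lemma eigen_other_parity:
  assumes X: "solution X" "has_parity e X" "eigen \<kappa> X" "X 0 \<noteq> 0" and \<kappa>: "\<kappa>\<^sup>2 \<noteq> 1"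
    and e: "e = 1 \<or> e = -1"
  defines "Y \<equiv> \<lambda>t. X (t + P) - X (t - P)"
  shows "solution Y" "has_parity (- e) Y" "eigen \<kappa> Y" "Y 0 \<noteq> 0"
proof -
  have Y': "Y = (\<lambda>t. X (t + P) - X (t + (- P)))" by (simp add: Y_def)
  show sol: "solution Y" unfolding Y'
    by (intro mode_path_diff mode_path_shift X) (use Q_per Q_per' in auto)
  show par: "has_parity (- e) Y"
    unfolding has_parity_def
  proof
    fix t
    have "- (t - P) = - t + P" "- (t + P) = - t - P" by simp_all
    then have "X (- t + P) = e *\<^sub>R flip (X (t - P))" "X (- t - P) = e *\<^sub>R flip (X (t + P))"
      using X(2)[unfolded has_parity_def] by metis+
    then show "Y (- t) = - e *\<^sub>R flip (Y t)"
      by (simp add: Y_def linear_diff[OF linear_flip] algebra_simps)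
  qed
  have eX: "X (t + P) + X (t - P) = (2 * \<kappa>) *\<^sub>R X t" for t using X(3) by (simp add: eigen_def)
  show "eigen \<kappa> Y"
    unfolding eigen_def
  proof
    fix t
    have "Y (t + P) + Y (t - P) = (X (t + P + P) + X (t + P - P)) - (X (t - P + P) + X (t - P - P))"
      by (simp add: Y_def)
    also have "\<dots> = (2 * \<kappa>) *\<^sub>R Y t" by (simp only: eX) (simp add: Y_def algebra_simps)
    finally show "Y (t + P) + Y (t - P) = (2 * \<kappa>) *\<^sub>R Y t" .
  qed
  show "Y 0 \<noteq> 0"
  proof
    assume "Y 0 = 0"
    then have "Y = (\<lambda>_. 0)" using solution_unique[OF sol solution_zero] by simp
    then have "X (t + P) = X (t - P)" for t by (simp add: Y_def fun_eq_iff)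
    note eq = this
    have s: "X (t - P) = \<kappa> *\<^sub>R X t" "X (t + P) = \<kappa> *\<^sub>R X t" for t
    proof -
      have "2 *\<^sub>R X (t - P) = 2 *\<^sub>R (\<kappa> *\<^sub>R X t)"
        using eX[of t] unfolding eq[of t] scaleR_2[symmetric] scaleR_scaleR .
      then show "X (t - P) = \<kappa> *\<^sub>R X t" by (rule scaleR_left_imp_eq[rotated]) simp
      then show "X (t + P) = \<kappa> *\<^sub>R X t" using eq[of t] by (rule trans[rotated])
    qed
    have "X 0 = X (0 + P - P)" by simp
    also have "\<dots> = \<kappa>\<^sup>2 *\<^sub>R X 0" unfolding s(1)[of "0 + P"] s(2)[of 0] by (simp add: power2_eq_square)
    finally have "(1 - \<kappa>\<^sup>2) *\<^sub>R X 0 = 0" by (simp add: algebra_simps)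
    then show False using \<kappa> X(4) by simp
  qed
qed

lemma eigenvalue_cases:
  assumes e: "e = 1 \<or> e = -1"
    and F: "solution F" "has_parity e F" "eigen \<kappa> F" "F 0 \<noteq> 0"
    and G: "solution G" "has_parity e G" "eigen \<mu> G" "G 0 \<noteq> 0" and ne: "\<kappa> \<noteq> \<mu>"
    and X: "solution X" "has_parity e X" "eigen \<nu> X" "X 0 \<noteq> 0"
  shows "\<nu> = \<kappa> \<or> \<nu> = \<mu>"
proof (rule ccontr)
  assume \<nu>: "\<not> ?thesis"
  obtain a b where ab: "X = (\<lambda>t. a *\<^sub>R F t + b *\<^sub>R G t)" by (rule parity_span[OF e F G ne X(1,2)])
  have "(a * (\<nu> - \<kappa>)) *\<^sub>R F t + (b * (\<nu> - \<mu>)) *\<^sub>R G t = 0" for t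
  proof -
    have "0 = a *\<^sub>R (F (t + P) + F (t - P)) + b *\<^sub>R (G (t + P) + G (t - P)) - (2 * \<nu>) *\<^sub>R (a *\<^sub>R F t + b *\<^sub>R G t)"
      using X(3)[unfolded eigen_def ab, rule_format, of t] by (simp add: algebra_simps)
    also have "\<dots> = - 2 *\<^sub>R ((a * (\<nu> - \<kappa>)) *\<^sub>R F t + (b * (\<nu> - \<mu>)) *\<^sub>R G t)"
      by (simp only: F(3)[unfolded eigen_def, rule_format] G(3)[unfolded eigen_def, rule_format])
        (simp add: algebra_simps)
    finally have "- 2 *\<^sub>R ((a * (\<nu> - \<kappa>)) *\<^sub>R F t + (b * (\<nu> - \<mu>)) *\<^sub>R G t) = 0" by (rule sym)
    then show ?thesis by (simp only: scaleR_eq_0_iff) simp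
  qed
  from eigen_separate[OF F(3) G(3) ne this, of 0] have "a = 0" "b = 0" using \<nu> F(4) G(4) by auto
  then show False using X(4) ab by simp
qed

end

section \<open>Bases of the scalar solution spaces\<close>

lemma forward_growingI:
  assumes "0 < \<delta>" "0 < \<delta>'" "0 < m" "\<And>t. 0 \<le> t \<Longrightarrow> m * exp (\<delta> * t) \<le> \<bar>f t\<bar>"
    "\<And>t. t \<le> 0 \<Longrightarrow> \<bar>f t\<bar> \<le> M * exp (\<delta>' * t)"
  shows "forward_growing f"
  unfolding forward_growing_def using assms by blast

context mode_equation
begin

lemma parity_part:
  assumes Z: "solution Z" and e: "e = 1 \<or> e = -1"
  defines "Ze \<equiv> \<lambda>t. Z t + e *\<^sub>R flip (Z (- t))"
  shows "solution Ze" "has_parity e Ze"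
proof -
  show "solution Ze"
    unfolding Ze_def by (intro mode_path_add mode_path_scale mode_path_reflect Z Q_even)
  show "has_parity e Ze"
    using e unfolding has_parity_def Ze_def
    by (auto simp: linear_add[OF linear_flip] linear_diff[OF linear_flip] linear_neg[OF linear_flip])
qed

text \<open>Write \<open>2 \<kappa> > 2 \<mu>\<close> for the even and \<open>2 \<kappa>' > 2 \<mu>'\<close> for the odd eigenvalues.  Exchanging parities
  gives \<open>\<kappa> = \<kappa>'\<close>, and \<open>\<mu> = \<mu>'\<close> if one of \<open>\<bar>\<mu>\<bar>, \<bar>\<mu>'\<bar>\<close> exceeds \<open>1\<close>.  The even or the odd part of the bounded solution is
  non-zero and has no principal component, so it is a multiple of \<open>Y\<close> or \<open>Y'\<close>, and one of \<open>\<bar>\<mu>\<bar>, \<bar>\<mu>'\<bar>\<close> is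
  at most \<open>1\<close>; hence both are.\<close>
theorem bounded_solution_gives_slow_basis:
  assumes Z: "solution Z" "bounded (range Z)" "Z t0 \<noteq> 0"
  shows "\<exists>u. indexed_basis {..<2::nat} u {f \<in> mode_functions A B Q. lin_growth f}"
proof -
  obtain X Y \<kappa> \<mu> where X: "has_parity 1 X" "principal \<kappa> X" "1 < \<kappa>"
    and Y: "solution Y" "has_parity 1 Y" "eigen \<mu> Y" "Y 0 \<noteq> 0" "\<mu> < \<kappa>" "- \<kappa> < \<mu>"
    by (rule parity_modes[of 1]) auto
  obtain X' Y' \<kappa>' \<mu>' where X': "has_parity (-1) X'" "principal \<kappa>' X'" "1 < \<kappa>'"
    and Y': "solution Y'" "has_parity (-1) Y'" "eigen \<mu>' Y'" "Y' 0 \<noteq> 0" "\<mu>' < \<kappa>'" "- \<kappa>' < \<mu>'"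
    by (rule parity_modes[of "-1"]) auto
  have XX: "solution X" "eigen \<kappa> X" "X 0 \<noteq> 0" and XX': "solution X'" "eigen \<kappa>' X'" "X' 0 \<noteq> 0"
    using X(2) X'(2) by (auto simp: principal_def)
  \<comment> \<open>an eigenvalue other than \<open>\<plusminus>2\<close> of one parity occurs in the other\<close>
  have up: "\<nu> = \<kappa>' \<or> \<nu> = \<mu>'" if F: "solution F" "has_parity 1 F" "eigen \<nu> F" "F 0 \<noteq> 0" "\<nu>\<^sup>2 \<noteq> 1" for F \<nu>
  proof -
    note o = eigen_other_parity[OF F, simplified]
    show ?thesis
      by (rule eigenvalue_cases[OF _ XX'(1) X'(1) XX'(2,3) Y'(1-4) _ o(1-3)]) (use o(4) Y' in auto)
  qed
  have down: "\<nu> = \<kappa> \<or> \<nu> = \<mu>" if F: "solution F" "has_parity (-1) F" "eigen \<nu> F" "F 0 \<noteq> 0" "\<nu>\<^sup>2 \<noteq> 1" for F \<nu>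
  proof -
    note o = eigen_other_parity[OF F, simplified]
    show ?thesis
      by (rule eigenvalue_cases[OF _ XX(1) X(1) XX(2,3) Y(1-4) _ o(1-3)]) (use o(4) Y in auto)
  qed
  have sq: "\<nu>\<^sup>2 \<noteq> 1" if "1 < \<bar>\<nu>\<bar>" for \<nu> :: real using that by (auto simp: power2_eq_1_iff)
  have \<kappa>: "\<kappa> = \<kappa>'"
    using up[OF XX(1) X(1) XX(2,3) sq] down[OF XX'(1) X'(1) XX'(2,3) sq] X(3) X'(3) Y(5) Y'(5) by auto
  have le1: "\<bar>\<mu>\<bar> \<le> 1 \<longleftrightarrow> \<bar>\<mu>'\<bar> \<le> 1"
  proof -
    have "\<mu> = \<mu>'" if "1 < \<bar>\<mu>\<bar>" using up[OF Y(1-4) sq[OF that]] \<kappa> Y(5) by auto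
    moreover have "\<mu> = \<mu>'" if "1 < \<bar>\<mu>'\<bar>" using down[OF Y'(1-4) sq[OF that]] \<kappa> Y'(5) by auto
    ultimately show ?thesis by linarith
  qed
  \<comment> \<open>a solution of at most linear growth has no principal component in either parity\<close>
  have slow: "\<exists>b. (\<lambda>t. Z t + e *\<^sub>R flip (Z (- t))) = (\<lambda>t. b *\<^sub>R G t)"
    if Z: "solution Z" "lin_growth (\<lambda>t. fst (Z t))" and e: "e = 1 \<or> e = -1"
      and F: "has_parity e F" "principal k F"
      and G: "solution G" "has_parity e G" "eigen m G" "G 0 \<noteq> 0" "m < k" for Z e F G k m
  proof -
    have F': "solution F" "eigen k F" "F 0 \<noteq> 0" using F(2) by (auto simp: principal_def)
    obtain a b where ab: "(\<lambda>t. Z t + e *\<^sub>R flip (Z (- t))) = (\<lambda>t. a *\<^sub>R F t + b *\<^sub>R G t)"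
      by (rule parity_span[OF e F'(1) F(1) F'(2,3) G(1-4) _ parity_part[OF Z(1) e]]) (use G(5) in auto)
    have "lin_growth (\<lambda>t. 1 * fst (Z t) + e * fst (Z (- t)))"
      by (intro lin_growth_lincomb Z(2) lin_growth_reflect[OF Z(2)])
    moreover have "1 * fst (Z t) + e * fst (Z (- t)) = fst (a *\<^sub>R F t + b *\<^sub>R G t)" for t
      using ab[THEN fun_cong, of t, THEN arg_cong[where f = fst]] by simp
    ultimately have "lin_growth (\<lambda>t. fst (a *\<^sub>R F t + b *\<^sub>R G t))" by simp
    from lin_growth_excludes_principal[OF F(2) G(3) _ this] have "a = 0" using G(5) by simp
    then show ?thesis using ab by auto
  qed
  have "bounded (range (\<lambda>t. fst (Z t)))"
    using bounded_fst[OF Z(2)] by (simp add: image_comp o_def)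
  then have Zlin: "lin_growth (\<lambda>t. fst (Z t))" by (rule bounded_lin_growth)
  \<comment> \<open>a non-zero bounded part of \<open>Z\<close> makes its eigensolution bounded\<close>
  have small: "\<bar>m\<bar> \<le> 1"
    if "e = 1 \<or> e = -1" "solution G" "eigen m G" "G 0 \<noteq> 0" "(\<lambda>t. Z t + e *\<^sub>R flip (Z (- t))) = (\<lambda>t. b *\<^sub>R G t)"
      "Z t0 + e *\<^sub>R flip (Z (- t0)) \<noteq> 0" for e G m b
  proof -
    have eq: "Z t + e *\<^sub>R flip (Z (- t)) = b *\<^sub>R G t" for t using that(5) by (rule fun_cong)
    have b: "b \<noteq> 0" using that(6) eq[of t0] by auto
    obtain C where C: "\<And>t. norm (Z t) \<le> C" using Z(2) by (auto simp: bounded_iff)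
    have "norm (G t) \<le> (C + C) / \<bar>b\<bar>" for t
    proof -
      have "norm (e *\<^sub>R flip (Z (- t))) = norm (Z (- t))" using that(1) by auto
      then have "norm (b *\<^sub>R G t) \<le> C + C"
        unfolding eq[symmetric] using norm_triangle_ineq[of "Z t" "e *\<^sub>R flip (Z (- t))"] C[of t] C[of "- t"]
        by linarith
      then have "\<bar>b\<bar> * norm (G t) \<le> C + C" by simp
      then show ?thesis using b by (simp add: pos_le_divide_eq mult.commute[of _ "\<bar>b\<bar>"])
    qed
    then have "bounded (range G)" by (auto simp: bounded_iff)
    then show ?thesis by (rule bounded_eigen[OF that(3,4)])
  qed
  obtain b where b: "(\<lambda>t. Z t + 1 *\<^sub>R flip (Z (- t))) = (\<lambda>t. b *\<^sub>R Y t)"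
    using slow[OF Z(1) Zlin _ X(1,2) Y(1-5)] by blast
  obtain b' where b': "(\<lambda>t. Z t + (- 1) *\<^sub>R flip (Z (- t))) = (\<lambda>t. b' *\<^sub>R Y' t)"
    using slow[OF Z(1) Zlin _ X'(1,2) Y'(1-5)] by blast
  have "Z t0 + 1 *\<^sub>R flip (Z (- t0)) \<noteq> 0 \<or> Z t0 + (- 1) *\<^sub>R flip (Z (- t0)) \<noteq> 0"
  proof (rule ccontr)
    assume n: "\<not> ?thesis"
    have "2 *\<^sub>R Z t0 = (Z t0 + 1 *\<^sub>R flip (Z (- t0))) + (Z t0 + (- 1) *\<^sub>R flip (Z (- t0)))"
      by (simp add: scaleR_2)
    also have "\<dots> = 0" using n by (simp only: de_Morgan_disj not_not add_0)
    finally show False using Z(3) by simp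
  qed
  then have \<mu>: "\<bar>\<mu>\<bar> \<le> 1" "\<bar>\<mu>'\<bar> \<le> 1"
    using small[OF _ Y(1,3,4) b] small[OF _ Y'(1,3,4) b'] le1 by auto
  have lin: "lin_growth (\<lambda>t. fst (Y t))" "lin_growth (\<lambda>t. fst (Y' t))"
    using eigen_lin_growth[OF Y(1,3,2) _ \<mu>(1)] eigen_lin_growth[OF Y'(1,3,2) _ \<mu>(2)] by auto
  define u where "u i t = (if i = (0::nat) then fst (Y t) else fst (Y' t))" for i t
  have sum_u: "(\<Sum>i<2. c i *\<^sub>R u i t) = c 0 * fst (Y t) + c 1 * fst (Y' t)" for c t
    by (simp add: u_def numeral_2_eq_2)
  have "indexed_basis {..<2} u {f \<in> mode_functions A B Q. lin_growth f}"
    unfolding indexed_basis_def sum_u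
  proof (intro conjI allI impI set_eqI iffI)
    fix f assume "f \<in> {f \<in> mode_functions A B Q. lin_growth f}"
    then obtain W where W: "solution W" "f = (\<lambda>t. fst (W t))" "lin_growth (\<lambda>t. fst (W t))"
      by (auto simp: mode_functions_def)
    obtain c where c: "(\<lambda>t. W t + 1 *\<^sub>R flip (W (- t))) = (\<lambda>t. c *\<^sub>R Y t)"
      using slow[OF W(1,3) _ X(1,2) Y(1-5)] by blast
    obtain d where d: "(\<lambda>t. W t + (- 1) *\<^sub>R flip (W (- t))) = (\<lambda>t. d *\<^sub>R Y' t)"
      using slow[OF W(1,3) _ X'(1,2) Y'(1-5)] by blast
    have "f t = c / 2 * fst (Y t) + d / 2 * fst (Y' t)" for t
      using c[THEN fun_cong, of t, THEN arg_cong[where f = fst]] d[THEN fun_cong, of t, THEN arg_cong[where f = fst]]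
      by (simp add: W(2))
    then show "f \<in> range (\<lambda>c t. c (0::nat) * fst (Y t) + c 1 * fst (Y' t))"
      by (intro range_eqI[where x = "\<lambda>i. if i = 0 then c / 2 else d / 2"]) auto
  next
    fix f assume "f \<in> range (\<lambda>c t. c (0::nat) * fst (Y t) + c 1 * fst (Y' t))"
    then obtain c where f: "f = (\<lambda>t. c (0::nat) * fst (Y t) + c 1 * fst (Y' t))" by (elim rangeE)
    have "f \<in> mode_functions A B Q"
      unfolding mode_functions_def f
      by (rule CollectI, rule exI[of _ "\<lambda>t. c 0 *\<^sub>R Y t + c 1 *\<^sub>R Y' t"])
        (simp add: mode_path_lincomb[OF Y(1) Y'(1)])
    then show "f \<in> {f \<in> mode_functions A B Q. lin_growth f}"
      using lin_growth_lincomb[OF lin] f by simp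
  next
    fix c :: "nat \<Rightarrow> real" assume 0: "\<forall>t. c 0 * fst (Y t) + c 1 * fst (Y' t) = 0"
    have "fst (Y (- t)) = fst (Y t)" "fst (Y' (- t)) = - fst (Y' t)" for t
      using Y(2) Y'(2) by (simp_all add: has_parity_def)
    then have "c 0 * fst (Y t) = 0" "c 1 * fst (Y' t) = 0" for t
      using 0[rule_format, of t] 0[rule_format, of "- t"] by auto
    then have "c 0 = 0" "c 1 = 0"
      using solution_fst_zero[OF Y(1), of 0] solution_fst_zero[OF Y'(1), of 0] Y(4) Y'(4) by auto
    then show "\<forall>i\<in>{..<2}. c i = 0" by (auto simp: less_2_cases_iff)
  qed auto
  then show ?thesis by blast
qed

lemma multiplier_root:
  assumes "1 < \<bar>\<kappa>\<bar>"
  obtains \<nu> :: real where "1 < \<bar>\<nu>\<bar>" "\<nu> + 1 / \<nu> = 2 * \<kappa>" "\<bar>\<nu>\<bar> = \<bar>\<kappa>\<bar> + sqrt (\<kappa>\<^sup>2 - 1)" "0 < \<kappa> \<Longrightarrow> 0 < \<nu>"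
proof
  define \<nu> where "\<nu> = \<kappa> + sgn \<kappa> * sqrt (\<kappa>\<^sup>2 - 1)"
  have k2: "1 < \<kappa>\<^sup>2" using assms by (metis one_less_power pos2 power2_abs)
  have r: "0 < sqrt (\<kappa>\<^sup>2 - 1)" using k2 by simp
  show abs: "\<bar>\<nu>\<bar> = \<bar>\<kappa>\<bar> + sqrt (\<kappa>\<^sup>2 - 1)"
  proof (cases "0 < \<kappa>")
    case True then show ?thesis using r by (simp add: \<nu>_def)
  next
    case False
    then have "\<kappa> < 0" using assms by auto
    then have "\<nu> = \<kappa> - sqrt (\<kappa>\<^sup>2 - 1)" by (simp add: \<nu>_def)
    then show ?thesis using r \<open>\<kappa> < 0\<close> by linarith
  qed
  show "1 < \<bar>\<nu>\<bar>" using abs assms r by linarith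
  then have "\<nu> \<noteq> 0" by auto
  have "(\<nu> - \<kappa>)\<^sup>2 = \<kappa>\<^sup>2 - 1"
    using k2 by (auto simp: \<nu>_def power_mult_distrib sgn_if split: if_splits)
  then have "\<nu> * \<nu> + 1 = 2 * \<kappa> * \<nu>" by (simp add: power2_eq_square algebra_simps)
  then show "\<nu> + 1 / \<nu> = 2 * \<kappa>" using \<open>\<nu> \<noteq> 0\<close> by (simp add: field_simps)
  show "0 < \<kappa> \<Longrightarrow> 0 < \<nu>" using r unfolding \<nu>_def by (simp del: real_sqrt_gt_0_iff)
qed

text \<open>An even eigensolution \<open>X\<close> splits into Floquet solutions: \<open>U\<close> has multiplier \<open>\<nu>\<close>, its reflection
  has multiplier \<open>1 / \<nu>\<close>, their sum is a multiple of \<open>X\<close> and their difference is the odd partner of \<open>X\<close>.\<close>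
lemma eigen_split:
  assumes X: "solution X" "has_parity 1 X" "eigen \<kappa> X" and \<nu>: "1 < \<bar>\<nu>\<bar>" "\<nu> + 1 / \<nu> = 2 * \<kappa>"
  defines "U \<equiv> \<lambda>t. X (t + P) - (1 / \<nu>) *\<^sub>R X t"
  shows "solution U" "U (t + P) = \<nu> *\<^sub>R U t"
    "U t + flip (U (- t)) = (\<nu> - 1 / \<nu>) *\<^sub>R X t" "U t - flip (U (- t)) = X (t + P) - X (t - P)"
proof -
  have \<nu>0: "\<nu> \<noteq> 0" using \<nu> by auto
  show "solution U"
    unfolding U_def by (intro mode_path_diff mode_path_scale mode_path_shift X Q_per)
  have "X (t + P + P) = (2 * \<kappa>) *\<^sub>R X (t + P) - X t"
    using X(3)[unfolded eigen_def, rule_format, of "t + P"] by (simp add: algebra_simps)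
  then have "U (t + P) = (2 * \<kappa> - 1 / \<nu>) *\<^sub>R X (t + P) - X t"
    by (simp add: U_def scaleR_diff_left)
  also have "2 * \<kappa> - 1 / \<nu> = \<nu>" using \<nu>(2) by simp
  finally show "U (t + P) = \<nu> *\<^sub>R U t" using \<nu>0 by (simp add: U_def scaleR_diff_right)
  have "X (- t + P) = flip (X (t - P))" "X (- t) = flip (X t)"
    using X(2)[unfolded has_parity_def, rule_format, of "t - P"] X(2)[unfolded has_parity_def, rule_format, of t]
    by simp_all
  then have fU: "flip (U (- t)) = X (t - P) - (1 / \<nu>) *\<^sub>R X t"
    by (simp only: U_def linear_diff[OF linear_flip] linear_scale[OF linear_flip] flip_flip)
  have "U t + flip (U (- t)) = (X (t + P) + X (t - P)) - (2 / \<nu>) *\<^sub>R X t"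
    unfolding fU by (simp add: U_def algebra_simps flip: scaleR_2)
  also have "\<dots> = (2 * \<kappa> - 2 / \<nu>) *\<^sub>R X t" using X(3) by (simp add: eigen_def scaleR_diff_left)
  also have "2 * \<kappa> - 2 / \<nu> = \<nu> - 1 / \<nu>" using \<nu>(2) by (simp add: field_simps)
  finally show "U t + flip (U (- t)) = (\<nu> - 1 / \<nu>) *\<^sub>R X t" .
  show "U t - flip (U (- t)) = X (t + P) - X (t - P)" unfolding fU by (simp add: U_def)
qed

text \<open>Let \<open>U\<close> and \<open>V\<close> be the Floquet solutions with multipliers \<open>\<alpha>\<close> and \<open>\<beta>\<close>, \<open>1 < \<bar>\<beta>\<bar> \<le> \<alpha>\<close>.  They decay at
  \<open>-\<infinity>\<close> and grow at \<open>\<infinity>\<close>, but \<open>V\<close> may vanish at arbitrarily large times.  Since \<open>U\<close> is positive and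
  dominates \<open>\<bar>V\<bar>\<close> for \<open>t \<ge> 0\<close> up to a constant, \<open>V + N U\<close> with large \<open>N\<close> has no such zeros.  The basis
  consists of \<open>U\<close>, \<open>V + N U\<close> and their reflections.\<close>
theorem no_bounded_solution_gives_hyperbolic_basis:
  assumes none: "\<And>Z t. solution Z \<Longrightarrow> bounded (range Z) \<Longrightarrow> Z t = 0"
  shows "\<exists>u. indexed_basis {..<4::nat} u (mode_functions A B Q) \<and>
    (\<forall>i<4. forward_growing (u i) \<or> forward_growing (\<lambda>t. u i (- t)))"
proof -
  obtain X Y \<kappa> \<mu> where X: "has_parity 1 X" "principal \<kappa> X" "1 < \<kappa>"
    and Y: "solution Y" "has_parity 1 Y" "eigen \<mu> Y" "Y 0 \<noteq> 0" "\<mu> < \<kappa>" "- \<kappa> < \<mu>"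
    by (rule parity_modes[of 1]) auto
  have XX: "solution X" "eigen \<kappa> X" "X 0 \<noteq> 0" and X_pos: "\<And>t. 0 < t \<Longrightarrow> 0 < fst (X t)"
    and X_nonneg: "\<And>t. 0 \<le> t \<Longrightarrow> nonneg_state (X t)"
    using X(2) by (auto simp: principal_def)
  have \<mu>: "1 < \<bar>\<mu>\<bar>" using eigen_gives_bounded[OF Y(1,3,4)] none by fastforce
  obtain \<alpha> where \<alpha>: "1 < \<bar>\<alpha>\<bar>" "\<alpha> + 1 / \<alpha> = 2 * \<kappa>" "\<bar>\<alpha>\<bar> = \<bar>\<kappa>\<bar> + sqrt (\<kappa>\<^sup>2 - 1)" "0 < \<alpha>"
    by (rule multiplier_root[of \<kappa>]) (use X(3) in auto)
  obtain \<beta> where \<beta>: "1 < \<bar>\<beta>\<bar>" "\<beta> + 1 / \<beta> = 2 * \<mu>" "\<bar>\<beta>\<bar> = \<bar>\<mu>\<bar> + sqrt (\<mu>\<^sup>2 - 1)"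
    by (rule multiplier_root[OF \<mu>])
  have \<beta>\<alpha>: "\<bar>\<beta>\<bar> \<le> \<bar>\<alpha>\<bar>"
  proof -
    have "\<bar>\<mu>\<bar> \<le> \<bar>\<kappa>\<bar>" using Y(5,6) by linarith
    moreover from this have "\<mu>\<^sup>2 \<le> \<kappa>\<^sup>2" by (simp add: abs_le_square_iff)
    ultimately show ?thesis unfolding \<alpha>(3) \<beta>(3) by (intro add_mono) auto
  qed
  define U where "U t = X (t + P) - (1 / \<alpha>) *\<^sub>R X t" for t
  define V where "V t = Y (t + P) - (1 / \<beta>) *\<^sub>R Y t" for t
  define U' where "U' t = flip (U (- t))" for t
  define V' where "V' t = flip (V (- t))" for t
  note U = eigen_split[OF XX(1) X(1) XX(2) \<alpha>(1,2), folded U_def, folded U'_def]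
  note V = eigen_split[OF Y(1-3) \<beta>(1,2), folded V_def, folded V'_def]
  have U': "solution U'" and V': "solution V'"
    unfolding U'_def V'_def by (intro mode_path_reflect Q_even U V)+
  have sub_inverse: "\<nu> - 1 / \<nu> \<noteq> 0" if "1 < \<bar>\<nu>\<bar>" for \<nu> :: real
  proof
    assume "\<nu> - 1 / \<nu> = 0"
    then have "\<nu>\<^sup>2 = 1" using that by (auto simp: power2_eq_square field_simps)
    then show False using that by (auto simp: power2_eq_1_iff)
  qed
  define \<sigma> \<tau> where "\<sigma> = \<alpha> - 1 / \<alpha>" and "\<tau> = \<beta> - 1 / \<beta>"
  have \<sigma>\<tau>: "\<sigma> \<noteq> 0" "\<tau> \<noteq> 0"
    unfolding \<sigma>_def \<tau>_def using sub_inverse \<alpha>(1) \<beta>(1) by auto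
  define Xo where "Xo t = X (t + P) - X (t - P)" for t
  define Yo where "Yo t = Y (t + P) - Y (t - P)" for t
  have sq: "\<nu>\<^sup>2 \<noteq> 1" if "1 < \<bar>\<nu>\<bar>" for \<nu> :: real using that by (auto simp: power2_eq_1_iff)
  note Xo = eigen_other_parity[OF XX(1) X(1) XX(2,3) sq, folded Xo_def, simplified]
  note Yo = eigen_other_parity[OF Y(1-4) sq[OF \<mu>], folded Yo_def, simplified]
  have \<kappa>1: "1 < \<bar>\<kappa>\<bar>" using X(3) by simp
  have U_sum: "U t + U' t = \<sigma> *\<^sub>R X t" and U_diff: "U t - U' t = Xo t" for t
    using U(3,4) by (simp_all add: \<sigma>_def Xo_def)
  have V_sum: "V t + V' t = \<tau> *\<^sub>R Y t" and V_diff: "V t - V' t = Yo t" for t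
    using V(3,4) by (simp_all add: \<tau>_def Yo_def)
  define \<delta> \<delta>' where "\<delta> = ln \<bar>\<alpha>\<bar> / P" and "\<delta>' = ln \<bar>\<beta>\<bar> / P"
  have \<delta>: "0 < \<delta>'" "\<delta>' \<le> \<delta>"
    using \<alpha>(1) \<beta>(1) \<beta>\<alpha> P_pos by (auto simp: \<delta>_def \<delta>'_def divide_right_mono)
  have U_mult: "fst (U (t + P)) = \<alpha> * fst (U t)" and V_mult: "fst (V (t + P)) = \<beta> * fst (V t)" for t
    using U(2) V(2) by simp_all
  have cU: "continuous_on UNIV (\<lambda>t. fst (U t))" and cV: "continuous_on UNIV (\<lambda>t. fst (V t))"
    using mode_path_continuous[OF U(1)] mode_path_continuous[OF V(1)] by (auto intro!: continuous_intros)
  have U_pos0: "0 < fst (U t)" if t: "0 \<le> t" for t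
  proof -
    have "fst (X t) \<le> fst (X (t + P))"
      by (rule nonneg_solution_nondecreasing(1)[OF XX(1) X_nonneg t]) (use P_pos in auto)
    moreover have "0 \<le> fst (X t)" using X_nonneg[OF t] by (simp add: nonneg_state_def)
    moreover have "0 < fst (X (t + P))" using X_pos t P_pos by simp
    moreover have "1 < \<alpha>" using \<alpha>(1,4) by simp
    moreover from calculation have "fst (X (t + P)) < \<alpha> * fst (X (t + P))" by simp
    ultimately have "fst (X t) < \<alpha> * fst (X (t + P))" by linarith
    then show ?thesis using \<open>1 < \<alpha>\<close> by (simp add: U_def field_simps)
  qed
  have U_pos: "0 < fst (U t)" for t
  proof -
    have iter: "fst (U (t + real k * P)) = \<alpha> ^ k * fst (U t)" for k
    proof (induction k)
      case (Suc k)
      show ?case using U_mult[of "t + real k * P"] Suc by (simp add: algebra_simps)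
    qed simp
    obtain k :: nat where "\<bar>t\<bar> / P < real k" using reals_Archimedean2 by blast
    then have "0 \<le> t + real k * P" using P_pos by (simp add: field_simps)
    then have "0 < \<alpha> ^ k * fst (U t)" using U_pos0 iter by metis
    then show ?thesis using \<alpha>(4) by (simp add: zero_less_mult_iff)
  qed
  obtain M1 where M1: "\<And>t. \<bar>fst (U t)\<bar> \<le> M1 * exp (\<delta> * t)"
    using multiplier_growth(1)[OF cU P_pos U_mult \<alpha>(1)] by (auto simp: \<delta>_def)
  obtain m where m: "0 < m" "\<And>t. m * exp (\<delta> * t) \<le> \<bar>fst (U t)\<bar>"
    using multiplier_growth(2)[OF cU P_pos U_mult \<alpha>(1)] U_pos less_irrefl unfolding \<delta>_def by metis
  obtain M2 where M2: "\<And>t. \<bar>fst (V t)\<bar> \<le> M2 * exp (\<delta>' * t)"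
    using multiplier_growth(1)[OF cV P_pos V_mult \<beta>(1)] by (auto simp: \<delta>'_def)
  have M2_nonneg: "0 \<le> M2" using order_trans[OF abs_ge_zero M2[of 0]] by simp
  have M1_nonneg: "0 \<le> M1" using order_trans[OF abs_ge_zero M1[of 0]] by simp
  \<comment> \<open>the constant makes \<open>N U \<ge> \<bar>V\<bar> + U\<close> for \<open>t \<ge> 0\<close>\<close>
  define N where "N = 1 + M2 / m"
  have N: "0 < N" using m(1) M2_nonneg by (simp add: N_def add_pos_nonneg)
  define W where "W t = fst (V t) + N * fst (U t)" for t
  have gU: "forward_growing (\<lambda>t. fst (U t))"
    by (rule forward_growingI[of \<delta> \<delta> m _ M1]) (use \<delta> m M1 in auto)
  have gW: "forward_growing W"
  proof (rule forward_growingI[of \<delta> \<delta>' m _ "M2 + N * M1"])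
    fix t :: real assume t: "0 \<le> t"
    have "M2 * exp (\<delta>' * t) \<le> M2 * exp (\<delta> * t)"
      using \<delta> t M2_nonneg by (intro mult_left_mono) (auto intro: mult_right_mono)
    also have "\<dots> = M2 / m * (m * exp (\<delta> * t))" using m(1) by simp
    also have "\<dots> \<le> M2 / m * fst (U t)"
      using m M2_nonneg U_pos[of t] by (intro mult_left_mono) (metis abs_of_pos, simp)
    finally have "- (M2 / m * fst (U t)) \<le> fst (V t)" using M2[of t] by linarith
    then have "fst (U t) \<le> W t" by (simp add: W_def N_def algebra_simps)
    then show "m * exp (\<delta> * t) \<le> \<bar>W t\<bar>" using m(2)[of t] U_pos[of t] by linarith
  next
    fix t :: real assume t: "t \<le> 0"
    have "\<delta> * t \<le> \<delta>' * t" using \<delta> t by (simp add: mult_right_mono_neg)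
    then have "M1 * exp (\<delta> * t) \<le> M1 * exp (\<delta>' * t)" using M1_nonneg by (intro mult_left_mono) auto
    then have "N * \<bar>fst (U t)\<bar> \<le> N * (M1 * exp (\<delta>' * t))"
      using M1[of t] N by (intro mult_left_mono) auto
    moreover have "\<bar>W t\<bar> \<le> \<bar>fst (V t)\<bar> + N * \<bar>fst (U t)\<bar>"
      unfolding W_def using N by (intro order_trans[OF abs_triangle_ineq]) (simp add: abs_mult)
    ultimately show "\<bar>W t\<bar> \<le> (M2 + N * M1) * exp (\<delta>' * t)"
      using M2[of t] by (simp add: distrib_right)
  qed (use \<delta> m in auto)
  define u where "u i = (if i = (0::nat) then (\<lambda>t. fst (U t)) else if i = 1 then (\<lambda>t. fst (U (- t)))
    else if i = 2 then W else (\<lambda>t. W (- t)))" for i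
  define G where "G c t = (c 0 + N * c 2) *\<^sub>R U t + (c 1 + N * c 3) *\<^sub>R U' t + c 2 *\<^sub>R V t + c 3 *\<^sub>R V' t"
    for c :: "nat \<Rightarrow> real" and t
  have G: "solution (G c)" for c
    unfolding G_def by (intro mode_path_add mode_path_scale U(1) V(1) U' V')
  have G_reflect: "flip (G c (- t)) = (c 0 + N * c 2) *\<^sub>R U' t + (c 1 + N * c 3) *\<^sub>R U t + c 2 *\<^sub>R V' t + c 3 *\<^sub>R V t" for c t
    by (simp add: G_def linear_add[OF linear_flip] linear_scale[OF linear_flip] U'_def V'_def)
  have sum_u: "(\<Sum>i<4. c i *\<^sub>R u i t) = fst (G c t)" for c t
    by (simp add: u_def G_def W_def U'_def V'_def eval_nat_numeral algebra_simps)
  have "indexed_basis {..<4} u (mode_functions A B Q)"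
    unfolding indexed_basis_def sum_u
  proof (intro conjI allI impI set_eqI iffI)
    fix f assume "f \<in> mode_functions A B Q"
    then obtain Z where Z: "solution Z" "f = (\<lambda>t. fst (Z t))" by (auto simp: mode_functions_def)
    obtain a b where ab: "(\<lambda>t. Z t + 1 *\<^sub>R flip (Z (- t))) = (\<lambda>t. a *\<^sub>R X t + b *\<^sub>R Y t)"
      by (rule parity_span[OF _ XX(1) X(1) XX(2,3) Y(1-4) _ parity_part[OF Z(1)]]) (use Y(5) in auto)
    obtain c d where cd: "(\<lambda>t. Z t + (- 1) *\<^sub>R flip (Z (- t))) = (\<lambda>t. c *\<^sub>R Xo t + d *\<^sub>R Yo t)"
      by (rule parity_span[OF _ Xo(1) Xo(2) Xo(3) _ Yo(1) Yo(2) Yo(3) _ _ parity_part[OF Z(1)]])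
        (use Xo(4) Yo(4) Y(5) \<kappa>1 in auto)
    define k where "k i = (if i = (0::nat) then (a / \<sigma> + c) / 2 - N * ((b / \<tau> + d) / 2)
      else if i = 1 then (a / \<sigma> - c) / 2 - N * ((b / \<tau> - d) / 2)
      else if i = 2 then (b / \<tau> + d) / 2 else (b / \<tau> - d) / 2)" for i
    have "f t = fst (G k t)" for t
    proof -
      have "2 *\<^sub>R Z t = (Z t + 1 *\<^sub>R flip (Z (- t))) + (Z t + (- 1) *\<^sub>R flip (Z (- t)))"
        by (simp add: scaleR_2)
      also have "\<dots> = (a *\<^sub>R X t + b *\<^sub>R Y t) + (c *\<^sub>R Xo t + d *\<^sub>R Yo t)"
        using ab[THEN fun_cong, of t] cd[THEN fun_cong, of t] by (simp only:)
      also have "\<dots> = (a / \<sigma>) *\<^sub>R (U t + U' t) + (b / \<tau>) *\<^sub>R (V t + V' t) + c *\<^sub>R (U t - U' t) + d *\<^sub>R (V t - V' t)"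
        unfolding U_sum V_sum U_diff V_diff using \<sigma>\<tau> by simp
      also have "\<dots> = (a / \<sigma> + c) *\<^sub>R U t + (a / \<sigma> - c) *\<^sub>R U' t + (b / \<tau> + d) *\<^sub>R V t + (b / \<tau> - d) *\<^sub>R V' t"
        by (simp add: algebra_simps)
      also have "\<dots> = 2 *\<^sub>R G k t"
      proof -
        have half: "2 *\<^sub>R ((x / 2) *\<^sub>R z) = x *\<^sub>R z" for x :: real and z :: "state"
          by simp
        have "G k t = ((a / \<sigma> + c) / 2) *\<^sub>R U t + ((a / \<sigma> - c) / 2) *\<^sub>R U' t
            + ((b / \<tau> + d) / 2) *\<^sub>R V t + ((b / \<tau> - d) / 2) *\<^sub>R V' t"
          by (simp add: G_def k_def)
        then show ?thesis by (simp only: scaleR_add_right half)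
      qed
      finally show ?thesis using Z(2) by simp
    qed
    then show "f \<in> range (\<lambda>c t. fst (G c t))" by (intro range_eqI[where x = k]) auto
  next
    fix f assume "f \<in> range (\<lambda>c t. fst (G c t))"
    then show "f \<in> mode_functions A B Q" using G by (auto simp: mode_functions_def)
  next
    fix c :: "nat \<Rightarrow> real" assume 0: "\<forall>t. fst (G c t) = 0"
    have G0: "G c t = 0" for t using solution_fst_zero[OF G] 0 by blast
    have fG0: "flip (G c (- t)) = 0" for t unfolding G0 by (rule linear_0[OF linear_flip])
    let ?p = "c 0 + N * c 2" and ?q = "c 1 + N * c 3"
    have even: "((?p + ?q) * \<sigma>) *\<^sub>R X t + ((c 2 + c 3) * \<tau>) *\<^sub>R Y t = 0" for t
    proof -
      have "((?p + ?q) * \<sigma>) *\<^sub>R X t + ((c 2 + c 3) * \<tau>) *\<^sub>R Y t = (?p + ?q) *\<^sub>R (U t + U' t) + (c 2 + c 3) *\<^sub>R (V t + V' t)"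
        unfolding U_sum V_sum by simp
      also have "\<dots> = G c t + flip (G c (- t))" unfolding G_reflect by (simp add: G_def algebra_simps)
      finally show ?thesis using G0 fG0 by simp
    qed
    have odd: "(?p - ?q) *\<^sub>R Xo t + (c 2 - c 3) *\<^sub>R Yo t = 0" for t
    proof -
      have "(?p - ?q) *\<^sub>R Xo t + (c 2 - c 3) *\<^sub>R Yo t = (?p - ?q) *\<^sub>R (U t - U' t) + (c 2 - c 3) *\<^sub>R (V t - V' t)"
        unfolding U_diff V_diff by simp
      also have "\<dots> = G c t - flip (G c (- t))" unfolding G_reflect by (simp add: G_def algebra_simps)
      finally show ?thesis using G0 fG0 by simp
    qed
    have ne: "\<kappa> \<noteq> \<mu>" using Y(5) by simp
    have "?p + ?q = 0" "c 2 + c 3 = 0"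
      using eigen_separate[OF XX(2) Y(3) ne even, of 0] XX(3) Y(4) \<sigma>\<tau> by auto
    moreover have "?p - ?q = 0" "c 2 - c 3 = 0"
      using eigen_separate[OF Xo(3) Yo(3) ne odd, of 0] Xo(4) Yo(4) \<kappa>1 by auto
    ultimately have "?p = 0" "?q = 0" "c 2 = 0" "c 3 = 0" by linarith+
    then show "\<forall>i\<in>{..<4}. c i = 0"
      by (auto simp: eval_nat_numeral less_Suc_eq)
  qed auto
  moreover have "forward_growing (u i) \<or> forward_growing (\<lambda>t. u i (- t))" for i
    using gU gW by (simp add: u_def)
  ultimately show ?thesis by blast
qed

end

section \<open>A maximum principle that excludes bounded solutions\<close>

lemma strong_minimum_forward:
  fixes z :: "real \<Rightarrow> real"
  assumes z: "\<And>t. (z has_real_derivative z1 t) (at t)" "\<And>t. (z1 has_real_derivative z2 t) (at t)"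
    and nn: "\<And>t. 0 \<le> z t" and le: "\<And>t. z2 t \<le> b\<^sup>2 * z t" and t0: "z t0 = 0" and t: "t0 \<le> t"
  shows "z t = 0"
proof -
  have "z1 t0 = 0"
    by (rule DERIV_local_min[OF z(1), of 1]) (use nn t0 in auto)
  have dp: "((\<lambda>t. (z1 t + b * z t) * exp (- b * t)) has_real_derivative
      (z2 s - b\<^sup>2 * z s) * exp (- b * s)) (at s)" for s
    by (auto intro!: derivative_eq_intros z simp: algebra_simps power2_eq_square)
  have p: "z1 s + b * z s \<le> 0" if "t0 \<le> s" for s
  proof -
    have "(z1 s + b * z s) * exp (- b * s) \<le> (z1 t0 + b * z t0) * exp (- b * t0)"
    proof (rule DERIV_nonpos_imp_nonincreasing[OF that])
      fix r
      have "(z2 r - b\<^sup>2 * z r) * exp (- b * r) \<le> 0" using le[of r] by (simp add: mult_le_0_iff)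
      then show "\<exists>y. ((\<lambda>t. (z1 t + b * z t) * exp (- b * t)) has_real_derivative y) (at r) \<and> y \<le> 0"
        using dp by blast
    qed
    then show ?thesis using \<open>z1 t0 = 0\<close> t0 by (simp add: mult_le_0_iff)
  qed
  have "z t * exp (b * t) \<le> z t0 * exp (b * t0)"
  proof (rule DERIV_nonpos_imp_nonincreasing[OF t])
    fix s assume s: "t0 \<le> s" "s \<le> t"
    have "((\<lambda>t. z t * exp (b * t)) has_real_derivative (z1 s + b * z s) * exp (b * s)) (at s)"
      by (auto intro!: derivative_eq_intros z simp: algebra_simps)
    moreover have "(z1 s + b * z s) * exp (b * s) \<le> 0" using p[OF s(1)] by (simp add: mult_le_0_iff)
    ultimately show "\<exists>y. ((\<lambda>t. z t * exp (b * t)) has_real_derivative y) (at s) \<and> y \<le> 0" by blast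
  qed
  then show ?thesis using nn[of t] t0 by (simp add: mult_le_0_iff)
qed

lemma has_real_derivative_reflect:
  assumes "(f has_real_derivative f') (at (- t))"
  shows "((\<lambda>s. f (- s)) has_real_derivative - f') (at t)"
  using has_vector_derivative_reflect[of f f' t] assms
  by (simp add: has_real_derivative_iff_has_vector_derivative)

text \<open>A supersolution of \<open>z'' = B z\<close> that touches zero from above vanishes.  Forward in time,
  \<open>z'' - b\<^sup>2 z = (d/dt - b) (z' + b z)\<close> reduces this to two monotonicity statements of first order.\<close>
lemma strong_minimum:
  fixes z :: "real \<Rightarrow> real"
  assumes z: "\<And>t. (z has_real_derivative z1 t) (at t)" "\<And>t. (z1 has_real_derivative z2 t) (at t)"
    and nn: "\<And>t. 0 \<le> z t" and B: "0 \<le> B" and le: "\<And>t. z2 t \<le> B * z t" and t0: "z t0 = 0"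
  shows "z t = 0"
proof (cases "t0 \<le> t")
  case True
  then show ?thesis using strong_minimum_forward[OF z nn _ t0, of "sqrt B"] le B by simp
next
  case False
  have "((\<lambda>s. - z1 (- s)) has_real_derivative z2 (- s)) (at s)" for s
    using DERIV_minus[OF has_real_derivative_reflect[OF z(2)]] by simp
  from strong_minimum_forward[OF has_real_derivative_reflect[OF z(1)] this, of "sqrt B" "- t0" "- t"]
  show ?thesis using nn le B t0 False by simp
qed

lemma vanishing_attains_max:
  fixes F :: "real \<Rightarrow> real"
  assumes cont: "continuous_on UNIV F" and F: "\<And>t. F t \<le> C * exp (- \<bar>t\<bar>)" and pos: "0 < F t1"
  obtains t0 where "\<And>t. F t \<le> F t0"
proof -
  have C: "0 < C" using order_less_le_trans[OF pos F[of t1]] by (simp add: zero_less_mult_iff)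
  \<comment> \<open>beyond \<open>R\<close> the bound on \<open>F\<close> drops below \<open>F t1\<close>\<close>
  define R where "R = max \<bar>t1\<bar> (ln (C / F t1))"
  have R: "\<bar>t1\<bar> \<le> R" by (simp add: R_def)
  have "\<exists>x\<in>{- R..R}. \<forall>y\<in>{- R..R}. F y \<le> F x"
    by (rule continuous_attains_sup) (use continuous_on_subset[OF cont subset_UNIV] R in auto)
  then obtain t0 where t0: "\<And>t. t \<in> {- R..R} \<Longrightarrow> F t \<le> F t0" by blast
  have "F t \<le> F t0" for t
  proof (cases "t \<in> {- R..R}")
    case False
    then have "ln (C / F t1) \<le> \<bar>t\<bar>" by (auto simp: R_def)
    then have "C / F t1 \<le> exp \<bar>t\<bar>" using C pos by (metis divide_pos_pos exp_le_cancel_iff exp_ln)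
    then have "C * exp (- \<bar>t\<bar>) \<le> F t1" using pos by (simp add: exp_minus field_simps)
    also have "F t1 \<le> F t0" by (rule t0) (use R in auto)
    finally show ?thesis using F[of t] by linarith
  qed (rule t0)
  then show ?thesis by (rule that)
qed

text \<open>Let \<open>M\<close> be the least constant with \<open>\<bar>f\<bar> \<le> M h\<close> and \<open>\<bar>g\<bar> \<le> M k\<close>.  As \<open>h\<close> and \<open>k\<close> tend to infinity and
  \<open>f\<close>, \<open>g\<close> are bounded, one of these estimates is an equality at some point.  Then \<open>M h \<plusminus> f\<close> or
  \<open>M k \<plusminus> g\<close> touches zero from above, and cooperativity makes it a supersolution of \<open>z'' = B z\<close> or
  \<open>z'' = A z\<close>.  By the strong minimum principle it vanishes identically, which is impossible for
  \<open>M > 0\<close> because \<open>h\<close> and \<open>k\<close> are unbounded.  The function \<open>k\<close> bounds the negated companion: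
  \<open>k = B' h - h''\<close>.\<close>
theorem supersolution_excludes_bounded:
  assumes h: "\<And>t. (h has_real_derivative h1 t) (at t)" "\<And>t. (h1 has_real_derivative B' * h t - k t) (at t)"
    and k: "\<And>t. (k has_real_derivative k1 t) (at t)" "\<And>t. (k1 has_real_derivative A' * k t - R t * h t) (at t)"
    and m: "0 < m" "\<And>t. m * exp \<bar>t\<bar> \<le> h t" "\<And>t. m * exp \<bar>t\<bar> \<le> k t"
    and AB: "A' \<le> A" "B' \<le> B" "0 \<le> A" "0 \<le> B" and Q: "\<And>t. 0 \<le> Q t" "\<And>t. Q t \<le> R t"
    and X: "mode_path A B Q X" "bounded (range X)"
  shows "X t = 0"
proof -
  define f f1 g g1 where "f t = fst (X t)" and "f1 t = slope (X t)"
    and "g t = companion (X t)" and "g1 t = companion_slope (X t)" for t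
  have d: "(f has_real_derivative f1 t) (at t)" "(f1 has_real_derivative B * f t + g t) (at t)"
    "(g has_real_derivative g1 t) (at t)" "(g1 has_real_derivative A * g t + Q t * f t) (at t)" for t
    using X(1) mode_path_coords[of A B Q f f1 g g1] by (simp_all add: f_def f1_def g_def g1_def)
  obtain C where C: "\<And>t. norm (X t) \<le> C" using X(2) by (auto simp: bounded_iff)
  have fC: "\<bar>f t\<bar> \<le> C" and gC: "\<bar>g t\<bar> \<le> C" for t
  proof -
    have "X t = (f t, f1 t, g t, g1 t)" by (simp add: f_def f1_def g_def g1_def)
    then have "norm (f t, f1 t, g t, g1 t) \<le> C" using C[of t] by simp
    then show "\<bar>f t\<bar> \<le> C" "\<bar>g t\<bar> \<le> C"
      using coord_le_norm(1,3)[where p = "f t" and q = "f1 t" and r = "g t" and s = "g1 t"] by linarith+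
  qed
  have C0: "0 \<le> C" using fC[of 0] by linarith
  have pos: "0 < h t" "0 < k t" for t
  proof -
    have e: "0 < m * exp \<bar>t\<bar>" using m(1) by simp
    show "0 < h t" "0 < k t" by (rule less_le_trans[OF e m(2)], rule less_le_trans[OF e m(3)])
  qed
  have unbdd: "\<exists>t. D < w t" if "\<And>t. m * exp \<bar>t\<bar> \<le> w t" for w and D :: real
  proof -
    have "\<bar>D\<bar> / m < exp (\<bar>D\<bar> / m)" using exp_ge_add_one_self[of "\<bar>D\<bar> / m"] by linarith
    then have "\<bar>D\<bar> < m * exp \<bar>\<bar>D\<bar> / m\<bar>"
      using m(1) by (simp add: pos_divide_less_eq mult.commute)
    also have "\<dots> \<le> w (\<bar>D\<bar> / m)" by (rule that)
    finally show ?thesis by (intro exI[of _ "\<bar>D\<bar> / m"]) linarith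
  qed
  define F where "F t = max (\<bar>f t\<bar> / h t) (\<bar>g t\<bar> / k t)" for t
  have F0: "F t1 \<le> 0" for t1
  proof (rule ccontr)
    assume "\<not> F t1 \<le> 0"
    then have F1: "0 < F t1" by simp
    have "continuous_on UNIV f" "continuous_on UNIV g" "continuous_on UNIV h" "continuous_on UNIV k"
      using DERIV_isCont[OF d(1)] DERIV_isCont[OF d(3)] DERIV_isCont[OF h(1)] DERIV_isCont[OF k(1)]
      by (auto intro: continuous_at_imp_continuous_on)
    moreover have "h t \<noteq> 0" "k t \<noteq> 0" for t using pos[of t] by auto
    ultimately have cont: "continuous_on UNIV F"
      unfolding F_def by (intro continuous_intros) auto
    have small: "\<bar>w\<bar> / y \<le> C / m * exp (- \<bar>t\<bar>)" if "\<bar>w\<bar> \<le> C" "m * exp \<bar>t\<bar> \<le> y" for w y t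
    proof -
      have "\<bar>w\<bar> / y \<le> C / (m * exp \<bar>t\<bar>)" using that m(1) C0 by (intro frac_le) auto
      then show ?thesis by (simp add: exp_minus field_simps)
    qed
    have "F t \<le> C / m * exp (- \<bar>t\<bar>)" for t
      unfolding F_def using small[OF fC m(2)] small[OF gC m(3)] by simp
    then obtain t0 where t0: "\<And>t. F t \<le> F t0" by (rule vanishing_attains_max[OF cont _ F1]) auto
    define M where "M = F t0"
    have M: "0 < M" using F1 t0[of t1] by (simp add: M_def)
    have fM: "\<bar>f t\<bar> \<le> M * h t" and gM: "\<bar>g t\<bar> \<le> M * k t" for t
      using t0[of t] pos[of t] by (auto simp: M_def F_def divide_le_eq)
    have touch_f: False if s: "s = 1 \<or> s = -1" and touch: "s * f t0 = M * h t0" for s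
    proof -
      have sf: "s * f t \<le> M * h t" and sg: "- (s * g t) \<le> M * k t" for t
        using fM[of t] gM[of t] s by auto
      have "M * h t - s * f t = 0" for t
      proof (rule strong_minimum[where z = "\<lambda>t. M * h t - s * f t" and ?z1.0 = "\<lambda>t. M * h1 t - s * f1 t"
          and ?z2.0 = "\<lambda>t. M * (B' * h t - k t) - s * (B * f t + g t)" and B = B and ?t0.0 = t0])
        show "((\<lambda>t. M * h t - s * f t) has_real_derivative M * h1 t - s * f1 t) (at t)" for t
          by (auto intro!: derivative_eq_intros h d)
        show "((\<lambda>t. M * h1 t - s * f1 t) has_real_derivative M * (B' * h t - k t) - s * (B * f t + g t)) (at t)" for t
          by (auto intro!: derivative_eq_intros h d)
        show "M * (B' * h t - k t) - s * (B * f t + g t) \<le> B * (M * h t - s * f t)" for t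
        proof -
          have "0 \<le> (B - B') * (M * h t)" using AB M pos[of t] by simp
          then show ?thesis using sg[of t] by (simp add: algebra_simps)
        qed
      qed (use sf touch AB in auto)
      then have "M * h t \<le> C" for t using fC[of t] s by (auto simp: abs_le_iff)
      moreover obtain t where "C / M < h t" using unbdd[OF m(2)] by blast
      then have "C < M * h t" using M by (simp add: field_simps)
      ultimately show False by (meson not_le)
    qed
    have touch_g: False if s: "s = 1 \<or> s = -1" and touch: "- (s * g t0) = M * k t0" for s
    proof -
      have sf: "s * f t \<le> M * h t" and sg: "- (s * g t) \<le> M * k t" for t
        using fM[of t] gM[of t] s by auto
      have "M * k t + s * g t = 0" for t
      proof (rule strong_minimum[where z = "\<lambda>t. M * k t + s * g t" and ?z1.0 = "\<lambda>t. M * k1 t + s * g1 t"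
          and ?z2.0 = "\<lambda>t. M * (A' * k t - R t * h t) + s * (A * g t + Q t * f t)" and B = A and ?t0.0 = t0])
        show "((\<lambda>t. M * k t + s * g t) has_real_derivative M * k1 t + s * g1 t) (at t)" for t
          by (auto intro!: derivative_eq_intros k d)
        show "((\<lambda>t. M * k1 t + s * g1 t) has_real_derivative M * (A' * k t - R t * h t) + s * (A * g t + Q t * f t)) (at t)" for t
          by (auto intro!: derivative_eq_intros k d)
        show "M * (A' * k t - R t * h t) + s * (A * g t + Q t * f t) \<le> A * (M * k t + s * g t)" for t
        proof -
          have "0 \<le> (A - A') * (M * k t)" using AB M pos[of t] by simp
          moreover have "Q t * (s * f t) \<le> R t * (M * h t)"
            using order_trans[OF mult_left_mono[OF sf[of t] Q(1)[of t]] mult_right_mono[OF Q(2)[of t]]] M pos[of t] by simp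
          ultimately show ?thesis by (simp add: algebra_simps)
        qed
        show "0 \<le> M * k t + s * g t" for t using sg[of t] by linarith
      qed (use touch AB in linarith)+
      then have "M * k t = - (s * g t)" for t by (metis add_eq_0_iff2)
      then have "M * k t \<le> C" for t using gC[of t] s by (auto simp: abs_le_iff)
      moreover obtain t where "C / M < k t" using unbdd[OF m(3)] by blast
      then have "C < M * k t" using M by (simp add: field_simps)
      ultimately show False by (meson not_le)
    qed
    have "\<bar>f t0\<bar> / h t0 = M \<or> \<bar>g t0\<bar> / k t0 = M" by (auto simp: M_def F_def max_def)
    then have "\<bar>f t0\<bar> = M * h t0 \<or> \<bar>g t0\<bar> = M * k t0" using pos[of t0] by (auto simp: field_simps)
    then show False
      using touch_f[of 1] touch_f[of "-1"] touch_g[of 1] touch_g[of "-1"] by (auto simp: abs_if split: if_splits)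
  qed
  have fg: "f t = 0 \<and> g t = 0" for t
  proof -
    have "\<bar>f t\<bar> / h t \<le> 0" "\<bar>g t\<bar> / k t \<le> 0" using F0[of t] by (simp_all add: F_def)
    then show ?thesis using pos[of t] by (simp add: divide_le_0_iff)
  qed
  then have "f = (\<lambda>_. 0)" "g = (\<lambda>_. 0)" by auto
  then have "f1 t = 0" "g1 t = 0" using DERIV_unique[OF d(1)[of t], of 0] DERIV_unique[OF d(3)[of t], of 0] by simp_all
  then show ?thesis using fg[of t] by (simp add: prod_eq_iff f_def f1_def g_def g1_def)
qed

section \<open>The equation linearized at a periodic profile\<close>

lemma four_times_differentiable_iff:
  "four_times_differentiable f \<longleftrightarrow>
     (\<forall>k<4. \<forall>t. ((deriv ^^ k) f has_real_derivative (deriv ^^ Suc k) f t) (at t))"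
  by (simp add: four_times_differentiable_def DERIV_deriv_iff_field_differentiable)

lemma derivative_chain:
  assumes "\<And>t. (f has_real_derivative f1 t) (at t)" "\<And>t. (f1 has_real_derivative f2 t) (at t)"
    "\<And>t. (f2 has_real_derivative f3 t) (at t)" "\<And>t. (f3 has_real_derivative f4 t) (at t)"
  shows "four_times_differentiable f" "(deriv ^^ 2) f = f2" "(deriv ^^ 4) f = f4"
proof -
  have step: "(deriv ^^ Suc k) f = g'"
    if "(deriv ^^ k) f = g" "\<And>t. (g has_real_derivative g' t) (at t)" for k g g'
    using that by (auto intro!: ext DERIV_imp_deriv)
  have 0: "(deriv ^^ 0) f = f" by simp
  note 1 = step[OF 0 assms(1)]
  note 2 = step[OF 1 assms(2)]
  note 3 = step[OF 2 assms(3)]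
  note 4 = step[OF 3 assms(4)]
  show "(deriv ^^ 2) f = f2" "(deriv ^^ 4) f = f4"
    using 2 4 by (simp_all add: eval_nat_numeral)
  have "k = 0 \<or> k = Suc 0 \<or> k = Suc (Suc 0) \<or> k = Suc (Suc (Suc 0))" if "k < 4" for k :: nat
    using that by auto
  then show "four_times_differentiable f"
    unfolding four_times_differentiable_iff using 0 1 2 3 4 assms by metis
qed

lemma mode_functions_iff:
  "f \<in> mode_functions A B Q \<longleftrightarrow> four_times_differentiable f \<and>
     (\<forall>t. (deriv ^^ 4) f t - (A + B) * (deriv ^^ 2) f t + A * B * f t = Q t * f t)"
proof
  assume "f \<in> mode_functions A B Q"
  then obtain X where X: "mode_path A B Q X" "f = (\<lambda>t. fst (X t))" by (auto simp: mode_functions_def)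
  define f1 g g1 where "f1 t = slope (X t)"
    and "g t = companion (X t)" and "g1 t = companion_slope (X t)" for t
  have d: "(f has_real_derivative f1 t) (at t)" "(f1 has_real_derivative B * f t + g t) (at t)"
    "(g has_real_derivative g1 t) (at t)" "(g1 has_real_derivative A * g t + Q t * f t) (at t)" for t
    using X mode_path_coords[of A B Q f f1 g g1] by (simp_all add: f1_def g_def g1_def)
  have d2: "((\<lambda>t. B * f t + g t) has_real_derivative B * f1 t + g1 t) (at t)" for t
    by (auto intro!: derivative_eq_intros d)
  have d3: "((\<lambda>t. B * f1 t + g1 t) has_real_derivative B * (B * f t + g t) + (A * g t + Q t * f t)) (at t)" for t
    by (auto intro!: derivative_eq_intros d)
  note c = derivative_chain[OF d(1,2) d2 d3]
  show "four_times_differentiable f \<and>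
     (\<forall>t. (deriv ^^ 4) f t - (A + B) * (deriv ^^ 2) f t + A * B * f t = Q t * f t)"
    unfolding c(2,3) using c(1) by (simp add: algebra_simps)
next
  assume f: "four_times_differentiable f \<and>
     (\<forall>t. (deriv ^^ 4) f t - (A + B) * (deriv ^^ 2) f t + A * B * f t = Q t * f t)"
  have "((deriv ^^ k) f has_real_derivative (deriv ^^ Suc k) f t) (at t)" if "k < 4" for k t
    using f that by (auto simp: four_times_differentiable_iff)
  from this[of 0] this[of 1] this[of 2] this[of 3]
  have d: "(f has_real_derivative deriv f t) (at t)" "(deriv f has_real_derivative (deriv ^^ 2) f t) (at t)"
    "((deriv ^^ 2) f has_real_derivative (deriv ^^ 3) f t) (at t)"
    "((deriv ^^ 3) f has_real_derivative (deriv ^^ 4) f t) (at t)" for t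
    by (simp_all add: eval_nat_numeral)
  have "(deriv f has_real_derivative B * f t + ((deriv ^^ 2) f t - B * f t)) (at t)"
    "((\<lambda>t. (deriv ^^ 2) f t - B * f t) has_real_derivative (deriv ^^ 3) f t - B * deriv f t) (at t)"
    "((\<lambda>t. (deriv ^^ 3) f t - B * deriv f t) has_real_derivative
        A * ((deriv ^^ 2) f t - B * f t) + Q t * f t) (at t)" for t
  proof -
    have "(deriv ^^ 4) f t = (A + B) * (deriv ^^ 2) f t - A * B * f t + Q t * f t" using f by (simp add: algebra_simps)
    then show "((\<lambda>t. (deriv ^^ 3) f t - B * deriv f t) has_real_derivative
        A * ((deriv ^^ 2) f t - B * f t) + Q t * f t) (at t)"
      by (auto intro!: derivative_eq_intros d simp: algebra_simps)
  qed (use d in \<open>auto intro!: derivative_eq_intros\<close>)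
  then have "mode_path A B Q (\<lambda>t. (f t, deriv f t, (deriv ^^ 2) f t - B * f t, (deriv ^^ 3) f t - B * deriv f t))"
    unfolding mode_path_coords using d by blast
  then show "f \<in> mode_functions A B Q" unfolding mode_functions_def by force
qed

lemma derivative_periodic:
  assumes f: "\<And>t. (f has_real_derivative f' t) (at t)" and per: "\<And>t. f (t + P) = f t"
  shows "f' (t + P) = f' t"
proof -
  have "(f has_real_derivative f' (t + P)) (at t)"
    using DERIV_shift[of f "f' (t + P)" t P] f by (simp add: per)
  then show ?thesis by (rule DERIV_unique[OF _ f])
qed

text \<open>A periodic function attains its minimum, and there its derivative vanishes.\<close>
lemma positive_if_positive_at_critical:
  fixes w :: "real \<Rightarrow> real"
  assumes w: "\<And>t. (w has_real_derivative w' t) (at t)" and per: "\<And>t. w (t + P) = w t" and P: "0 < P"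
    and crit: "\<And>t. w' t = 0 \<Longrightarrow> 0 < w t"
  obtains m where "0 < m" "\<And>t. m \<le> w t"
proof -
  have cont: "continuous_on UNIV w"
    using DERIV_isCont[OF w] by (simp add: continuous_at_imp_continuous_on)
  obtain s where s: "\<And>t. w s \<le> w t" using periodic_attains_min[of w P, OF cont per P] by blast
  have "w' s = 0" by (rule DERIV_local_min[OF w, of 1]) (use s in auto)
  then show ?thesis using crit s that by blast
qed

locale periodic_profile =
  fixes n :: nat and v v1 v2 v3 :: "real \<Rightarrow> real" and P :: real
  assumes n: "5 \<le> n" and P: "0 < P" and v_pos: "\<And>t. 0 < v t" and v_per: "\<And>t. v (t + P) = v t"
    and dv: "\<And>t. (v has_real_derivative v1 t) (at t)" "\<And>t. (v1 has_real_derivative v2 t) (at t)"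
      "\<And>t. (v2 has_real_derivative v3 t) (at t)"
      "\<And>t. (v3 has_real_derivative K2 n * v2 t - K0 n * v t + c_const n * v t powr (crit_exp n - 1)) (at t)"
    and v1_0: "v1 0 = 0" and v3_0: "v3 0 = 0"
begin

text \<open>The linear part of the profile equation is \<open>(d\<^sup>2/dt\<^sup>2 - \<gamma>\<^sup>2) (d\<^sup>2/dt\<^sup>2 - \<alpha>\<^sup>2)\<close>.\<close>
definition "\<gamma> = (real n - 4) / 2"
definition "\<alpha> = real n / 2"
definition "q = crit_exp n - 1"
definition "nonlin t = c_const n * v t powr q"
definition "potential \<theta> t = \<theta> * c_const n * v t powr (q - 1)"

lemma constants: "0 < \<gamma>" "\<alpha> = \<gamma> + 2" "1 < q" "q * \<gamma> = \<alpha> + 2" "K2 n = \<gamma>\<^sup>2 + \<alpha>\<^sup>2" "K0 n = \<gamma>\<^sup>2 * \<alpha>\<^sup>2"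
  "0 < c_const n" "crit_exp n - 2 = q - 1"
proof -
  have n': "5 \<le> real n" using n by simp
  show "0 < \<gamma>" "\<alpha> = \<gamma> + 2" using n' by (auto simp: \<gamma>_def \<alpha>_def field_simps)
  show "1 < q" using n' by (simp add: q_def crit_exp_def field_simps)
  show "q * \<gamma> = \<alpha> + 2" using n' by (simp add: q_def crit_exp_def \<gamma>_def \<alpha>_def field_simps)
  show "K2 n = \<gamma>\<^sup>2 + \<alpha>\<^sup>2" by (simp add: K2_def \<gamma>_def \<alpha>_def power2_eq_square field_simps)
  show "K0 n = \<gamma>\<^sup>2 * \<alpha>\<^sup>2" by (simp add: K0_def \<gamma>_def \<alpha>_def power2_eq_square field_simps)
  have "4 < (real n)\<^sup>2" using power_strict_mono[of 2 "real n" 2] n' by simp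
  then show "0 < c_const n" using n' by (simp add: c_const_def)
  show "crit_exp n - 2 = q - 1" by (simp add: q_def)
qed

lemma dv3: "(v3 has_real_derivative (\<gamma>\<^sup>2 + \<alpha>\<^sup>2) * v2 t - \<gamma>\<^sup>2 * \<alpha>\<^sup>2 * v t + nonlin t) (at t)"
  using dv(4)[of t] by (simp add: constants(5,6) nonlin_def q_def)

lemma nonlin_pos: "0 < nonlin t"
  using v_pos[of t] constants(7) by (simp add: nonlin_def)

lemma potential_pos: "0 < \<theta> \<Longrightarrow> 0 < potential \<theta> t"
  using v_pos[of t] constants(7) by (simp add: potential_def)

lemma nonlin_eq: "nonlin t = potential 1 t * v t"
  using v_pos[of t] powr_mult_base[of "v t" "q - 1"] by (simp add: nonlin_def potential_def mult_ac)

lemma nonlin_deriv: "(nonlin has_real_derivative potential q t * v1 t) (at t)"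
proof -
  have "((\<lambda>t. c_const n * v t powr q) has_real_derivative c_const n * (q * v t powr (q - 1) * v1 t)) (at t)"
    by (intro DERIV_cmult has_real_derivative_powr'[THEN DERIV_chain2, simplified] ) 
      (use DERIV_fun_powr[OF dv(1) v_pos] in auto)
  then show ?thesis unfolding nonlin_def[abs_def] by (simp add: potential_def mult_ac)
qed

lemma periodic: "v1 (t + P) = v1 t" "v2 (t + P) = v2 t" "v3 (t + P) = v3 t" "nonlin (t + P) = nonlin t"
  "potential \<theta> (t + P) = potential \<theta> t"
proof -
  show 1: "v1 (t + P) = v1 t" for t by (rule derivative_periodic[OF dv(1) v_per])
  show 2: "v2 (t + P) = v2 t" for t by (rule derivative_periodic[OF dv(2) 1])
  show "v3 (t + P) = v3 t" by (rule derivative_periodic[OF dv(3) 2])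
qed (simp_all add: nonlin_def potential_def v_per)

lemma v_cont: "continuous_on UNIV v" "continuous_on UNIV v1" "continuous_on UNIV v2" "continuous_on UNIV v3"
  using DERIV_isCont[OF dv(1)] DERIV_isCont[OF dv(2)] DERIV_isCont[OF dv(3)] DERIV_isCont[OF dv(4)]
  by (auto intro: continuous_at_imp_continuous_on)

lemma powr_cont: "continuous_on UNIV (\<lambda>t. v t powr r)"
  by (intro continuous_intros v_cont) (use v_pos less_irrefl in metis)

text \<open>The profile and its reflection satisfy the same equation and have the same state at \<open>0\<close>, as the odd
  derivatives vanish there.  On the range of \<open>v\<close> the nonlinearity is Lipschitz continuous.\<close>
lemma profile_even: "v (- t) = v t"
proof -
  obtain M where M: "\<And>t. \<bar>v t\<bar> \<le> M" using periodic_bounded[OF v_cont(1) v_per P] by (auto simp: bounded_iff)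
  define L where "L = c_const n * (q * M powr (q - 1))"
  have lip: "\<bar>nonlin t - nonlin s\<bar> \<le> L * \<bar>v t - v s\<bar>" for t s
  proof -
    have "norm (v t powr q - v s powr q) \<le> q * M powr (q - 1) * norm (v t - v s)"
    proof (rule field_differentiable_bound[of "{0<..M}" "\<lambda>x. x powr q" "\<lambda>x. q * x powr (q - 1)"])
      show "((\<lambda>x. x powr q) has_real_derivative q * z powr (q - 1)) (at z within {0<..M})" if "z \<in> {0<..M}" for z
        using has_real_derivative_powr[of z q] that by (auto intro: has_field_derivative_at_within)
      show "norm (q * z powr (q - 1)) \<le> q * M powr (q - 1)" if "z \<in> {0<..M}" for z
        using that constants(3) by (simp add: abs_mult powr_mono2)
    qed (use v_pos M abs_le_D1 in auto)
    then have "c_const n * \<bar>v t powr q - v s powr q\<bar> \<le> c_const n * (q * M powr (q - 1) * \<bar>v t - v s\<bar>)"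
      using constants(7) by (intro mult_left_mono) auto
    moreover have "\<bar>nonlin t - nonlin s\<bar> = c_const n * \<bar>v t powr q - v s powr q\<bar>"
      using constants(7) by (simp add: nonlin_def abs_mult flip: right_diff_distrib)
    ultimately show ?thesis by (simp add: L_def mult_ac)
  qed
  let ?X = "\<lambda>t. (v t - v (- t), v1 t + v1 (- t), v2 t - v2 (- t), v3 t + v3 (- t))"
  let ?X' = "\<lambda>t. (v1 t + v1 (- t), v2 t - v2 (- t), v3 t + v3 (- t),
      (\<gamma>\<^sup>2 + \<alpha>\<^sup>2) * (v2 t - v2 (- t)) - \<gamma>\<^sup>2 * \<alpha>\<^sup>2 * (v t - v (- t)) + (nonlin t - nonlin (- t)))"
  have "?X t = 0"
  proof (rule linear_ode_unique[where X = ?X and X' = ?X' and K = "3 + (\<gamma>\<^sup>2 + \<alpha>\<^sup>2) + \<gamma>\<^sup>2 * \<alpha>\<^sup>2 + L"])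
    fix t
    note r = has_real_derivative_reflect
    have "((\<lambda>t. v t - v (- t)) has_real_derivative v1 t + v1 (- t)) (at t)"
      using DERIV_diff[OF dv(1) r[OF dv(1)]] by simp
    moreover have "((\<lambda>t. v1 t + v1 (- t)) has_real_derivative v2 t - v2 (- t)) (at t)"
      using DERIV_add[OF dv(2) r[OF dv(2)]] by simp
    moreover have "((\<lambda>t. v2 t - v2 (- t)) has_real_derivative v3 t + v3 (- t)) (at t)"
      using DERIV_diff[OF dv(3) r[OF dv(3)]] by simp
    moreover have "((\<lambda>t. v3 t + v3 (- t)) has_real_derivative
      (\<gamma>\<^sup>2 + \<alpha>\<^sup>2) * (v2 t - v2 (- t)) - \<gamma>\<^sup>2 * \<alpha>\<^sup>2 * (v t - v (- t)) + (nonlin t - nonlin (- t))) (at t)"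
      using DERIV_add[OF dv3 r[OF dv3], of t] by (simp add: algebra_simps)
    ultimately show "(?X has_vector_derivative ?X' t) (at t)"
      by (auto simp: has_real_derivative_iff_has_vector_derivative intro!: has_vector_derivative_Pair)
    let ?N = "norm (?X t)"
    let ?a = "\<gamma>\<^sup>2 + \<alpha>\<^sup>2" and ?b = "\<gamma>\<^sup>2 * \<alpha>\<^sup>2"
    have c: "\<bar>v t - v (- t)\<bar> \<le> ?N" "\<bar>v1 t + v1 (- t)\<bar> \<le> ?N" "\<bar>v2 t - v2 (- t)\<bar> \<le> ?N" "\<bar>v3 t + v3 (- t)\<bar> \<le> ?N"
      by (rule coord_le_norm)+
    have L: "\<bar>nonlin t - nonlin (- t)\<bar> \<le> L * ?N"
    proof (rule order_trans[OF lip mult_left_mono[OF c(1)]])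
      show "0 \<le> L" using constants(3,7) by (simp add: L_def)
    qed
    have 1: "\<bar>?a * (v2 t - v2 (- t))\<bar> \<le> ?a * ?N"
      unfolding abs_mult using c(3) by (intro mult_mono) auto
    have 2: "\<bar>?b * (v t - v (- t))\<bar> \<le> ?b * ?N"
      unfolding abs_mult using c(1) by (intro mult_mono) auto
    have tri: "\<bar>x - y + z\<bar> \<le> \<bar>x\<bar> + \<bar>y\<bar> + \<bar>z\<bar>" for x y z :: real by linarith
    have "norm (?X' t) \<le> ?N + ?N + ?N + (?a * ?N + ?b * ?N + L * ?N)"
      by (rule order_trans[OF norm_quad_le add_mono[OF add_mono[OF add_mono[OF c(2) c(3)] c(4)]
              order_trans[OF tri add_mono[OF add_mono[OF 1 2] L]]]])
    then show "norm (?X' t) \<le> (3 + ?a + ?b + L) * ?N" by (simp add: algebra_simps)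
  qed (simp_all add: v1_0 v3_0 zero_prod_def)
  then show ?thesis by (simp add: zero_prod_def)
qed

text \<open>On the mode \<open>l\<close>, harmonic functions have the exponents \<open>\<plusminus> s / 2\<close> with \<open>s\<^sup>2 = (n - 2)\<^sup>2 + 4 l\<close>, up to the
  conformal shift.  Biharmonic functions arise from them by a factor \<open>\<bar>x\<bar>\<^sup>2\<close>, which moves the
  exponents to \<open>\<plusminus> s / 2 \<plusminus> 1\<close>.  Their squares are the roots of the characteristic polynomial.\<close>
definition "discriminant_root l = sqrt ((real n - 2)\<^sup>2 + 4 * l)"
definition "upper_root l = (discriminant_root l / 2 + 1)\<^sup>2"
definition "lower_root l = (discriminant_root l / 2 - 1)\<^sup>2"

lemma factorization:
  assumes "0 \<le> l"
  shows "upper_root l + lower_root l = K2 n + 2 * l" "upper_root l * lower_root l = K0 n + l * (l + J0 n)" "0 < upper_root l" "0 < lower_root l"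
proof -
  define s where "s = discriminant_root l"
  have s2: "s * s = (real n - 2)\<^sup>2 + 4 * l" using assms by (simp add: s_def discriminant_root_def)
  have "3 \<le> s" unfolding s_def discriminant_root_def
    by (rule real_le_rsqrt) (use n assms power_mono[of 3 "real n - 2" 2] in simp)
  then show "0 < upper_root l" "0 < lower_root l" by (simp_all add: upper_root_def lower_root_def s_def[symmetric])
  have "upper_root l + lower_root l = s * s / 2 + 2"
    by (simp add: upper_root_def lower_root_def s_def[symmetric] power2_eq_square field_simps)
  then show "upper_root l + lower_root l = K2 n + 2 * l" unfolding s2 by (simp add: K2_def power2_eq_square field_simps)
  have "upper_root l * lower_root l = (s * s / 4 - 1)\<^sup>2"
    by (simp add: upper_root_def lower_root_def s_def[symmetric] power2_eq_square field_simps)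
  then show "upper_root l * lower_root l = K0 n + l * (l + J0 n)"
    unfolding s2 by (simp add: K0_def J0_def power2_eq_square field_simps)
qed

lemma mode_equation_instance:
  assumes "0 \<le> l" "0 < \<theta>"
  shows "mode_equation (upper_root l) (lower_root l) P (potential \<theta>)"
proof
  show "continuous_on UNIV (potential \<theta>)"
    unfolding potential_def[abs_def] by (intro continuous_intros powr_cont)
  show "potential \<theta> (- t) = potential \<theta> t" for t by (simp add: potential_def profile_even)
  show "potential \<theta> (t + P) = potential \<theta> t" for t by (rule periodic)
qed (use factorization assms P potential_pos in auto)

text \<open>The supersolution is \<open>h = e\<^sup>t \<sigma> + e\<^sup>-\<^sup>t \<sigma>'\<close> with \<open>\<sigma> = v' + \<gamma> v\<close> and \<open>\<sigma>' = \<gamma> v - v'\<close>, which solves the equation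
  for \<open>l = n - 1\<close> and \<open>\<theta> = q\<close>, where the roots are \<open>(1 + \<alpha>)\<^sup>2\<close> and \<open>(1 + \<gamma>)\<^sup>2\<close>.  Both roots increase with \<open>l\<close>.
  Positivity comes from splitting the profile equation into first-order factors: with
  \<open>x0 = \<gamma>\<^sup>2 v - v''\<close>, each of \<open>x0' + \<alpha> x0\<close>, \<open>\<alpha> x0 - x0'\<close>, \<open>\<sigma>\<close> and \<open>\<sigma>'\<close> is periodic and satisfies a
  first-order equation with a positive source, hence is positive at its minimum.\<close>
lemma no_bounded_solution:
  assumes l: "real n - 1 \<le> l" and \<theta>: "0 < \<theta>" "\<theta> \<le> q"
    and X: "mode_path (upper_root l) (lower_root l) (potential \<theta>) X" "bounded (range X)"
  shows "X t = 0"
proof -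
  define x0 x1 where "x0 t = \<gamma>\<^sup>2 * v t - v2 t" and "x1 t = \<gamma>\<^sup>2 * v1 t - v3 t" for t
  have dx0: "(x0 has_real_derivative x1 t) (at t)" for t
    unfolding x0_def[abs_def] x1_def by (auto intro!: derivative_eq_intros dv)
  have dx1: "(x1 has_real_derivative \<alpha>\<^sup>2 * x0 t - nonlin t) (at t)" for t
    unfolding x1_def[abs_def] x0_def by (auto intro!: derivative_eq_intros dv3 dv(1-3) simp: algebra_simps)
  define \<eta> \<eta>' where "\<eta> t = x1 t + \<alpha> * x0 t" and "\<eta>' t = \<alpha> * x0 t - x1 t" for t
  have d\<eta>: "(\<eta> has_real_derivative \<alpha> * \<eta> t - nonlin t) (at t)"
    and d\<eta>': "(\<eta>' has_real_derivative nonlin t - \<alpha> * \<eta>' t) (at t)" for t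
    unfolding \<eta>_def[abs_def] \<eta>'_def[abs_def]
    by (auto intro!: derivative_eq_intros dx0 dx1 simp: algebra_simps power2_eq_square)
  have \<alpha>: "0 < \<alpha>" using constants by simp
  have crit: "0 < w" if "\<alpha> * w = nonlin t" for w t
    using nonlin_pos[of t] \<alpha> that by (metis zero_less_mult_pos)
  have per: "x0 (t + P) = x0 t" "x1 (t + P) = x1 t" for t by (simp_all add: x0_def x1_def v_per periodic)
  have per_m1: "\<eta> (t + P) = \<eta> t" for t
    by (simp add: \<eta>_def per)
  have crit_m1: "0 < \<eta> t" if "\<alpha> * \<eta> t - nonlin t = 0" for t
    using crit[of "\<eta> t" t] that by simp
  obtain m1 where m1: "0 < m1" "\<And>t. m1 \<le> \<eta> t"
    using positive_if_positive_at_critical[of \<eta> _ P, OF d\<eta> per_m1 P crit_m1] by blast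
  have per_m2: "\<eta>' (t + P) = \<eta>' t" for t
    by (simp add: \<eta>'_def per)
  have crit_m2: "0 < \<eta>' t" if "nonlin t - \<alpha> * \<eta>' t = 0" for t
    using crit[of "\<eta>' t" t] that by simp
  obtain m2 where m2: "0 < m2" "\<And>t. m2 \<le> \<eta>' t"
    using positive_if_positive_at_critical[of \<eta>' _ P, OF d\<eta>' per_m2 P crit_m2] by blast
  have x0_pos: "0 < x0 t" for t
  proof -
    have "0 < \<eta> t + \<eta>' t" using m1 m2 by (meson add_pos_pos less_le_trans)
    then have "0 < 2 * \<alpha> * x0 t" by (simp add: \<eta>_def \<eta>'_def)
    then show ?thesis using \<alpha> by (simp add: zero_less_mult_iff)
  qed
  define \<sigma> \<sigma>' where "\<sigma> t = v1 t + \<gamma> * v t" and "\<sigma>' t = \<gamma> * v t - v1 t" for t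
  have d\<sigma>: "(\<sigma> has_real_derivative \<gamma> * \<sigma> t - x0 t) (at t)"
    and d\<sigma>': "(\<sigma>' has_real_derivative x0 t - \<gamma> * \<sigma>' t) (at t)" for t
    unfolding \<sigma>_def[abs_def] \<sigma>'_def[abs_def] x0_def
    by (auto intro!: derivative_eq_intros dv simp: algebra_simps power2_eq_square)
  have crit': "0 < w" if "\<gamma> * w = x0 t" for w t
    using x0_pos[of t] constants(1) that by (metis zero_less_mult_pos)
  have per_m3: "\<sigma> (t + P) = \<sigma> t" for t
    by (simp add: \<sigma>_def v_per periodic)
  have crit_m3: "0 < \<sigma> t" if "\<gamma> * \<sigma> t - x0 t = 0" for t
    using crit'[of "\<sigma> t" t] that by simp
  obtain m3 where m3: "0 < m3" "\<And>t. m3 \<le> \<sigma> t"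
    using positive_if_positive_at_critical[of \<sigma> _ P, OF d\<sigma> per_m3 P crit_m3] by blast
  have per_m4: "\<sigma>' (t + P) = \<sigma>' t" for t
    by (simp add: \<sigma>'_def v_per periodic)
  have crit_m4: "0 < \<sigma>' t" if "x0 t - \<gamma> * \<sigma>' t = 0" for t
    using crit'[of "\<sigma>' t" t] that by simp
  obtain m4 where m4: "0 < m4" "\<And>t. m4 \<le> \<sigma>' t"
    using positive_if_positive_at_critical[of \<sigma>' _ P, OF d\<sigma>' per_m4 P crit_m4] by blast
  define h h1 k k1 where "h t = exp t * \<sigma> t + exp (- t) * \<sigma>' t"
    and "h1 t = exp t * ((1 + \<gamma>) * \<sigma> t - x0 t) - exp (- t) * ((1 + \<gamma>) * \<sigma>' t - x0 t)"
    and "k t = exp t * \<eta> t + exp (- t) * \<eta>' t"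
    and "k1 t = exp t * ((1 + \<alpha>) * \<eta> t - nonlin t) - exp (- t) * ((1 + \<alpha>) * \<eta>' t - nonlin t)" for t
  have dh: "(h has_real_derivative h1 t) (at t)" for t
    unfolding h_def[abs_def] h1_def by (auto intro!: derivative_eq_intros d\<sigma> d\<sigma>' simp: algebra_simps)
  have dh1: "(h1 has_real_derivative (1 + \<gamma>)\<^sup>2 * h t - k t) (at t)" for t
    unfolding h1_def[abs_def] h_def k_def \<eta>_def \<eta>'_def constants(2)
    by (auto intro!: derivative_eq_intros d\<sigma> d\<sigma>' dx0 simp: algebra_simps power2_eq_square)
  have dk: "(k has_real_derivative k1 t) (at t)" for t
    unfolding k_def[abs_def] k1_def by (auto intro!: derivative_eq_intros d\<eta> d\<eta>' simp: algebra_simps)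
  have dk1: "(k1 has_real_derivative (1 + \<alpha>)\<^sup>2 * k t - potential q t * h t) (at t)" for t
  proof -
    have "(k1 has_real_derivative exp t * ((1 + \<alpha>)\<^sup>2 * \<eta> t - (\<alpha> + 2) * nonlin t - potential q t * v1 t)
        + exp (- t) * ((1 + \<alpha>)\<^sup>2 * \<eta>' t - (\<alpha> + 2) * nonlin t + potential q t * v1 t)) (at t)"
      unfolding k1_def[abs_def]
      by (auto intro!: derivative_eq_intros d\<eta> d\<eta>' nonlin_deriv simp: algebra_simps power2_eq_square)
    moreover have eq: "(\<alpha> + 2) * nonlin t = potential q t * (\<gamma> * v t)"
      unfolding constants(4)[symmetric] nonlin_eq by (simp add: potential_def)
    have "exp t * ((1 + \<alpha>)\<^sup>2 * \<eta> t - (\<alpha> + 2) * nonlin t - potential q t * v1 t)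
        + exp (- t) * ((1 + \<alpha>)\<^sup>2 * \<eta>' t - (\<alpha> + 2) * nonlin t + potential q t * v1 t)
        = (1 + \<alpha>)\<^sup>2 * k t - potential q t * h t"
      unfolding eq k_def h_def \<sigma>_def \<sigma>'_def by (simp add: algebra_simps)
    ultimately show ?thesis by simp
  qed
  define m where "m = min (min m1 m2) (min m3 m4)"
  have exp_le: "m * exp \<bar>t\<bar> \<le> exp t * x + exp (- t) * y" if "m \<le> x" "m \<le> y" for t x y
  proof -
    have m: "0 < m" using m1 m2 m3 m4 by (simp add: m_def)
    have 1: "m * exp t \<le> exp t * x" "m * exp (- t) \<le> exp (- t) * y" using that by (simp_all add: mult.commute)
    have 2: "0 < m * exp t" "0 < m * exp (- t)" using m by simp_all
    show ?thesis
    proof (cases "0 \<le> t")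
      case True
      then have abs_t: "\<bar>t\<bar> = t" by simp
      show ?thesis unfolding abs_t using 1 2 by linarith
    next
      case False
      then have abs_t: "\<bar>t\<bar> = - t" by simp
      show ?thesis unfolding abs_t using 1 2 by linarith
    qed
  qed
  have root_ge: "real n \<le> discriminant_root l"
    unfolding discriminant_root_def by (rule real_le_rsqrt) (use l in \<open>simp add: power2_eq_square algebra_simps\<close>)
  show ?thesis
  proof (rule supersolution_excludes_bounded[OF dh dh1 dk dk1, of m])
    show "(1 + \<alpha>)\<^sup>2 \<le> upper_root l" "(1 + \<gamma>)\<^sup>2 \<le> lower_root l"
      unfolding upper_root_def lower_root_def using root_ge n by (auto simp: \<alpha>_def \<gamma>_def field_simps intro!: power_mono)
    show "potential \<theta> t \<le> potential q t" for t
      unfolding potential_def using \<theta> constants(7) by (intro mult_right_mono) auto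
    show "0 \<le> potential \<theta> t" for t using potential_pos[OF \<theta>(1)] less_imp_le by blast
    show "m * exp \<bar>t\<bar> \<le> h t" "m * exp \<bar>t\<bar> \<le> k t" for t
      unfolding h_def k_def using m1(2)[of t] m2(2)[of t] m3(2)[of t] m4(2)[of t]
      by (intro exp_le; simp add: m_def)+
  qed (use m1 m2 m3 m4 X in \<open>auto simp: m_def upper_root_def lower_root_def\<close>)
qed

lemma exponents_0: "upper_root 0 = \<alpha>\<^sup>2" "lower_root 0 = \<gamma>\<^sup>2"
proof -
  have "discriminant_root 0 = real n - 2" unfolding discriminant_root_def using n by simp
  then have "discriminant_root 0 / 2 + 1 = \<alpha>" "discriminant_root 0 / 2 - 1 = \<gamma>"
    by (simp_all add: \<alpha>_def \<gamma>_def field_simps)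
  then show "upper_root 0 = \<alpha>\<^sup>2" "lower_root 0 = \<gamma>\<^sup>2" by (simp_all add: upper_root_def lower_root_def)
qed

lemma periodic_path_bounded:
  assumes X: "mode_path A B Q X" and per: "\<And>t. X (t + P) = X t"
  shows "bounded (range X)"
  by (rule periodic_bounded[OF mode_path_continuous[OF X], of P]) (use per P in auto)

text \<open>Across \<open>\<Lambda>\<close> the profile itself solves the linearized equation.\<close>
lemma bounded_solution_perp:
  "\<exists>X t0. mode_path (upper_root 0) (lower_root 0) (potential 1) X \<and> bounded (range X) \<and> X t0 \<noteq> 0"
proof -
  let ?X = "\<lambda>t. (v t, v1 t, v2 t - \<gamma>\<^sup>2 * v t, v3 t - \<gamma>\<^sup>2 * v1 t)"
  have X: "mode_path (upper_root 0) (lower_root 0) (potential 1) ?X"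
    unfolding mode_path_coords exponents_0
    by (auto intro!: derivative_eq_intros dv(1-3) dv3 simp: nonlin_eq algebra_simps)
  have "bounded (range ?X)"
    by (rule periodic_path_bounded[OF X]) (simp add: v_per periodic)
  moreover have "?X 0 \<noteq> 0" using v_pos[of 0] by (simp add: zero_prod_def)
  ultimately show ?thesis using X by blast
qed

text \<open>The profile equation is autonomous, so \<open>v'\<close> solves the equation along \<open>\<Lambda>\<close>.  If \<open>v\<close> is constant,
  this solution is zero; then the equation has constant coefficients and, as
  \<open>Q = q A B > A B\<close>, an imaginary characteristic exponent \<open>i \<omega>\<close>.\<close>
lemma bounded_solution_par:
  "\<exists>X t0. mode_path (upper_root 0) (lower_root 0) (potential q) X \<and> bounded (range X) \<and> X t0 \<noteq> 0"
proof (cases "\<forall>t. v1 t = 0")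
  case False
  then obtain t0 where t0: "v1 t0 \<noteq> 0" by blast
  let ?v4 = "\<lambda>t. (\<gamma>\<^sup>2 + \<alpha>\<^sup>2) * v2 t - \<gamma>\<^sup>2 * \<alpha>\<^sup>2 * v t + nonlin t"
  let ?X = "\<lambda>t. (v1 t, v2 t, v3 t - \<gamma>\<^sup>2 * v1 t, ?v4 t - \<gamma>\<^sup>2 * v2 t)"
  have X: "mode_path (upper_root 0) (lower_root 0) (potential q) ?X"
    unfolding mode_path_coords exponents_0
    by (auto intro!: derivative_eq_intros dv(1-3) dv3 nonlin_deriv simp: algebra_simps)
  have "bounded (range ?X)"
    by (rule periodic_path_bounded[OF X]) (simp add: v_per periodic)
  moreover have "?X t0 \<noteq> 0" using t0 by (simp add: zero_prod_def)
  ultimately show ?thesis using X by blast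
next
  case True
  have 1: "v1 = (\<lambda>_. 0)" using True by auto
  have 2: "v2 = (\<lambda>_. 0)"
  proof
    show "v2 t = 0" for t using DERIV_unique[OF dv(2)[of t], of 0] by (simp add: 1)
  qed
  have 3: "v3 = (\<lambda>_. 0)"
  proof
    show "v3 t = 0" for t using DERIV_unique[OF dv(3)[of t], of 0] by (simp add: 2)
  qed
  have "nonlin t = \<gamma>\<^sup>2 * \<alpha>\<^sup>2 * v t" for t using DERIV_unique[OF dv3[of t], of 0] by (simp add: 2 3)
  then have "potential 1 t = \<gamma>\<^sup>2 * \<alpha>\<^sup>2" for t using v_pos[of t] nonlin_eq[of t] by simp
  then have pot: "potential q t = q * (\<gamma>\<^sup>2 * \<alpha>\<^sup>2)" for t by (simp add: potential_def mult.assoc)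
  define a b where "a = \<gamma>\<^sup>2 + \<alpha>\<^sup>2" and "b = (q - 1) * (\<gamma>\<^sup>2 * \<alpha>\<^sup>2)"
  have b: "0 < b" using constants(1,2,3) by (simp add: b_def)
  \<comment> \<open>\<open>- w\<close> is the negative root of \<open>x\<^sup>2 - a x - b\<close>\<close>
  define w where "w = (- a + sqrt (a\<^sup>2 + 4 * b)) / 2"
  have "a < sqrt (a\<^sup>2 + 4 * b)" using b by (intro real_less_rsqrt) simp
  then have w: "0 < w" by (simp add: w_def)
  have "2 * w + a = sqrt (a\<^sup>2 + 4 * b)" by (simp add: w_def field_simps)
  then have "(2 * w + a)\<^sup>2 = a\<^sup>2 + 4 * b" using b by simp
  then have w_eq: "w * w = b - a * w" by (simp add: power2_eq_square algebra_simps)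
  define \<omega> where "\<omega> = sqrt w"
  have \<omega>2: "\<omega> * \<omega> = w" using w by (simp add: \<omega>_def)
  let ?X = "\<lambda>t. (cos (\<omega> * t), - \<omega> * sin (\<omega> * t), - (w + \<gamma>\<^sup>2) * cos (\<omega> * t), (w + \<gamma>\<^sup>2) * \<omega> * sin (\<omega> * t))"
  have char: "(w + \<gamma>\<^sup>2) * w = - (\<alpha>\<^sup>2 * (w + \<gamma>\<^sup>2)) + q * (\<gamma>\<^sup>2 * \<alpha>\<^sup>2)"
    using w_eq by (simp add: a_def b_def algebra_simps)
  have X: "mode_path (upper_root 0) (lower_root 0) (potential q) ?X"
    unfolding mode_path_coords exponents_0 pot
  proof (intro allI conjI)
    fix t
    show "((\<lambda>t. cos (\<omega> * t)) has_real_derivative - \<omega> * sin (\<omega> * t)) (at t)"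
      "((\<lambda>t. - (w + \<gamma>\<^sup>2) * cos (\<omega> * t)) has_real_derivative (w + \<gamma>\<^sup>2) * \<omega> * sin (\<omega> * t)) (at t)"
      by (auto intro!: derivative_eq_intros simp: algebra_simps)
    have "((\<lambda>t. - \<omega> * sin (\<omega> * t)) has_real_derivative - (\<omega> * \<omega>) * cos (\<omega> * t)) (at t)"
      by (auto intro!: derivative_eq_intros)
    then show "((\<lambda>t. - \<omega> * sin (\<omega> * t)) has_real_derivative \<gamma>\<^sup>2 * cos (\<omega> * t) + - (w + \<gamma>\<^sup>2) * cos (\<omega> * t)) (at t)"
      unfolding \<omega>2 by (simp add: algebra_simps)
    have "((\<lambda>t. (w + \<gamma>\<^sup>2) * \<omega> * sin (\<omega> * t)) has_real_derivative ((w + \<gamma>\<^sup>2) * (\<omega> * \<omega>)) * cos (\<omega> * t)) (at t)"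
      by (auto intro!: derivative_eq_intros)
    then show "((\<lambda>t. (w + \<gamma>\<^sup>2) * \<omega> * sin (\<omega> * t)) has_real_derivative
        \<alpha>\<^sup>2 * (- (w + \<gamma>\<^sup>2) * cos (\<omega> * t)) + q * (\<gamma>\<^sup>2 * \<alpha>\<^sup>2) * cos (\<omega> * t)) (at t)"
      unfolding \<omega>2 char by (simp add: algebra_simps)
  qed
  have "norm (?X t) \<le> 1 + \<bar>\<omega>\<bar> + \<bar>w + \<gamma>\<^sup>2\<bar> + \<bar>(w + \<gamma>\<^sup>2) * \<omega>\<bar>" for t
  proof (rule order_trans[OF norm_quad_le])
    have "\<bar>x * cos y\<bar> \<le> \<bar>x\<bar>" "\<bar>x * sin y\<bar> \<le> \<bar>x\<bar>" for x y :: real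
      by (simp_all add: abs_mult mult_left_le)
    then show "\<bar>cos (\<omega> * t)\<bar> + \<bar>- \<omega> * sin (\<omega> * t)\<bar> + \<bar>- (w + \<gamma>\<^sup>2) * cos (\<omega> * t)\<bar> + \<bar>(w + \<gamma>\<^sup>2) * \<omega> * sin (\<omega> * t)\<bar>
        \<le> 1 + \<bar>\<omega>\<bar> + \<bar>w + \<gamma>\<^sup>2\<bar> + \<bar>(w + \<gamma>\<^sup>2) * \<omega>\<bar>"
      by (intro add_mono) (metis abs_cos_le_one abs_minus_cancel)+
  qed
  then have "bounded (range ?X)" by (auto simp: bounded_iff)
  moreover have "?X 0 \<noteq> 0" by (simp add: zero_prod_def)
  ultimately show ?thesis using X by blast
qed

end

section \<open>From scalar equations to the system\<close>

lemma sum_fun_eval: "(\<Sum>i\<in>I. f i) t = (\<Sum>i\<in>I. f i t)"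
  for f :: "'i \<Rightarrow> 'a \<Rightarrow> 'b::comm_monoid_add"
  by (induction I rule: infinite_finite_induct) (auto simp: zero_fun_def plus_fun_def)

lemma indexed_basis_imp_solution_basis:
  fixes u :: "'i \<Rightarrow> 'a \<Rightarrow> 'b::real_vector"
  assumes "indexed_basis I u S"
  shows "solution_basis (u ` I) S" "card (u ` I) = card I"
proof -
  have fin: "finite I" and S: "S = range (\<lambda>c t. \<Sum>i\<in>I. c i *\<^sub>R u i t)"
    and ind: "\<And>c i. (\<And>t. (\<Sum>i\<in>I. c i *\<^sub>R u i t) = 0) \<Longrightarrow> i \<in> I \<Longrightarrow> c i = 0"
    using assms by (auto simp: indexed_basis_def)
  have inj: "inj_on u I"
  proof (rule inj_onI, rule ccontr)
    fix i j assume ij: "i \<in> I" "j \<in> I" "u i = u j" "i \<noteq> j"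
    define c where "c k = (if k = i then 1 else if k = j then - 1 else 0 :: real)" for k
    have "(\<Sum>k\<in>I. c k *\<^sub>R u k t) = 0" for t
    proof -
      have "(\<Sum>k\<in>I. c k *\<^sub>R u k t) = (\<Sum>k\<in>{i, j}. c k *\<^sub>R u k t)"
        by (rule sum.mono_neutral_right) (use fin ij in \<open>auto simp: c_def\<close>)
      then show ?thesis using ij by (simp add: c_def)
    qed
    then have "c i = 0" by (rule ind) (rule ij)
    then show False by (simp add: c_def)
  qed
  then show "card (u ` I) = card I" by (rule card_image)
  have eval: "(\<Sum>f\<in>u ` I. fun_scale (d f) f) = (\<lambda>t. \<Sum>i\<in>I. d (u i) *\<^sub>R u i t)" for d
    by (auto simp: sum.reindex[OF inj] fun_eq_iff sum_fun_eval fun_scale_def)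
  have "fun_vs.span (u ` I) = S"
  proof -
    have "fun_vs.span (u ` I) = range (\<lambda>d t. \<Sum>i\<in>I. d (u i) *\<^sub>R u i t)"
      by (simp add: fun_vs.span_finite[OF finite_imageI[OF fin]] eval)
    also have "\<dots> = S"
      unfolding S
    proof (intro set_eqI iffI; elim rangeE)
      fix f and d :: "('a \<Rightarrow> 'b) \<Rightarrow> real" assume "f = (\<lambda>t. \<Sum>i\<in>I. d (u i) *\<^sub>R u i t)"
      then show "f \<in> range (\<lambda>c t. \<Sum>i\<in>I. c i *\<^sub>R u i t)"
        by (intro range_eqI[where x = "\<lambda>i. d (u i)"]) simp
    next
      fix f and c :: "'i \<Rightarrow> real" assume "f = (\<lambda>t. \<Sum>i\<in>I. c i *\<^sub>R u i t)"
      then show "f \<in> range (\<lambda>d t. \<Sum>i\<in>I. d (u i) *\<^sub>R u i t)"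
        by (intro range_eqI[where x = "\<lambda>f. c (the_inv_into I u f)"])
          (auto simp: the_inv_into_f_f[OF inj] intro!: ext sum.cong)
    qed
    finally show ?thesis .
  qed
  moreover have "fun_vs.independent (u ` I)"
    unfolding fun_vs.dependent_finite[OF finite_imageI[OF fin]]
  proof clarify
    fix d i assume 0: "(\<Sum>f\<in>u ` I. fun_scale (d f) f) = 0" and i: "i \<in> I" "d (u i) \<noteq> 0"
    have "(\<Sum>i\<in>I. d (u i) *\<^sub>R u i t) = 0" for t
      using 0 unfolding eval by (simp add: fun_eq_iff)
    then have "d (u i) = 0" by (rule ind) (rule i)
    then show False using i by simp
  qed
  ultimately show "solution_basis (u ` I) S" by (simp add: solution_basis_def)
qed

lemma indexed_basisD:
  assumes "indexed_basis I u S" "\<And>t. (\<Sum>i\<in>I. c i *\<^sub>R u i t) = 0" "i \<in> I"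
  shows "c i = 0"
  using assms unfolding indexed_basis_def by blast

lemma indexed_basis_shift:
  fixes u :: "'i \<Rightarrow> real \<Rightarrow> 'b::real_vector"
  assumes "indexed_basis I u S"
  shows "indexed_basis I (\<lambda>i t. u i (t + c)) {f. (\<lambda>t. f (t - c)) \<in> S}"
  unfolding indexed_basis_def
proof (intro conjI allI impI set_eqI iffI)
  show "finite I" using assms by (simp add: indexed_basis_def)
  fix f assume "f \<in> {f. (\<lambda>t. f (t - c)) \<in> S}"
  then obtain d where d: "(\<lambda>t. f (t - c)) = (\<lambda>t. \<Sum>i\<in>I. d i *\<^sub>R u i t)"
    using assms by (auto simp: indexed_basis_def)
  have "f t = (\<Sum>i\<in>I. d i *\<^sub>R u i (t + c))" for t using fun_cong[OF d, of "t + c"] by simp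
  then show "f \<in> range (\<lambda>d t. \<Sum>i\<in>I. d i *\<^sub>R u i (t + c))" by auto
next
  fix f assume "f \<in> range (\<lambda>d t. \<Sum>i\<in>I. d i *\<^sub>R u i (t + c))"
  then show "f \<in> {f. (\<lambda>t. f (t - c)) \<in> S}" using assms by (auto simp: indexed_basis_def)
next
  fix d assume 0: "\<forall>t. (\<Sum>i\<in>I. d i *\<^sub>R u i (t + c)) = 0"
  have "(\<Sum>i\<in>I. d i *\<^sub>R u i t) = 0" for t using 0[rule_format, of "t - c"] by simp
  then show "\<forall>i\<in>I. d i = 0" using assms by (auto simp: indexed_basis_def)
qed

text \<open>Taking inner products with the vectors of an orthonormal frame separates the components, for
  spanning as well as for independence.\<close>
lemma indexed_basis_vector:
  fixes E :: "'v::euclidean_space set" and u :: "'v \<Rightarrow> 'i \<Rightarrow> real \<Rightarrow> real"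
  assumes E: "finite E" "pairwise orthogonal E" "\<And>b. b \<in> E \<Longrightarrow> norm b = 1" "span E = UNIV"
    and u: "\<And>b. b \<in> E \<Longrightarrow> indexed_basis I (u b) (S b)" and I: "finite I"
  shows "indexed_basis (E \<times> I) (\<lambda>(b, i) t. u b i t *\<^sub>R b) {\<Phi>. \<forall>b\<in>E. (\<lambda>t. \<Phi> t \<bullet> b) \<in> S b}"
proof -
  have dot: "b \<bullet> b' = (if b = b' then 1 else 0)" if "b \<in> E" "b' \<in> E" for b b'
    using that E(2,3) by (auto simp: pairwise_def orthogonal_def norm_eq_1)
  have sumE: "(\<Sum>p\<in>E \<times> I. c p *\<^sub>R (case p of (b, i) \<Rightarrow> \<lambda>t. u b i t *\<^sub>R b) t) = (\<Sum>b\<in>E. (\<Sum>i\<in>I. c (b, i) *\<^sub>R u b i t) *\<^sub>R b)" for c t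
    by (simp add: sum.cartesian_product scaleR_sum_left case_prod_unfold)
  have coord: "(\<Sum>b\<in>E. x b *\<^sub>R b) \<bullet> b' = x b'" if "b' \<in> E" for x b'
  proof -
    have "(\<Sum>b\<in>E. x b *\<^sub>R b) \<bullet> b' = (\<Sum>b\<in>E. if b = b' then x b else 0)"
      unfolding inner_sum_left by (rule sum.cong) (use dot that in auto)
    then show ?thesis using that E(1) by simp
  qed
  show ?thesis
    unfolding indexed_basis_def sumE
  proof (intro conjI allI impI set_eqI iffI)
    fix \<Phi> assume "\<Phi> \<in> {\<Phi>. \<forall>b\<in>E. (\<lambda>t. \<Phi> t \<bullet> b) \<in> S b}"
    then have "\<forall>b\<in>E. \<exists>c. (\<lambda>t. \<Phi> t \<bullet> b) = (\<lambda>t. \<Sum>i\<in>I. c i *\<^sub>R u b i t)"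
      using u unfolding indexed_basis_def by blast
    then obtain c where c: "\<And>b. b \<in> E \<Longrightarrow> (\<lambda>t. \<Phi> t \<bullet> b) = (\<lambda>t. \<Sum>i\<in>I. c b i *\<^sub>R u b i t)"
      by metis
    have "\<Phi> t = (\<Sum>b\<in>E. (\<Sum>i\<in>I. c b i *\<^sub>R u b i t) *\<^sub>R b)" for t
    proof -
      have "\<Phi> t = (\<Sum>b\<in>E. (\<Phi> t \<bullet> b) *\<^sub>R b)"
        using orthonormal_basis_expand[OF E(2,3) _ E(1), of "\<Phi> t"] E(4) by simp
      also have "\<dots> = (\<Sum>b\<in>E. (\<Sum>i\<in>I. c b i *\<^sub>R u b i t) *\<^sub>R b)"
        by (rule sum.cong) (use c[THEN fun_cong] in auto)
      finally show ?thesis .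
    qed
    then show "\<Phi> \<in> range (\<lambda>c t. \<Sum>b\<in>E. (\<Sum>i\<in>I. c (b, i) *\<^sub>R u b i t) *\<^sub>R b)"
      by (intro range_eqI[where x = "\<lambda>(b, i). c b i"]) auto
  next
    fix \<Phi> assume "\<Phi> \<in> range (\<lambda>c t. \<Sum>b\<in>E. (\<Sum>i\<in>I. c (b, i) *\<^sub>R u b i t) *\<^sub>R b)"
    then obtain c where c: "\<Phi> = (\<lambda>t. \<Sum>b\<in>E. (\<Sum>i\<in>I. c (b, i) *\<^sub>R u b i t) *\<^sub>R b)" by (elim rangeE)
    have "(\<lambda>t. \<Phi> t \<bullet> b) \<in> S b" if b: "b \<in> E" for b
    proof -
      have "(\<lambda>t. \<Phi> t \<bullet> b) = (\<lambda>t. \<Sum>i\<in>I. c (b, i) *\<^sub>R u b i t)"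
        unfolding c coord[OF b] ..
      then show ?thesis using u[OF b] unfolding indexed_basis_def by auto
    qed
    then show "\<Phi> \<in> {\<Phi>. \<forall>b\<in>E. (\<lambda>t. \<Phi> t \<bullet> b) \<in> S b}" by simp
  next
    fix c assume 0: "\<forall>t. (\<Sum>b\<in>E. (\<Sum>i\<in>I. c (b, i) *\<^sub>R u b i t) *\<^sub>R b) = 0"
    have "c (b, i) = 0" if b: "b \<in> E" and i: "i \<in> I" for b i
    proof -
      have "(\<Sum>i\<in>I. c (b, i) *\<^sub>R u b i t) = 0" for t
        using coord[OF b, of "\<lambda>b. \<Sum>i\<in>I. c (b, i) *\<^sub>R u b i t"] 0 by simp
      from indexed_basisD[OF u[OF b] this i] show ?thesis .
    qed
    then show "\<forall>p\<in>E \<times> I. c p = 0" by auto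
  qed (use E I in auto)
qed

lemma deriv_sum:
  fixes f :: "'i \<Rightarrow> real \<Rightarrow> real"
  assumes "\<And>i. i \<in> I \<Longrightarrow> four_times_differentiable (f i)"
  shows "four_times_differentiable (\<lambda>t. \<Sum>i\<in>I. c i * f i t)"
    and "k \<le> 4 \<Longrightarrow> (deriv ^^ k) (\<lambda>t. \<Sum>i\<in>I. c i * f i t) = (\<lambda>t. \<Sum>i\<in>I. c i * (deriv ^^ k) (f i) t)"
proof -
  have d: "((\<lambda>t. \<Sum>i\<in>I. c i * (deriv ^^ k) (f i) t) has_real_derivative (\<Sum>i\<in>I. c i * (deriv ^^ Suc k) (f i) t)) (at t)"
    if "k < 4" for k t
    using assms that by (auto simp: four_times_differentiable_iff simp del: funpow.simps intro!: DERIV_sum DERIV_cmult)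
  show eq: "k \<le> 4 \<Longrightarrow> (deriv ^^ k) (\<lambda>t. \<Sum>i\<in>I. c i * f i t) = (\<lambda>t. \<Sum>i\<in>I. c i * (deriv ^^ k) (f i) t)" for k
  proof (induction k)
    case (Suc k)
    then have IH: "(deriv ^^ k) (\<lambda>t. \<Sum>i\<in>I. c i * f i t) = (\<lambda>t. \<Sum>i\<in>I. c i * (deriv ^^ k) (f i) t)" by simp
    have "k < 4" using Suc.prems by simp
    then show ?case
      unfolding funpow.simps o_apply IH
      by (intro ext DERIV_imp_deriv) (rule d[unfolded funpow.simps o_apply])
  qed simp
  show "four_times_differentiable (\<lambda>t. \<Sum>i\<in>I. c i * f i t)"
    unfolding four_times_differentiable_iff
  proof (intro allI impI)
    fix k :: nat and t assume "k < 4"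
    then show "((deriv ^^ k) (\<lambda>t. \<Sum>i\<in>I. c i * f i t) has_real_derivative (deriv ^^ Suc k) (\<lambda>t. \<Sum>i\<in>I. c i * f i t) t) (at t)"
      using d[of k t] eq[of k] eq[of "Suc k"] by (simp del: funpow.simps)
  qed
qed

lemma mode_functions_shift:
  "f \<in> mode_functions A B (\<lambda>t. Q (t + c)) \<longleftrightarrow> (\<lambda>t. f (t - c)) \<in> mode_functions A B Q"
proof
    assume "f \<in> mode_functions A B (\<lambda>t. Q (t + c))"
    then obtain X where "mode_path A B (\<lambda>t. Q (t + c)) X" "f = (\<lambda>t. fst (X t))" by (auto simp: mode_functions_def)
    then show "(\<lambda>t. f (t - c)) \<in> mode_functions A B Q"
      using mode_path_translate[of A B "\<lambda>t. Q (t + c)" X "- c"] by (auto simp: mode_functions_def)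
  next
    assume "(\<lambda>t. f (t - c)) \<in> mode_functions A B Q"
    then obtain X where X: "mode_path A B Q X" "(\<lambda>t. f (t - c)) = (\<lambda>t. fst (X t))" by (auto simp: mode_functions_def)
    have "f t = fst (X (t + c))" for t using fun_cong[OF X(2), of "t + c"] by simp
    then show "f \<in> mode_functions A B (\<lambda>t. Q (t + c))"
      using mode_path_translate[OF X(1), of c] by (auto simp: mode_functions_def)
qed

lemma lin_growth_iff_bigo:
  assumes "continuous_on UNIV f"
  shows "lin_growth f \<longleftrightarrow> f \<in> O[at_infinity](\<lambda>t. t)"
proof
  assume "lin_growth f"
  then obtain C where C: "\<And>t. \<bar>f t\<bar> \<le> C * (1 + \<bar>t\<bar>)" by (auto simp: lin_growth_def)
  have C0: "0 \<le> C" using order_trans[OF abs_ge_zero C[of 0]] by simp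
  have "\<bar>f t\<bar> \<le> (2 * C) * \<bar>t\<bar>" if "1 \<le> \<bar>t\<bar>" for t
    using C[of t] mult_left_mono[OF that C0] by (simp add: algebra_simps)
  then have "\<forall>\<^sub>F t in at_infinity. norm (f t) \<le> (2 * C) * norm t"
    unfolding eventually_at_infinity by (intro exI[of _ 1]) auto
  then show "f \<in> O[at_infinity](\<lambda>t. t)" by (rule bigoI)
next
  assume "f \<in> O[at_infinity](\<lambda>t. t)"
  then obtain c where c: "0 < c" "\<forall>\<^sub>F t in at_infinity. norm (f t) \<le> c * norm t"
    by (rule landau_o.bigE)
  then obtain R where R: "\<And>t. R \<le> \<bar>t\<bar> \<Longrightarrow> \<bar>f t\<bar> \<le> c * \<bar>t\<bar>" by (auto simp: eventually_at_infinity)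
  have "compact (f ` {- R..R})"
    by (intro compact_continuous_image continuous_on_subset[OF assms]) auto
  then obtain M where M: "\<And>y. y \<in> f ` {- R..R} \<Longrightarrow> \<bar>y\<bar> \<le> M"
    using compact_imp_bounded bounded_iff by (metis real_norm_def)
  have "\<bar>f t\<bar> \<le> (c + \<bar>M\<bar>) * (1 + \<bar>t\<bar>)" for t
  proof -
    have "\<bar>f t\<bar> \<le> c * \<bar>t\<bar> \<or> \<bar>f t\<bar> \<le> \<bar>M\<bar>"
    proof (cases "R \<le> \<bar>t\<bar>")
      case False
      then have "f t \<in> f ` {- R..R}" by (intro imageI) auto
      then show ?thesis using M[of "f t"] by linarith
    qed (use R in simp)
    moreover have "(c + \<bar>M\<bar>) * (1 + \<bar>t\<bar>) = c * \<bar>t\<bar> + \<bar>M\<bar> + (c + \<bar>M\<bar> * \<bar>t\<bar>)" by (simp add: algebra_simps)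
    moreover have "0 \<le> c * \<bar>t\<bar>" "0 \<le> \<bar>M\<bar>" "0 \<le> c + \<bar>M\<bar> * \<bar>t\<bar>" using c(1) by simp_all
    ultimately show ?thesis by linarith
  qed
  then show "lin_growth f" by (auto simp: lin_growth_def)
qed

lemma mode_functions_continuous: "f \<in> mode_functions A B Q \<Longrightarrow> continuous_on UNIV f"
  unfolding mode_functions_def using mode_path_continuous by (auto intro!: continuous_intros)

lemma at_most_linear_iff:
  fixes E :: "'v::euclidean_space set"
  assumes E: "finite E" "pairwise orthogonal E" "\<And>b. b \<in> E \<Longrightarrow> norm b = 1" "span E = UNIV"
    and cont: "\<And>b. b \<in> E \<Longrightarrow> continuous_on UNIV (\<lambda>t. \<Phi> t \<bullet> b)"
  shows "at_most_linear \<Phi> \<longleftrightarrow> (\<forall>b\<in>E. lin_growth (\<lambda>t. \<Phi> t \<bullet> b))"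
proof
  assume "at_most_linear \<Phi>"
  then have \<Phi>: "(\<lambda>t. norm (\<Phi> t)) \<in> O[at_infinity](\<lambda>t. t)" by (simp add: at_most_linear_def)
  show "\<forall>b\<in>E. lin_growth (\<lambda>t. \<Phi> t \<bullet> b)"
  proof
    fix b assume b: "b \<in> E"
    have "\<bar>\<Phi> t \<bullet> b\<bar> \<le> norm (\<Phi> t)" for t
      using Cauchy_Schwarz_ineq2[of "\<Phi> t" b] E(3)[OF b] by simp
    then have "(\<lambda>t. \<Phi> t \<bullet> b) \<in> O[at_infinity](\<lambda>t. norm (\<Phi> t))"
      by (intro bigoI[of _ 1]) auto
    then show "lin_growth (\<lambda>t. \<Phi> t \<bullet> b)"
      using lin_growth_iff_bigo[OF cont[OF b]] landau_o.big_trans[OF _ \<Phi>] by blast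
  qed
next
  assume "\<forall>b\<in>E. lin_growth (\<lambda>t. \<Phi> t \<bullet> b)"
  then have "(\<lambda>t. \<Phi> t \<bullet> b) \<in> O[at_infinity](\<lambda>t. t)" if "b \<in> E" for b
    using lin_growth_iff_bigo[OF cont[OF that]] that by blast
  then have "(\<lambda>t. \<Sum>b\<in>E. \<bar>\<Phi> t \<bullet> b\<bar>) \<in> O[at_infinity](\<lambda>t. t)"
    by (intro big_sum_in_bigo) simp
  moreover have "norm (\<Phi> t) \<le> (\<Sum>b\<in>E. \<bar>\<Phi> t \<bullet> b\<bar>)" for t
  proof -
    have "norm (\<Phi> t) = norm (\<Sum>b\<in>E. (\<Phi> t \<bullet> b) *\<^sub>R b)"
      using orthonormal_basis_expand[OF E(2,3) _ E(1), of "\<Phi> t"] E(4) by simp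
    also have "\<dots> \<le> (\<Sum>b\<in>E. norm ((\<Phi> t \<bullet> b) *\<^sub>R b))" by (rule norm_sum)
    also have "\<dots> = (\<Sum>b\<in>E. \<bar>\<Phi> t \<bullet> b\<bar>)" by (rule sum.cong) (use E(3) in auto)
    finally show ?thesis .
  qed
  then have "(\<lambda>t. norm (\<Phi> t)) \<in> O[at_infinity](\<lambda>t. \<Sum>b\<in>E. \<bar>\<Phi> t \<bullet> b\<bar>)"
    by (intro bigoI[of _ 1]) (auto simp: abs_of_nonneg[OF sum_nonneg])
  ultimately show "at_most_linear \<Phi>"
    unfolding at_most_linear_def using landau_o.big_trans by blast
qed

lemma forward_growing_exp:
  assumes f: "forward_growing f" and \<Phi>: "\<And>t. norm (\<Phi> t) = \<bar>f (t + c)\<bar>"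
  shows "exp_growing at_top \<Phi>" "exp_decaying at_bot \<Phi>"
proof -
  obtain \<delta> \<delta>' m M where d: "0 < \<delta>" "0 < \<delta>'" "0 < m"
    and grow: "\<And>t. 0 \<le> t \<Longrightarrow> m * exp (\<delta> * t) \<le> \<bar>f t\<bar>" and decay: "\<And>t. t \<le> 0 \<Longrightarrow> \<bar>f t\<bar> \<le> M * exp (\<delta>' * t)"
    using f unfolding forward_growing_def by blast
  have "norm (exp (\<delta> * \<bar>t\<bar>)) \<le> (exp (- \<delta> * c) / m) * norm (norm (\<Phi> t))" if "max 0 (- c) \<le> t" for t
  proof -
    have "m * exp (\<delta> * (t + c)) \<le> \<bar>f (t + c)\<bar>" using that by (intro grow) auto
    then have "exp (- \<delta> * c) / m * (m * exp (\<delta> * (t + c))) \<le> exp (- \<delta> * c) / m * \<bar>f (t + c)\<bar>"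
      using d by (intro mult_left_mono) auto
    moreover have "exp (- \<delta> * c) / m * (m * exp (\<delta> * (t + c))) = exp (\<delta> * t)"
      using d by (simp add: distrib_left exp_add exp_minus)
    ultimately show ?thesis using that by (simp add: \<Phi>)
  qed
  then have "\<forall>\<^sub>F t in at_top. norm (exp (\<delta> * \<bar>t\<bar>)) \<le> (exp (- \<delta> * c) / m) * norm (norm (\<Phi> t))"
    unfolding eventually_at_top_linorder by blast
  then have "(\<lambda>t. exp (\<delta> * \<bar>t\<bar>)) \<in> O[at_top](\<lambda>t. norm (\<Phi> t))" by (rule bigoI)
  then show "exp_growing at_top \<Phi>" using d by (auto simp: exp_growing_def)
  have "norm (norm (\<Phi> t)) \<le> (M * exp (\<delta>' * c)) * norm (exp (- \<delta>' * \<bar>t\<bar>))" if "t \<le> min 0 (- c)" for t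
  proof -
    have "\<bar>f (t + c)\<bar> \<le> M * exp (\<delta>' * (t + c))" using that by (intro decay) auto
    then show ?thesis using that by (simp add: \<Phi> distrib_left exp_add mult_ac)
  qed
  then have "\<forall>\<^sub>F t in at_bot. norm (norm (\<Phi> t)) \<le> (M * exp (\<delta>' * c)) * norm (exp (- \<delta>' * \<bar>t\<bar>))"
    unfolding eventually_at_bot_linorder by blast
  then have "(\<lambda>t. norm (\<Phi> t)) \<in> O[at_bot](\<lambda>t. exp (- \<delta>' * \<bar>t\<bar>))" by (rule bigoI)
  then show "exp_decaying at_bot \<Phi>" using d by (auto simp: exp_decaying_def)
qed

lemma backward_growing_exp:
  assumes f: "forward_growing (\<lambda>t. f (- t))" and \<Phi>: "\<And>t. norm (\<Phi> t) = \<bar>f (t + c)\<bar>"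
  shows "exp_decaying at_top \<Phi>" "exp_growing at_bot \<Phi>"
proof -
  have "norm (\<Phi> (- t)) = \<bar>f (- (t + - c))\<bar>" for t by (simp add: \<Phi>)
  note r = forward_growing_exp[OF f, of "\<lambda>t. \<Phi> (- t)" "- c", OF this]
  show "exp_growing at_bot \<Phi>"
    using r(1) unfolding exp_growing_def at_top_mirror landau_o.big.in_filtermap_iff by simp
  show "exp_decaying at_top \<Phi>"
    using r(2) unfolding exp_decaying_def at_bot_mirror landau_o.big.in_filtermap_iff by simp
qed

context periodic_profile
begin

definition direction_weight :: "real ^ 'p \<Rightarrow> real ^ 'p \<Rightarrow> real" where
  "direction_weight \<Lambda> b = (if b = \<Lambda> then q else 1)"

text \<open>In an orthonormal frame containing \<open>\<Lambda>\<close> the coupling \<open>\<Lambda>\<^sub>i \<langle>\<Lambda>, \<Phi>\<rangle>\<close> is diagonal: it contributes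
  \<open>q - 1\<close> to the component along \<open>\<Lambda>\<close> and nothing to the others.\<close>
lemma mode_solutions_iff:
  fixes \<Lambda> :: "real ^ 'p" and T l :: real
  assumes E: "finite E" "pairwise orthogonal E" "\<And>b. b \<in> E \<Longrightarrow> norm b = 1" "span E = UNIV" "\<Lambda> \<in> E"
    and l: "0 \<le> l"
  shows "\<Phi> \<in> mode_solutions n \<Lambda> (\<lambda>t. v (t + T)) l \<longleftrightarrow>
    (\<forall>b\<in>E. (\<lambda>t. \<Phi> t \<bullet> b) \<in> mode_functions (upper_root l) (lower_root l) (\<lambda>t. potential (direction_weight \<Lambda> b) (t + T)))"
proof -
  define Q where "Q t = potential 1 (t + T)" for t
  have pot: "potential (direction_weight \<Lambda> b) (t + T) = direction_weight \<Lambda> b * Q t" for b t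
    by (simp add: potential_def Q_def)
  let ?L = "\<lambda>f t. (deriv ^^ 4) f t - (upper_root l + lower_root l) * (deriv ^^ 2) f t + upper_root l * lower_root l * f t"
  have lin: "?L (\<lambda>t. \<Sum>i\<in>I. c i * f i t) t = (\<Sum>i\<in>I. c i * ?L (f i) t)"
    if "\<And>i. i \<in> I \<Longrightarrow> four_times_differentiable (f i)" for I :: "'i set" and c f t
    using deriv_sum(2)[of I f 4 c, OF that] deriv_sum(2)[of I f 2 c, OF that]
    by (simp add: sum_subtractf sum.distrib sum_distrib_left algebra_simps)
  have sol_iff: "\<Phi> \<in> mode_solutions n \<Lambda> (\<lambda>t. v (t + T)) l \<longleftrightarrow>
     (\<forall>i. four_times_differentiable (\<lambda>t. \<Phi> t $ i)) \<and>
     (\<forall>t i. ?L (\<lambda>t. \<Phi> t $ i) t = Q t * ((q - 1) * (\<Lambda> $ i) * (\<Lambda> \<bullet> \<Phi> t) + \<Phi> t $ i))"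
    by (simp add: mode_solutions_def Lproj_def vec_eq_iff factorization[OF l] constants(8) Q_def potential_def)
  have fun_iff: "(\<lambda>t. \<Phi> t \<bullet> b) \<in> mode_functions (upper_root l) (lower_root l) (\<lambda>t. potential (direction_weight \<Lambda> b) (t + T)) \<longleftrightarrow>
      four_times_differentiable (\<lambda>t. \<Phi> t \<bullet> b) \<and> (\<forall>t. ?L (\<lambda>t. \<Phi> t \<bullet> b) t = direction_weight \<Lambda> b * Q t * (\<Phi> t \<bullet> b))" for b
    by (simp add: mode_functions_iff pot)
  have dot: "\<Lambda> \<bullet> b = (if b = \<Lambda> then 1 else 0)" if "b \<in> E" for b
    using that E(2,3,5) by (auto simp: pairwise_def orthogonal_def norm_eq_1)
  have weight: "(q - 1) * (b \<bullet> \<Lambda>) * (\<Lambda> \<bullet> x) + x \<bullet> b = direction_weight \<Lambda> b * (x \<bullet> b)" if "b \<in> E" for b x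
    using dot[OF that] by (auto simp: direction_weight_def inner_commute algebra_simps)
  show ?thesis
    unfolding sol_iff fun_iff
  proof (intro iffI ballI conjI allI; (elim conjE)?)
    fix b assume b: "b \<in> E" and d: "\<forall>i. four_times_differentiable (\<lambda>t. \<Phi> t $ i)"
      and eq: "\<forall>t i. ?L (\<lambda>t. \<Phi> t $ i) t = Q t * ((q - 1) * (\<Lambda> $ i) * (\<Lambda> \<bullet> \<Phi> t) + \<Phi> t $ i)"
    have comp: "\<Phi> t \<bullet> b = (\<Sum>i\<in>UNIV. b $ i * \<Phi> t $ i)" for t
      by (simp add: inner_vec_def mult.commute)
    show "four_times_differentiable (\<lambda>t. \<Phi> t \<bullet> b)"
      unfolding comp by (rule deriv_sum(1)) (use d in simp)
    fix t
    have "?L (\<lambda>t. \<Phi> t \<bullet> b) t = (\<Sum>i\<in>UNIV. b $ i * (Q t * ((q - 1) * (\<Lambda> $ i) * (\<Lambda> \<bullet> \<Phi> t) + \<Phi> t $ i)))"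
      unfolding comp using lin[of UNIV "\<lambda>i t. \<Phi> t $ i" "\<lambda>i. b $ i" t] d eq by simp
    also have "\<dots> = Q t * ((q - 1) * (b \<bullet> \<Lambda>) * (\<Lambda> \<bullet> \<Phi> t) + \<Phi> t \<bullet> b)"
    proof -
      have "(\<Sum>i\<in>UNIV. b $ i * (Q t * ((q - 1) * (\<Lambda> $ i) * y + x $ i))) = Q t * ((q - 1) * (b \<bullet> \<Lambda>) * y + x \<bullet> b)" for x y
        by (simp add: inner_vec_def sum.distrib sum_distrib_left sum_distrib_right distrib_left mult_ac)
      then show ?thesis .
    qed
    also have "\<dots> = direction_weight \<Lambda> b * Q t * (\<Phi> t \<bullet> b)" unfolding weight[OF b] by simp
    finally show "?L (\<lambda>t. \<Phi> t \<bullet> b) t = direction_weight \<Lambda> b * Q t * (\<Phi> t \<bullet> b)" .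
  next
    fix i assume all: "\<forall>b\<in>E. four_times_differentiable (\<lambda>t. \<Phi> t \<bullet> b) \<and> (\<forall>t. ?L (\<lambda>t. \<Phi> t \<bullet> b) t = direction_weight \<Lambda> b * Q t * (\<Phi> t \<bullet> b))"
    have expand: "x = (\<Sum>b\<in>E. (x \<bullet> b) *\<^sub>R b)" for x
      using orthonormal_basis_expand[OF E(2,3) _ E(1), of x] E(4) by simp
    have comp: "\<Phi> t $ i = (\<Sum>b\<in>E. b $ i * (\<Phi> t \<bullet> b))" for t
      using arg_cong[OF expand[of "\<Phi> t"], of "\<lambda>x. x $ i"] by (simp add: mult.commute)
    show "four_times_differentiable (\<lambda>t. \<Phi> t $ i)"
      unfolding comp by (rule deriv_sum(1)) (use all in simp)
    fix t
    have "?L (\<lambda>t. \<Phi> t $ i) t = (\<Sum>b\<in>E. b $ i * (direction_weight \<Lambda> b * Q t * (\<Phi> t \<bullet> b)))"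
      unfolding comp using lin[of E "\<lambda>b t. \<Phi> t \<bullet> b" "\<lambda>b. b $ i" t] all by simp
    also have "\<dots> = Q t * (\<Sum>b\<in>E. b $ i * ((q - 1) * (b \<bullet> \<Lambda>) * (\<Lambda> \<bullet> \<Phi> t) + \<Phi> t \<bullet> b))"
      unfolding sum_distrib_left by (rule sum.cong[OF refl], simp only: weight, simp only: mult_ac)
    also have "(\<Sum>b\<in>E. b $ i * ((q - 1) * (b \<bullet> \<Lambda>) * (\<Lambda> \<bullet> \<Phi> t) + \<Phi> t \<bullet> b)) =
        (q - 1) * (\<Lambda> \<bullet> \<Phi> t) * (\<Sum>b\<in>E. b $ i * (\<Lambda> \<bullet> b)) + (\<Sum>b\<in>E. b $ i * (\<Phi> t \<bullet> b))"
      by (simp add: sum.distrib sum_distrib_left distrib_left mult_ac inner_commute[of \<Lambda>])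
    also have "(\<Sum>b\<in>E. b $ i * (\<Lambda> \<bullet> b)) = \<Lambda> $ i"
      using arg_cong[OF expand[of \<Lambda>], of "\<lambda>x. x $ i"] by (simp add: mult.commute)
    also have "(\<Sum>b\<in>E. b $ i * (\<Phi> t \<bullet> b)) = \<Phi> t $ i"
      by (rule comp[symmetric])
    finally show "?L (\<lambda>t. \<Phi> t $ i) t = Q t * ((q - 1) * (\<Lambda> $ i) * (\<Lambda> \<bullet> \<Phi> t) + \<Phi> t $ i)"
      by (simp add: mult_ac)
  qed
qed

lemma slow_basis:
  assumes "\<theta> = 1 \<or> \<theta> = q"
  shows "\<exists>u. indexed_basis {..<2::nat} u {f \<in> mode_functions (upper_root 0) (lower_root 0) (potential \<theta>). lin_growth f}"
proof -
  interpret mode_equation "upper_root 0" "lower_root 0" P "potential \<theta>"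
    by (rule mode_equation_instance) (use assms constants(3) in auto)
  show ?thesis
    using assms bounded_solution_perp bounded_solution_par bounded_solution_gives_slow_basis by blast
qed

lemma hyperbolic_basis:
  assumes "\<theta> = 1 \<or> \<theta> = q" and l: "real n - 1 \<le> l"
  shows "\<exists>u. indexed_basis {..<4::nat} u (mode_functions (upper_root l) (lower_root l) (potential \<theta>)) \<and>
    (\<forall>i<4. forward_growing (u i) \<or> forward_growing (\<lambda>t. u i (- t)))"
proof -
  have \<theta>: "0 < \<theta>" "\<theta> \<le> q" using assms(1) constants(3) by auto
  interpret mode_equation "upper_root l" "lower_root l" P "potential \<theta>"
    by (rule mode_equation_instance) (use l n \<theta> in auto)
  show ?thesis
    by (rule no_bounded_solution_gives_hyperbolic_basis) (rule no_bounded_solution[OF l \<theta>])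
qed

lemma lin_growth_shift_iff: "lin_growth (\<lambda>t. f (t - c)) \<longleftrightarrow> lin_growth f"
  using lin_growth_shift[of f "- c"] lin_growth_shift[of "\<lambda>t. f (t - c)" c] by auto

text \<open>The bound \<open>at_most_linear\<close> can be tested on components, so the space is a product of two-dimensional
  scalar spaces, one for each vector of an orthonormal basis that contains \<open>\<Lambda>\<close>.\<close>
theorem zero_mode_basis:
  fixes \<Lambda> :: "real ^ 'p"
  assumes "norm \<Lambda> = 1"
  shows "\<exists>B. solution_basis B {\<Phi> \<in> mode_solutions n \<Lambda> (\<lambda>t. v (t + T)) 0. at_most_linear \<Phi>} \<and> card B = 2 * CARD('p)"
proof -
  obtain E where E: "\<Lambda> \<in> E" "pairwise orthogonal E" "\<And>b. b \<in> E \<Longrightarrow> norm b = 1"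
    "independent E" "card E = DIM(real ^ 'p)" "span E = UNIV"
    using vector_in_orthonormal_basis[OF assms] by metis
  have fin: "finite E" using E(4) by (rule finiteI_independent)
  let ?S = "\<lambda>b. {f \<in> mode_functions (upper_root 0) (lower_root 0) (potential (direction_weight \<Lambda> b)). lin_growth f}"
  have "\<forall>b. \<exists>u. indexed_basis {..<2::nat} u (?S b)"
    using slow_basis by (simp add: direction_weight_def)
  then obtain u where u: "\<And>b. indexed_basis {..<2::nat} (u b) (?S b)" by metis
  let ?U = "\<lambda>(b, i) t. u b i (t + T) *\<^sub>R b"
  have "indexed_basis (E \<times> {..<2}) ?U {\<Phi>. \<forall>b\<in>E. (\<lambda>t. \<Phi> t \<bullet> b) \<in> {f. (\<lambda>t. f (t - T)) \<in> ?S b}}"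
    using indexed_basis_vector[OF fin E(2,3,6) indexed_basis_shift[OF u]] by simp
  moreover have "{\<Phi>. \<forall>b\<in>E. (\<lambda>t. \<Phi> t \<bullet> b) \<in> {f. (\<lambda>t. f (t - T)) \<in> ?S b}}
      = {\<Phi> \<in> mode_solutions n \<Lambda> (\<lambda>t. v (t + T)) 0. at_most_linear \<Phi>}"
  proof -
    have "(\<lambda>t. f (t - T)) \<in> ?S b \<longleftrightarrow>
        f \<in> mode_functions (upper_root 0) (lower_root 0) (\<lambda>t. potential (direction_weight \<Lambda> b) (t + T)) \<and> lin_growth f" for f b
      by (simp add: mode_functions_shift lin_growth_shift_iff)
    note comps = this
    have "at_most_linear \<Phi> \<longleftrightarrow> (\<forall>b\<in>E. lin_growth (\<lambda>t. \<Phi> t \<bullet> b))"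
      if "\<Phi> \<in> mode_solutions n \<Lambda> (\<lambda>t. v (t + T)) 0" for \<Phi>
    proof (rule at_most_linear_iff[OF fin E(2,3,6)])
      show "continuous_on UNIV (\<lambda>t. \<Phi> t \<bullet> b)" if "b \<in> E" for b
        by (rule mode_functions_continuous)
          (rule bspec[OF iffD1[OF mode_solutions_iff[OF fin E(2,3,6,1) order_refl] \<open>\<Phi> \<in> _\<close>] that])
    qed
    then show ?thesis
      unfolding set_eq_iff mem_Collect_eq[of _ "\<lambda>f. (\<lambda>t. f (t - T)) \<in> _"] comps
      using mode_solutions_iff[OF fin E(2,3,6,1) order_refl, of _ T] by blast
  qed
  ultimately have B: "indexed_basis (E \<times> {..<2}) ?U {\<Phi> \<in> mode_solutions n \<Lambda> (\<lambda>t. v (t + T)) 0. at_most_linear \<Phi>}"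
    by simp
  show ?thesis
    using indexed_basis_imp_solution_basis[OF B] E(5)
    by (intro exI[of _ "?U ` (E \<times> {..<2})"]) (simp add: card_cartesian_product)
qed

text \<open>Each basis element is a scalar solution times a unit vector, so its norm inherits the growth and
  the decay of the scalar solution.\<close>
theorem higher_mode_basis:
  fixes \<Lambda> :: "real ^ 'p"
  assumes "norm \<Lambda> = 1" and l: "real n - 1 \<le> l"
  shows "\<exists>B. solution_basis B (mode_solutions n \<Lambda> (\<lambda>t. v (t + T)) l) \<and> card B = 4 * CARD('p) \<and>
    (\<forall>\<Phi>\<in>B. (exp_growing at_top \<Phi> \<and> exp_decaying at_bot \<Phi>) \<or> (exp_decaying at_top \<Phi> \<and> exp_growing at_bot \<Phi>))"
proof -
  obtain E where E: "\<Lambda> \<in> E" "pairwise orthogonal E" "\<And>b. b \<in> E \<Longrightarrow> norm b = 1"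
    "independent E" "card E = DIM(real ^ 'p)" "span E = UNIV"
    using vector_in_orthonormal_basis[OF assms(1)] by metis
  have fin: "finite E" using E(4) by (rule finiteI_independent)
  have l0: "0 \<le> l" using l n by simp
  let ?S = "\<lambda>b. mode_functions (upper_root l) (lower_root l) (potential (direction_weight \<Lambda> b))"
  have "\<forall>b. \<exists>u. indexed_basis {..<4::nat} u (?S b) \<and> (\<forall>i<4. forward_growing (u i) \<or> forward_growing (\<lambda>t. u i (- t)))"
    using hyperbolic_basis[OF _ l] by (simp add: direction_weight_def)
  then obtain u where u: "\<And>b. indexed_basis {..<4::nat} (u b) (?S b)"
    and gr: "\<And>b i. i < 4 \<Longrightarrow> forward_growing (u b i) \<or> forward_growing (\<lambda>t. u b i (- t))" by metis
  let ?U = "\<lambda>(b, i) t. u b i (t + T) *\<^sub>R b"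
  have "indexed_basis (E \<times> {..<4}) ?U {\<Phi>. \<forall>b\<in>E. (\<lambda>t. \<Phi> t \<bullet> b) \<in> {f. (\<lambda>t. f (t - T)) \<in> ?S b}}"
    using indexed_basis_vector[OF fin E(2,3,6) indexed_basis_shift[OF u]] by simp
  moreover have "{\<Phi>. \<forall>b\<in>E. (\<lambda>t. \<Phi> t \<bullet> b) \<in> {f. (\<lambda>t. f (t - T)) \<in> ?S b}} = mode_solutions n \<Lambda> (\<lambda>t. v (t + T)) l"
    using mode_solutions_iff[OF fin E(2,3,6,1) l0, of _ T] by (simp add: set_eq_iff mode_functions_shift)
  ultimately have B: "indexed_basis (E \<times> {..<4}) ?U (mode_solutions n \<Lambda> (\<lambda>t. v (t + T)) l)"
    by simp
  have "(exp_growing at_top \<Phi> \<and> exp_decaying at_bot \<Phi>) \<or> (exp_decaying at_top \<Phi> \<and> exp_growing at_bot \<Phi>)"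
    if \<Phi>: "\<Phi> \<in> ?U ` (E \<times> {..<4})" for \<Phi>
  proof -
    obtain b i where bi: "b \<in> E" "i < 4" "\<Phi> = (\<lambda>t. u b i (t + T) *\<^sub>R b)" using \<Phi> by auto
    have nm: "norm (\<Phi> t) = \<bar>u b i (t + T)\<bar>" for t using E(3)[OF bi(1)] by (simp add: bi(3))
    show ?thesis
      using gr[OF bi(2), of b] forward_growing_exp[of "u b i" \<Phi> T, OF _ nm] backward_growing_exp[of "u b i" \<Phi> T, OF _ nm] by blast
  qed
  then show ?thesis
    using indexed_basis_imp_solution_basis[OF B] E(5)
    by (intro exI[of _ "?U ` (E \<times> {..<4})"]) (simp add: card_cartesian_product)
qed

end

lemma emden_fowler_periodic_profile:
  assumes v: "emden_fowler n a v" and n: "5 \<le> n"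
  obtains P where "periodic_profile n v (deriv v) ((deriv ^^ 2) v) ((deriv ^^ 3) v) P"
proof -
  have ef: "ef_profile n a (shooting_value n a) v" using v by (simp add: emden_fowler_def)
  then obtain P where P: "is_period v P" by (auto simp: ef_profile_def)
  have d: "((deriv ^^ k) v has_real_derivative (deriv ^^ Suc k) v t) (at t)" if "k < 4" for k t
    using ef that by (auto simp: ef_profile_def four_times_differentiable_iff)
  have eq: "(deriv ^^ 4) v t = K2 n * (deriv ^^ 2) v t - K0 n * v t + c_const n * v t powr (crit_exp n - 1)" for t
    using ef unfolding ef_profile_def by (metis (no_types, lifting) add.commute diff_add_cancel diff_diff_eq2 add_diff_eq)
  have "periodic_profile n v (deriv v) ((deriv ^^ 2) v) ((deriv ^^ 3) v) P"
  proof
    show "((deriv ^^ 3) v has_real_derivative K2 n * (deriv ^^ 2) v t - K0 n * v t + c_const n * v t powr (crit_exp n - 1)) (at t)" for t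
      using d[of 3 t] eq[of t] by (simp add: eval_nat_numeral)
    show "(v has_real_derivative deriv v t) (at t)" "(deriv v has_real_derivative (deriv ^^ 2) v t) (at t)"
      "((deriv ^^ 2) v has_real_derivative (deriv ^^ 3) v t) (at t)" for t
      using d[of 0 t] d[of 1 t] d[of 2 t] by (simp_all add: eval_nat_numeral)
  qed (use ef P n in \<open>auto simp: ef_profile_def is_period_def\<close>)
  then show ?thesis by (rule that)
qed

theorem proposition8:
  fixes a T Ta :: real and v :: "real \<Rightarrow> real" and \<Lambda> :: "real ^ 'p" and ev :: "nat \<Rightarrow> real"
  assumes dim: "CARD('n::finite) \<ge> 5"
    and a: "0 < a" "a \<le> a0 CARD('n)"
    and v: "emden_fowler CARD('n) a v"
    and Ta: "a < a0 CARD('n) \<Longrightarrow> is_fundamental_period v Ta"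
    and T: "0 < T" "T \<le> Ta"
    and \<Lambda>: "norm \<Lambda> = 1" "\<And>i. 0 < \<Lambda> $ i"
    and ev: "sphere_eigenvalues TYPE(real ^ 'n) ev"
  shows "(\<exists>B. solution_basis B {\<Phi> \<in> mode_solutions CARD('n) \<Lambda> (\<lambda>t. v (t + T)) (ev 0). at_most_linear \<Phi>}
              \<and> card B = 2 * CARD('p)
              \<and> (\<forall>\<Phi>\<in>B. bounded (range \<Phi>) \<or> at_most_linear \<Phi>))
       \<and> (\<forall>j\<ge>1. \<exists>B. solution_basis B (mode_solutions CARD('n) \<Lambda> (\<lambda>t. v (t + T)) (ev j))
              \<and> card B = 4 * CARD('p)
              \<and> (\<forall>\<Phi>\<in>B. (exp_growing at_top \<Phi> \<and> exp_decaying at_bot \<Phi>)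
                      \<or> (exp_decaying at_top \<Phi> \<and> exp_growing at_bot \<Phi>)))"
proof -
  obtain P where "periodic_profile CARD('n) v (deriv v) ((deriv ^^ 2) v) ((deriv ^^ 3) v) P"
    using emden_fowler_periodic_profile[OF v dim] .
  then interpret periodic_profile "CARD('n)" v "deriv v" "(deriv ^^ 2) v" "(deriv ^^ 3) v" P .
  have ev0: "ev 0 = 0" and ev1: "ev 1 = real CARD('n) - 1" and mono: "mono ev"
    using ev dim by (auto simp: sphere_eigenvalues_def)
  have evj: "real CARD('n) - 1 \<le> ev j" if "1 \<le> j" for j using monoD[OF mono that] ev1 by simp
  obtain B where B: "solution_basis B {\<Phi> \<in> mode_solutions CARD('n) \<Lambda> (\<lambda>t. v (t + T)) 0. at_most_linear \<Phi>}"
    "card B = 2 * CARD('p)"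
    using zero_mode_basis[OF \<Lambda>(1)] by blast
  have "at_most_linear \<Phi>" if "\<Phi> \<in> B" for \<Phi>
    using B(1) fun_vs.span_base[OF that] by (auto simp: solution_basis_def)
  then show ?thesis using B higher_mode_basis[OF \<Lambda>(1) evj] unfolding ev0 by blast
qed

end
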